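(* Let $\mathcal{C}$ be an algebraically closed field with $\mathrm{char}(\mathcal{C})=0$, $(\mathcal{E},o)$ an elliptic curve over $\mathcal{C}$ with function field $\mathcal{K}$, $s\in\mathcal{E}(\mathcal{C})$ a non-torsion point, and $\tau$ the automorphism of $\mathcal{K}$ induced by addition by $s$. Let $0\neq\varpi\in H^0(\mathcal{E},\Omega^1_{\mathcal{E}/\mathcal{C}})$ and let $\delta$ be the derivation on $\mathcal{K}$ with $df=\delta(f)\varpi$ for all $f\in\mathcal{K}$. Let $\mathcal{R}=\{\alpha_\omega\}_{\omega\in\mathcal{E}/\tau}$ be a set of $\tau$-orbit representatives in $\mathcal{E}(\mathcal{C})$, and let $a\in\mathcal{K}^\times$. Then $\delta(a)/a$ is summable if and only if the following conditions hold: (1) $\displaystyle\sum_{\alpha\in\omega}\nu_\alpha(a)=0$ for each $\omega\in\mathcal{E}/\tau$; and (2) $\displaystyle\sum_{\omega\in\mathcal{E}/\tau}\sum_{n\in\mathbb{Z}}n\cdot\nu_{\alpha_\omega\oplus ns}(a)=0$.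
   Context: $\oplus$ is the group law of $\mathcal{E}$; $\nu_\alpha$ is the valuation of $\mathcal{K}=\mathcal{C}(\mathcal{E})$ at $\alpha\in\mathcal{E}(\mathcal{C})$; $\tau$ is the $\mathcal{C}$-linear automorphism of $\mathcal{K}$ induced by $\alpha\mapsto\alpha\oplus s$, so $\nu_\alpha(\tau(f))=\nu_{\alpha\oplus s}(f)$. $\mathcal{E}/\tau$ is the set of cosets (orbits) of $\mathbb{Z}s$ in $\mathcal{E}(\mathcal{C})$; a set of $\tau$-orbit representatives is a choice of one $\alpha_\omega\in\omega$ for each $\omega\in\mathcal{E}/\tau$. An element $f\in\mathcal{K}$ is summable if $f=\tau(g)-g$ for some $g\in\mathcal{K}$. *)

theory Defs
  imports "HOL-Computational_Algebra.Polynomial" "HOL-Library.Poly_Mapping"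
begin

section \<open>Bivariate polynomials\<close>

text \<open>
  An element of \<open>'a poly poly\<close> is a polynomial in \<open>X\<close> (inner variable) and \<open>Y\<close> (outer variable).
  \<open>eval2 h p u v\<close> is the value of \<open>p\<close> at \<open>X = u\<close>, \<open>Y = v\<close> with coefficients mapped through \<open>h\<close>.
\<close>
definition eval2 :: "('a::zero \<Rightarrow> 'b::comm_ring_1) \<Rightarrow> 'a poly poly \<Rightarrow> 'b \<Rightarrow> 'b \<Rightarrow> 'b" where
  "eval2 h p u v = poly (map_poly (\<lambda>q. poly (map_poly h q) u) p) v"


section \<open>Elliptic curves and their group law\<close>

text \<open>
  Elliptic curves are nonsingular plane projective cubics in general Weierstrass form
  \<open>y\<^sup>2 + a\<^sub>1 x y + a\<^sub>3 y = x\<^sup>3 + a\<^sub>2 x\<^sup>2 + a\<^sub>4 x + a\<^sub>6\<close>, whose origin is the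
  unique point \<open>[0:1:0]\<close> at infinity.
\<close>
record 'c weierstrass =
  a1 :: 'c
  a2 :: 'c
  a3 :: 'c
  a4 :: 'c
  a6 :: 'c

datatype 'c point = Origin | Affine 'c 'c

definition weierstrass_poly :: "'c::comm_ring_1 weierstrass \<Rightarrow> 'c poly poly" where
  "weierstrass_poly E = [: - [: a6 E, a4 E, a2 E, 1 :], [: a3 E, a1 E :], 1 :]"

fun on_curve :: "'c::comm_ring_1 weierstrass \<Rightarrow> 'c point \<Rightarrow> bool" where
  "on_curve E Origin = True"
| "on_curve E (Affine x y) =
     (y^2 + a1 E * x * y + a3 E * y = x^3 + a2 E * x^2 + a4 E * x + a6 E)"

definition curve_points :: "'c::comm_ring_1 weierstrass \<Rightarrow> 'c point set" where
  "curve_points E = {P. on_curve E P}"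

text \<open>
  Only affine points have to be tested for nonsingularity (by the two partial derivatives):
  the point at infinity of a Weierstrass cubic is always nonsingular. Testing points over
  the coefficient field suffices because that field is algebraically closed.
\<close>
definition elliptic_curve :: "'c::alg_closed_field weierstrass \<Rightarrow> bool" where
  "elliptic_curve E \<longleftrightarrow>
     (\<forall>x y. on_curve E (Affine x y) \<longrightarrow>
        2 * y + a1 E * x + a3 E \<noteq> 0 \<or>
        a1 E * y - (3 * x^2 + 2 * a2 E * x + a4 E) \<noteq> 0)"

fun ec_neg :: "'c::comm_ring_1 weierstrass \<Rightarrow> 'c point \<Rightarrow> 'c point" where
  "ec_neg E Origin = Origin"
| "ec_neg E (Affine x y) = Affine x (- y - a1 E * x - a3 E)"

text \<open>The chord-and-tangent law; \<open>l\<close> is the slope of the chord, or of the tangent line.\<close>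
fun ec_add :: "'c::field weierstrass \<Rightarrow> 'c point \<Rightarrow> 'c point \<Rightarrow> 'c point" where
  "ec_add E Origin Q = Q"
| "ec_add E (Affine x1 y1) Origin = Affine x1 y1"
| "ec_add E (Affine x1 y1) (Affine x2 y2) =
     (if Affine x1 y1 = ec_neg E (Affine x2 y2) then Origin
      else let l = (if x1 = x2
                    then (3 * x1^2 + 2 * a2 E * x1 + a4 E - a1 E * y1) / (2 * y1 + a1 E * x1 + a3 E)
                    else (y2 - y1) / (x2 - x1));
               x3 = l^2 + a1 E * l - a2 E - x1 - x2;
               y3 = l * (x3 - x1) + y1
           in ec_neg E (Affine x3 y3))"

definition ec_multiple :: "'c::field weierstrass \<Rightarrow> int \<Rightarrow> 'c point \<Rightarrow> 'c point" where
  "ec_multiple E n P =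
     (if n \<ge> 0 then (ec_add E P ^^ nat n) Origin else ec_neg E ((ec_add E P ^^ nat (- n)) Origin))"

definition ec_torsion :: "'c::field weierstrass \<Rightarrow> 'c point \<Rightarrow> bool" where
  "ec_torsion E P \<longleftrightarrow> (\<exists>n>0. ec_multiple E n P = Origin)"

definition orbit_rel :: "'c::field weierstrass \<Rightarrow> 'c point \<Rightarrow> ('c point \<times> 'c point) set" where
  "orbit_rel E s = {(P, Q). P \<in> curve_points E \<and> Q \<in> curve_points E \<and>
                            (\<exists>n. Q = ec_add E P (ec_multiple E n s))}"


section \<open>Function field, local rings and valuations\<close>

text \<open>
  A function field of \<open>E\<close> is a field \<open>'k\<close> with an embedding of the constants and coordinate
  functions \<open>x\<close>, \<open>y\<close> that make it the fraction field of \<open>C[X,Y]/(W)\<close>, where \<open>W\<close> is the Weierstrass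
  polynomial: evaluation at \<open>(x,y)\<close> has kernel \<open>(W)\<close>, and every element is a quotient of values.
\<close>
record ('c, 'k) function_field =
  const :: "'c \<Rightarrow> 'k"
  xcoord :: 'k
  ycoord :: 'k

definition is_function_field ::
    "'c::field weierstrass \<Rightarrow> ('c, 'k::field) function_field \<Rightarrow> bool" where
  "is_function_field E K \<longleftrightarrow>
     const K 1 = 1 \<and>
     (\<forall>c d. const K (c + d) = const K c + const K d) \<and>
     (\<forall>c d. const K (c * d) = const K c * const K d) \<and>
     (\<forall>p. eval2 (const K) p (xcoord K) (ycoord K) = 0 \<longleftrightarrow> weierstrass_poly E dvd p) \<and>
     (\<forall>f. \<exists>p q. eval2 (const K) q (xcoord K) (ycoord K) \<noteq> 0 \<and>
                f = eval2 (const K) p (xcoord K) (ycoord K) / eval2 (const K) q (xcoord K) (ycoord K))"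

text \<open>
  Affine coordinates near a point: the functions \<open>x\<close>, \<open>y\<close> at affine points, and the functions
  \<open>X/Y = x/y\<close>, \<open>Z/Y = 1/y\<close>, in which \<open>[0:1:0]\<close> has coordinates \<open>(0,0)\<close>, at the origin.
\<close>
fun chart :: "('c, 'k::field) function_field \<Rightarrow> 'c point \<Rightarrow> 'k \<times> 'k" where
  "chart K Origin = (xcoord K / ycoord K, 1 / ycoord K)"
| "chart K (Affine x y) = (xcoord K, ycoord K)"

fun chart_coords :: "'c::zero point \<Rightarrow> 'c \<times> 'c" where
  "chart_coords Origin = (0, 0)"
| "chart_coords (Affine x y) = (x, y)"

text \<open>The rational function \<open>f\<close> is regular at \<open>P\<close> and takes there the value \<open>c\<close>.\<close>
definition has_value :: "('c::field, 'k::field) function_field \<Rightarrow> 'c point \<Rightarrow> 'k \<Rightarrow> 'c \<Rightarrow> bool" where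
  "has_value K P f c \<longleftrightarrow>
     (\<exists>p q. case chart K P of (u, v) \<Rightarrow> case chart_coords P of (u0, v0) \<Rightarrow>
        eval2 id q u0 v0 \<noteq> 0 \<and>
        f = eval2 (const K) p u v / eval2 (const K) q u v \<and>
        c = eval2 id p u0 v0 / eval2 id q u0 v0)"

definition local_ring :: "('c::field, 'k::field) function_field \<Rightarrow> 'c point \<Rightarrow> 'k set" where
  "local_ring K P = {f. \<exists>c. has_value K P f c}"

text \<open>
  Normalized discrete valuations. The value at \<open>0\<close>, which should be infinite, is the
  irrelevant default \<open>0\<close>.
\<close>
definition normalized_valuation :: "('k::field \<Rightarrow> int) \<Rightarrow> bool" where
  "normalized_valuation v \<longleftrightarrow>
     v 0 = 0 \<and>
     (\<forall>f g. f \<noteq> 0 \<longrightarrow> g \<noteq> 0 \<longrightarrow> v (f * g) = v f + v g) \<and>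
     (\<forall>f g. f \<noteq> 0 \<longrightarrow> g \<noteq> 0 \<longrightarrow> f + g \<noteq> 0 \<longrightarrow> v (f + g) \<ge> min (v f) (v g)) \<and>
     (\<exists>f. f \<noteq> 0 \<and> v f = 1)"

text \<open>The valuation at \<open>P\<close> is the normalized valuation whose valuation ring is the local ring at \<open>P\<close>.\<close>
definition valuation_at :: "('c::field, 'k::field) function_field \<Rightarrow> 'c point \<Rightarrow> 'k \<Rightarrow> int" where
  "valuation_at K P =
     (THE v. normalized_valuation v \<and> {f. f = 0 \<or> v f \<ge> 0} = local_ring K P)"


section \<open>Translation and summability\<close>

text \<open>
  The automorphism of the function field over the constants that pulls functions back along
  \<open>P \<mapsto> P \<oplus> s\<close>: the value of \<open>\<tau> f\<close> at \<open>P\<close> is the value of \<open>f\<close> at \<open>P \<oplus> s\<close> wherever the latter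
  is defined.
\<close>
definition translation_automorphism ::
    "'c::field weierstrass \<Rightarrow> ('c, 'k::field) function_field \<Rightarrow> 'c point \<Rightarrow> ('k \<Rightarrow> 'k) \<Rightarrow> bool" where
  "translation_automorphism E K s \<tau> \<longleftrightarrow>
     bij \<tau> \<and>
     (\<forall>f g. \<tau> (f + g) = \<tau> f + \<tau> g) \<and>
     (\<forall>f g. \<tau> (f * g) = \<tau> f * \<tau> g) \<and>
     (\<forall>c. \<tau> (const K c) = const K c) \<and>
     (\<forall>P \<in> curve_points E. \<forall>f c. has_value K (ec_add E P s) f c \<longrightarrow> has_value K P (\<tau> f) c)"

definition difference_summable :: "('k::field \<Rightarrow> 'k) \<Rightarrow> 'k \<Rightarrow> bool" where
  "difference_summable \<tau> f \<longleftrightarrow> (\<exists>g. f = \<tau> g - g)"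


section \<open>Kaehler differentials\<close>

text \<open>
  The space of differentials of the function field \<open>'k\<close> over the constants is the free vector space
  on symbols \<open>dg\<close> for \<open>g :: 'k\<close>, realized as \<open>'k \<Rightarrow>\<^sub>0 'k\<close>, modulo the subspace \<open>kaehler_relations\<close>.
  So \<open>Poly_Mapping.single g h\<close> represents \<open>h dg\<close>. Differentials are given by representatives,
  and two of them are equal if they differ by a relation. The coefficient \<open>h\<close> in the rules below
  makes the generated subgroup a subspace.
\<close>
inductive_set kaehler_relations :: "('c, 'k::field) function_field \<Rightarrow> ('k \<Rightarrow>\<^sub>0 'k) set"
  for K :: "('c, 'k) function_field" where
  zero: "0 \<in> kaehler_relations K"
| plus: "u \<in> kaehler_relations K \<Longrightarrow> v \<in> kaehler_relations K \<Longrightarrow> u + v \<in> kaehler_relations K"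
| d_add: "Poly_Mapping.single (f + g) h - Poly_Mapping.single f h - Poly_Mapping.single g h
            \<in> kaehler_relations K"
| d_mult: "Poly_Mapping.single (f * g) h - Poly_Mapping.single g (h * f)
             - Poly_Mapping.single f (h * g) \<in> kaehler_relations K"
| d_const: "Poly_Mapping.single (const K c) h \<in> kaehler_relations K"

definition differential_eq ::
    "('c, 'k::field) function_field \<Rightarrow> ('k \<Rightarrow>\<^sub>0 'k) \<Rightarrow> ('k \<Rightarrow>\<^sub>0 'k) \<Rightarrow> bool" where
  "differential_eq K u v \<longleftrightarrow> u - v \<in> kaehler_relations K"

definition differential_scale :: "'k::field \<Rightarrow> ('k \<Rightarrow>\<^sub>0 'k) \<Rightarrow> ('k \<Rightarrow>\<^sub>0 'k)" where
  "differential_scale h u = Poly_Mapping.map (\<lambda>r. h * r) u"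

definition exact_differential :: "'k::field \<Rightarrow> ('k \<Rightarrow>\<^sub>0 'k)" where
  "exact_differential f = Poly_Mapping.single f 1"

text \<open>
  The stalk at \<open>P\<close> of the sheaf of differentials of the (nonsingular) curve, inside the differentials
  of the function field, consists of the finite sums of \<open>h dg\<close> with \<open>g\<close> and \<open>h\<close> regular at \<open>P\<close>.
\<close>
definition regular_differential_at ::
    "('c::field, 'k::field) function_field \<Rightarrow> 'c point \<Rightarrow> ('k \<Rightarrow>\<^sub>0 'k) \<Rightarrow> bool" where
  "regular_differential_at K P u \<longleftrightarrow>
     (\<exists>(n::nat) g h. (\<forall>i<n. g i \<in> local_ring K P \<and> h i \<in> local_ring K P) \<and>
        differential_eq K u (\<Sum>i<n. Poly_Mapping.single (g i) (h i)))"

text \<open>Representatives of the elements of \<open>H\<^sup>0(E, \<Omega>\<^sup>1)\<close>.\<close>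
definition global_differentials ::
    "'c::field weierstrass \<Rightarrow> ('c, 'k::field) function_field \<Rightarrow> ('k \<Rightarrow>\<^sub>0 'k) set" where
  "global_differentials E K = {u. \<forall>P \<in> curve_points E. regular_differential_at K P u}"


section \<open>Sums with finite support\<close>

text \<open>
  Unlike \<^const>\<open>sum\<close>, this gives the intended value on infinite index sets if only finitely many terms
  are nonzero.
\<close>
definition finsupp_sum :: "('a \<Rightarrow> 'b::comm_monoid_add) \<Rightarrow> 'a set \<Rightarrow> 'b" where
  "finsupp_sum f A = sum f {x \<in> A. f x \<noteq> 0}"

end

(*
Let D be the derivation dual to the invariant differential dx / (2y + a1 x + a3); delta is a nonzero
constant multiple of it, because a function without poles is constant. The function D(a)/a has at
most simple poles, and its residue at alpha is nu_alpha(a). If D(a)/a = tau(g) - g, then g has only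
simple poles as well, so nu_alpha(a) = r(alpha + s) - r(alpha) for the residues r of g; summing along
orbits gives (1), and (2) is the residue theorem, sum r = 0.

Conversely, (1) and (2) say that nu(a) = b(alpha + s) - b(alpha) for some finitely supported b with
sum 0. Choose g with simple poles and residues b; then tau(g) - g - D(a)/a is a constant c. Negation
on the curve turns this equation into a similar one with -c, and c = 0 results by comparing them.
*)

theory Submission
  imports Defs
begin

section \<open>Evaluation of bivariate polynomials\<close>

text \<open>Values, valuations and the group law are defined by coordinates, so even the basic facts
  have to be derived: local rings are discrete valuation rings, functions have finitely many zeros,
  the chord law is a group. The means are the normal form p(x) + q(x) y with its norm in C[x], and
  the parity of pole orders at infinity (even for p(x), odd for q(x) y). Parity yields a Liouville
  theorem that excludes even a single simple pole at the origin. It takes the place of Riemann-Roch: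
  points are determined by their divisor classes, and subtracting explicit functions with poles at
  \<alpha> and the origin proves the residue theorem. Residues of tau(g) can be compared with those
  of g only if translation preserves the invariant differential. General arguments preserve it up to
  a constant factor; the factor is 1 because translation and negation agree on one explicit function
  with simple poles at s and the origin. The constant c in the converse is invisible to residues;
  reflection makes 2c the logarithmic derivative of a function without zeros and poles.\<close>

locale field_embedding =
  fixes h :: "'c::field \<Rightarrow> 'k::field"
  assumes h_1 [simp]: "h 1 = 1"
    and h_add [simp]: "h (a + b) = h a + h b"
    and h_mult [simp]: "h (a * b) = h a * h b"
begin

lemma h_0 [simp]: "h 0 = 0"
proof -
  have "h 0 + h 0 = h 0 + 0" by (simp flip: h_add)
  then show ?thesis by (rule add_left_imp_eq)
qed

lemma h_minus [simp]: "h (- a) = - h a"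
  using h_add[of "- a" a] by (simp add: eq_neg_iff_add_eq_0)

lemma h_diff [simp]: "h (a - b) = h a - h b"
  using h_add[of a "- b"] by simp

lemma h_power [simp]: "h (a ^ n) = h a ^ n"
  by (induction n) auto

lemma h_of_nat [simp]: "h (of_nat n) = of_nat n"
  by (induction n) auto

lemma h_of_int [simp]: "h (of_int n) = of_int n"
  by (cases n rule: int_cases2) auto

lemma h_numeral [simp]: "h (numeral n) = numeral n"
  using h_of_nat[of "numeral n"] by simp

lemma h_eq_0_iff [simp]: "h a = 0 \<longleftrightarrow> a = 0"
proof
  assume "h a = 0"
  then have "h (a * inverse a) = 0" by (simp only: h_mult mult_zero_left)
  then show "a = 0" by (cases "a = 0") auto
qed simp

lemma h_eq_iff [simp]: "h a = h b \<longleftrightarrow> a = b"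
  using h_eq_0_iff[of "a - b"] by simp

lemma h_inverse [simp]: "h (inverse a) = inverse (h a)"
proof (cases "a = 0")
  case False
  then have "h a * h (inverse a) = 1" by (simp flip: h_mult)
  then show ?thesis by (metis inverse_unique)
qed simp

lemma h_divide [simp]: "h (a / b) = h a / h b"
  by (simp add: divide_inverse)

definition ev1 :: "'k \<Rightarrow> 'c poly \<Rightarrow> 'k" where
  "ev1 u p = poly (map_poly h p) u"

lemma ev1_0 [simp]: "ev1 u 0 = 0"
  by (simp add: ev1_def)

lemma ev1_pCons [simp]: "ev1 u (pCons a p) = h a + u * ev1 u p"
  by (simp add: ev1_def map_poly_pCons)

lemma ev1_add [simp]: "ev1 u (p + q) = ev1 u p + ev1 u q"
  by (induction p q rule: poly_induct2) (simp_all add: algebra_simps)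

lemma ev1_smult [simp]: "ev1 u (smult a p) = h a * ev1 u p"
  by (induction p) (simp_all add: algebra_simps)

lemma ev1_mult [simp]: "ev1 u (p * q) = ev1 u p * ev1 u q"
  by (induction p) (simp_all add: algebra_simps)

lemma ev1_minus [simp]: "ev1 u (- p) = - ev1 u p"
  using ev1_smult[of u "-1" p] by (simp del: ev1_smult)

lemma ev1_diff [simp]: "ev1 u (p - q) = ev1 u p - ev1 u q"
  using ev1_add[of u p "- q"] by simp

lemma ev1_1 [simp]: "ev1 u 1 = 1"
  by (simp add: one_pCons)

lemma ev1_power [simp]: "ev1 u (p ^ n) = ev1 u p ^ n"
  by (induction n) auto

lemma eval2_0 [simp]: "eval2 h 0 u v = 0"
  by (simp add: eval2_def)

lemma eval2_pCons [simp]: "eval2 h (pCons q p) u v = ev1 u q + v * eval2 h p u v"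
  by (simp add: eval2_def map_poly_pCons ev1_def)

lemma eval2_add [simp]: "eval2 h (p + q) u v = eval2 h p u v + eval2 h q u v"
  by (induction p q rule: poly_induct2) (simp_all add: algebra_simps)

lemma eval2_smult [simp]: "eval2 h (smult a p) u v = ev1 u a * eval2 h p u v"
  by (induction p) (simp_all add: algebra_simps)

lemma eval2_mult [simp]: "eval2 h (p * q) u v = eval2 h p u v * eval2 h q u v"
  by (induction p) (simp_all add: algebra_simps)

lemma eval2_minus [simp]: "eval2 h (- p) u v = - eval2 h p u v"
  using eval2_smult[of "-1" p u v] by (simp del: eval2_smult)

lemma eval2_diff [simp]: "eval2 h (p - q) u v = eval2 h p u v - eval2 h q u v"
  using eval2_add[of p "- q" u v] by simp

lemma eval2_1 [simp]: "eval2 h 1 u v = 1"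
  by (simp add: one_pCons)

end

interpretation idc: field_embedding "id :: 'c::field \<Rightarrow> 'c"
  by unfold_locales auto

lemma idc_ev1 [simp]: "idc.ev1 u p = poly p u"
  by (simp add: idc.ev1_def)


section \<open>Values of functions in a chart\<close>

text \<open>\<open>vanish\<close> is the well-definedness of evaluation at the point: a polynomial
  expression that is zero as a function is zero there. The calculus of values rests on it alone, so
  affine points and the point at infinity can share it.\<close>

locale chart_loc = field_embedding h for h :: "'c::field \<Rightarrow> 'k::field" +
  fixes u v :: 'k and u0 v0 :: 'c
  assumes vanish: "eval2 h p u v = 0 \<Longrightarrow> eval2 id p u0 v0 = 0"
begin

definition val :: "'k \<Rightarrow> 'c \<Rightarrow> bool" where
  "val f c \<longleftrightarrow> (\<exists>p q. eval2 id q u0 v0 \<noteq> 0 \<and> f = eval2 h p u v / eval2 h q u v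
      \<and> c = eval2 id p u0 v0 / eval2 id q u0 v0)"

lemma denom_nz: "eval2 id q u0 v0 \<noteq> 0 \<Longrightarrow> eval2 h q u v \<noteq> 0"
  using vanish by blast

lemma val_unique: assumes "val f c" "val f d" shows "c = d"
proof -
  obtain p q where 1: "eval2 id q u0 v0 \<noteq> 0" "f = eval2 h p u v / eval2 h q u v"
      "c = eval2 id p u0 v0 / eval2 id q u0 v0" using assms(1) unfolding val_def by blast
  obtain p' q' where 2: "eval2 id q' u0 v0 \<noteq> 0" "f = eval2 h p' u v / eval2 h q' u v"
      "d = eval2 id p' u0 v0 / eval2 id q' u0 v0" using assms(2) unfolding val_def by blast
  have "eval2 h (p * q' - p' * q) u v = 0"
    using trans[OF 1(2)[symmetric] 2(2)] denom_nz[OF 1(1)] denom_nz[OF 2(1)]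
    by (simp add: frac_eq_eq)
  then have "eval2 id (p * q' - p' * q) u0 v0 = 0" by (rule vanish)
  then show ?thesis unfolding 1(3) 2(3) using 1(1) 2(1) by (simp add: field_simps)
qed

lemma val_poly: "val (eval2 h p u v) (eval2 id p u0 v0)"
  unfolding val_def by (rule exI[of _ p], rule exI[of _ 1]) simp

lemma val_u: "val u u0"
  using val_poly[of "[:[:0,1:]:]"] by simp

lemma val_v: "val v v0"
  using val_poly[of "[:0,1:]"] by simp

lemma val_const: "val (h c) c"
  using val_poly[of "[:[:c:]:]"] by simp

lemma val_0: "val 0 0" and val_1: "val 1 1"
  using val_const[of 0] val_const[of 1] by simp_all

lemma val_add: assumes "val f c" "val g d" shows "val (f + g) (c + d)"
proof -
  obtain p q where 1: "eval2 id q u0 v0 \<noteq> 0" "f = eval2 h p u v / eval2 h q u v"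
      "c = eval2 id p u0 v0 / eval2 id q u0 v0" using assms(1) unfolding val_def by blast
  obtain p' q' where 2: "eval2 id q' u0 v0 \<noteq> 0" "g = eval2 h p' u v / eval2 h q' u v"
      "d = eval2 id p' u0 v0 / eval2 id q' u0 v0" using assms(2) unfolding val_def by blast
  show ?thesis unfolding val_def
    by (rule exI[of _ "p * q' + p' * q"], rule exI[of _ "q * q'"])
      (unfold 1(2,3) 2(2,3), use 1(1) 2(1) denom_nz[OF 1(1)] denom_nz[OF 2(1)] in \<open>simp add: field_simps\<close>)
qed

lemma val_mult: assumes "val f c" "val g d" shows "val (f * g) (c * d)"
proof -
  obtain p q where 1: "eval2 id q u0 v0 \<noteq> 0" "f = eval2 h p u v / eval2 h q u v"
      "c = eval2 id p u0 v0 / eval2 id q u0 v0" using assms(1) unfolding val_def by blast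
  obtain p' q' where 2: "eval2 id q' u0 v0 \<noteq> 0" "g = eval2 h p' u v / eval2 h q' u v"
      "d = eval2 id p' u0 v0 / eval2 id q' u0 v0" using assms(2) unfolding val_def by blast
  show ?thesis unfolding val_def
    by (rule exI[of _ "p * p'"], rule exI[of _ "q * q'"]) (use 1 2 in simp)
qed

lemma val_inverse: assumes "val f c" "c \<noteq> 0" shows "val (inverse f) (inverse c)"
proof -
  obtain p q where 1: "eval2 id q u0 v0 \<noteq> 0" "f = eval2 h p u v / eval2 h q u v"
      "c = eval2 id p u0 v0 / eval2 id q u0 v0" using assms(1) unfolding val_def by blast
  show ?thesis unfolding val_def
    by (rule exI[of _ q], rule exI[of _ p]) (use 1 assms(2) in auto)
qed

lemma val_minus: "val f c \<Longrightarrow> val (- f) (- c)"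
  using val_mult[OF val_const[of "-1"], of f c] by simp

lemma val_diff: "val f c \<Longrightarrow> val g d \<Longrightarrow> val (f - g) (c - d)"
  using val_add[of f c "- g" "- d"] val_minus by simp

lemma val_divide: "val f c \<Longrightarrow> val g d \<Longrightarrow> d \<noteq> 0 \<Longrightarrow> val (f / g) (c / d)"
  by (simp add: divide_inverse val_mult val_inverse)

lemma val_power: "val f c \<Longrightarrow> val (f ^ n) (c ^ n)"
  by (induction n) (auto intro: val_mult val_1)

lemma val_nz: "val f c \<Longrightarrow> c \<noteq> 0 \<Longrightarrow> f \<noteq> 0"
  using val_unique val_0 by blast

lemma val_ev1: "val U c \<Longrightarrow> val (ev1 U p) (poly p c)"
  by (induction p) (auto intro: val_add val_mult val_const val_0)

lemma val_eval2: "val U c \<Longrightarrow> val V d \<Longrightarrow> val (eval2 h p U V) (eval2 id p c d)"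
  by (induction p) (auto intro: val_add val_mult val_const val_0 val_ev1)

end

text \<open>What makes the local ring a discrete valuation ring with uniformizer \<open>t\<close> is
  \<open>decomp\<close>; the valuation is read off from it.\<close>

locale place_loc = chart_loc h u v u0 v0
  for h :: "'c::field \<Rightarrow> 'k::field" and u v u0 v0 +
  fixes t :: 'k
  assumes t_nz [simp]: "t \<noteq> 0" and val_t: "val t 0"
    and decomp: "f \<noteq> 0 \<Longrightarrow> \<exists>n e c. f = t powi n * e \<and> val e c \<and> c \<noteq> 0"
begin

lemma val_t_pow: "n > 0 \<Longrightarrow> val (t powi n) 0"
proof -
  assume "n > 0"
  then obtain k where k: "n = int (Suc k)" by (metis gr0_implies_Suc zero_less_imp_eq_int)
  show ?thesis using val_power[OF val_t, of "Suc k"] unfolding k power_int_of_nat by simp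
qed

lemma decomp_unique_aux:
  assumes "t powi n * e = t powi m * e'" "val e c" "c \<noteq> 0" "val e' c'" "c' \<noteq> 0"
  shows "n \<le> m"
proof (rule ccontr)
  assume "\<not> n \<le> m"
  then have "val (t powi (n - m) * e) (0 * c)"
    by (intro val_mult assms val_t_pow) simp
  moreover have "t powi (n - m) * e = e'"
    using assms(1) by (simp add: power_int_diff field_simps)
  ultimately show False using assms(4,5) val_unique by fastforce
qed

lemma decomp_unique:
  assumes "t powi n * e = t powi m * e'" "val e c" "c \<noteq> 0" "val e' c'" "c' \<noteq> 0"
  shows "n = m"
  using decomp_unique_aux[OF assms] decomp_unique_aux[OF assms(1)[symmetric] assms(4,5,2,3)] by simp

definition ord :: "'k \<Rightarrow> int" where
  "ord f = (if f = 0 then 0 else (THE n. \<exists>e c. f = t powi n * e \<and> val e c \<and> c \<noteq> 0))"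

lemma ord_0 [simp]: "ord 0 = 0"
  by (simp add: ord_def)

lemma ordI: assumes "f = t powi n * e" "val e c" "c \<noteq> 0" shows "ord f = n"
proof -
  have "f \<noteq> 0" using assms val_nz by auto
  moreover have "(THE n. \<exists>e c. f = t powi n * e \<and> val e c \<and> c \<noteq> 0) = n"
    using assms decomp_unique by (intro the_equality) blast+
  ultimately show ?thesis by (simp add: ord_def)
qed

lemma ordE: assumes "f \<noteq> 0"
  obtains e c where "f = t powi (ord f) * e" "val e c" "c \<noteq> 0" "e \<noteq> 0"
  using decomp[OF assms] ordI val_nz by metis

lemma ord_unit: "val e c \<Longrightarrow> c \<noteq> 0 \<Longrightarrow> ord e = 0"
  using ordI[of e 0 e c] by simp

lemma ord_t [simp]: "ord t = 1"
  using ordI[of t 1 1 1] val_1 by simp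

lemma ord_const [simp]: "ord (h c) = 0"
  using ord_unit[OF val_const[of c]] by (cases "c = 0") auto

lemma ord_mult: assumes "f \<noteq> 0" "g \<noteq> 0" shows "ord (f * g) = ord f + ord g"
proof -
  obtain e c where 1: "f = t powi (ord f) * e" "val e c" "c \<noteq> 0" using ordE[OF assms(1)] by metis
  obtain e' c' where 2: "g = t powi (ord g) * e'" "val e' c'" "c' \<noteq> 0" using ordE[OF assms(2)] by metis
  show ?thesis
  proof (rule ordI)
    show "f * g = t powi (ord f + ord g) * (e * e')"
      by (subst 1(1), subst 2(1)) (simp add: power_int_add)
    show "val (e * e') (c * c')" by (intro val_mult 1 2)
  qed (use 1 2 in auto)
qed

lemma val_ord_nonneg: assumes "f \<noteq> 0" "val f c" shows "ord f \<ge> 0"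
proof (rule ccontr)
  assume neg: "\<not> ord f \<ge> 0"
  obtain e d where 1: "f = t powi (ord f) * e" "val e d" "d \<noteq> 0" using ordE[OF assms(1)] by metis
  have "val (t powi (- ord f) * f) (0 * c)" using neg by (intro val_mult assms val_t_pow) simp
  moreover have "t powi (- ord f) * f = e" by (subst (2) 1(1)) (simp add: power_int_minus)
  ultimately show False using 1 val_unique by fastforce
qed

lemma ord_pos_val: assumes "f \<noteq> 0" "ord f > 0" shows "val f 0"
proof -
  obtain e d where 1: "f = t powi (ord f) * e" "val e d" "d \<noteq> 0" using ordE[OF assms(1)] by metis
  show ?thesis using val_mult[OF val_t_pow[OF assms(2)] 1(2)] 1(1) by simp
qed

lemma val_iff_ord: "(\<exists>c. val f c) \<longleftrightarrow> f = 0 \<or> ord f \<ge> 0"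
proof (cases "f = 0")
  case False
  then show ?thesis
  proof (cases "ord f = 0")
    case True
    then show ?thesis using ordE[OF False] by (metis order_refl power_int_0_right mult_1)
  qed (use val_ord_nonneg ord_pos_val in force)
qed (use val_0 in auto)

lemma val_0_iff_ord: "f \<noteq> 0 \<Longrightarrow> val f 0 \<longleftrightarrow> ord f > 0"
  using ord_pos_val val_ord_nonneg ordE
  by (metis less_le mult_1 power_int_0_right val_unique)

lemma ord_inverse: "ord (inverse f) = - ord f"
proof (cases "f = 0")
  case False
  then have "ord (f * inverse f) = ord f + ord (inverse f)" by (intro ord_mult) auto
  then show ?thesis using False ord_unit[OF val_1] by simp
qed simp

lemma ord_divide: "f \<noteq> 0 \<Longrightarrow> g \<noteq> 0 \<Longrightarrow> ord (f / g) = ord f - ord g"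
  by (simp add: divide_inverse ord_mult ord_inverse)

lemma ord_power: "f \<noteq> 0 \<Longrightarrow> ord (f ^ n) = int n * ord f"
proof (induction n)
  case 0
  then show ?case using ord_unit[OF val_1] by simp
qed (simp add: ord_mult algebra_simps)

lemma ord_power_int: "f \<noteq> 0 \<Longrightarrow> ord (f powi n) = n * ord f"
  by (cases n rule: int_cases2) (auto simp: ord_power ord_inverse power_int_minus)

lemma ord_minus [simp]: "ord (- f) = ord f"
  using ord_mult[of "h (-1)" f] ord_const[of "-1"] by (cases "f = 0") auto

lemma ord_add: assumes "f \<noteq> 0" "g \<noteq> 0" "f + g \<noteq> 0" shows "ord (f + g) \<ge> min (ord f) (ord g)"
proof -
  define m where "m = min (ord f) (ord g)"
  have "ord (f / t powi m) \<ge> 0" "ord (g / t powi m) \<ge> 0"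
    using assms by (simp_all add: ord_divide ord_power_int m_def)
  then obtain c d where "val (f / t powi m) c" "val (g / t powi m) d" by (metis val_iff_ord)
  then have "val ((f + g) / t powi m) (c + d)" by (simp add: add_divide_distrib val_add)
  then have "ord ((f + g) / t powi m) \<ge> 0" using assms val_iff_ord[of "(f + g) / t powi m"] by auto
  then show ?thesis using assms by (simp add: ord_divide ord_power_int m_def)
qed

lemma ord_add_less: assumes "f \<noteq> 0" "g \<noteq> 0" "ord f < ord g" shows "f + g \<noteq> 0" "ord (f + g) = ord f"
proof -
  show nz: "f + g \<noteq> 0"
  proof
    assume "f + g = 0"
    then have "f = - g" by (simp add: add_eq_0_iff2)
    then show False using assms by simp
  qed
  have "ord (f + g) \<ge> ord f" using ord_add[OF assms(1,2) nz] assms(3) by simp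
  moreover have "ord f \<ge> min (ord (f + g)) (ord g)"
    using ord_add[of "f + g" "- g"] assms nz by simp
  ultimately show "ord (f + g) = ord f" using assms by simp
qed

lemma normalized_valuation_ord: "normalized_valuation ord"
  unfolding normalized_valuation_def
  by (intro conjI allI impI exI[of _ t] ord_mult ord_add) simp_all

text \<open>The valuation ring fixes the sign of \<open>w\<close>, so \<open>w\<close> vanishes
  where \<open>ord\<close> does and \<open>w = ord * w t\<close>. Since \<open>w\<close> takes the
  value 1, the nonnegative integer \<open>w t\<close> divides 1. This is what justifies the definite
  description in \<open>valuation_at\<close>.\<close>

lemma ord_unique:
  assumes "normalized_valuation w" "{f. f = 0 \<or> w f \<ge> 0} = {f. \<exists>c. val f c}"
  shows "w = ord"
proof
  fix f
  have wm: "w (f * g) = w f + w g" if "f \<noteq> 0" "g \<noteq> 0" for f g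
    using that assms(1) by (simp add: normalized_valuation_def)
  have w0: "w 0 = 0" using assms(1) by (simp add: normalized_valuation_def)
  have ge: "w f \<ge> 0 \<longleftrightarrow> ord f \<ge> 0" for f
  proof (cases "f = 0")
    case False
    then have "w f \<ge> 0 \<longleftrightarrow> f \<in> {f. f = 0 \<or> w f \<ge> 0}" by simp
    also have "\<dots> \<longleftrightarrow> ord f \<ge> 0" unfolding assms(2) using val_iff_ord[of f] False by simp
    finally show ?thesis .
  qed (simp add: w0)
  have w1: "w 1 = 0" using wm[of 1 1] by simp
  have wi: "w (inverse f) = - w f" for f
    using wm[of f "inverse f"] w1 w0 by (cases "f = 0") auto
  have unit: "w f = 0" if "ord f = 0" for f
    using ge[of f] ge[of "inverse f"] that by (simp add: ord_inverse wi)
  have wpow: "w (t powi n) = n * w t" for n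
  proof (cases n rule: int_cases2)
    case (nonneg k)
    have "w (t ^ k) = int k * w t"
      by (induction k) (auto simp: w1 wm algebra_simps)
    then show ?thesis using nonneg by simp
  next
    case (nonpos k)
    have "w (t ^ k) = int k * w t"
      by (induction k) (auto simp: w1 wm algebra_simps)
    then show ?thesis using nonpos by (simp add: power_int_minus wi)
  qed
  have wf: "w f = ord f * w t" for f
  proof (cases "f = 0")
    case False
    then obtain e c where e: "f = t powi (ord f) * e" "val e c" "c \<noteq> 0" "e \<noteq> 0" by (rule ordE)
    have "w f = w (t powi (ord f)) + w e" by (subst e(1), rule wm) (use e in auto)
    then show ?thesis using unit[OF ord_unit[OF e(2,3)]] wpow by simp
  qed (simp add: w0)
  have "\<exists>g. g \<noteq> 0 \<and> w g = 1"
    using assms(1) unfolding normalized_valuation_def by (elim conjE)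
  then obtain g where "w g = 1" by blast
  then have "ord g * w t = 1" using wf[of g] by simp
  moreover have "w t \<ge> 0" using ge[of t] by simp
  ultimately have "w t = 1" by (auto simp: zmult_eq_1_iff)
  then show "w f = ord f" using wf[of f] by simp
qed

end

section \<open>The function field of a Weierstrass curve\<close>

locale ec_field =
  fixes E :: "'c::{alg_closed_field, field_char_0} weierstrass"
    and K :: "('c, 'k::field) function_field"
  assumes ec: "elliptic_curve E" and ff: "is_function_field E K"
begin

sublocale field_embedding "const K"
  using ff by unfold_locales (auto simp: is_function_field_def)

abbreviation h where "h \<equiv> const K"
abbreviation x where "x \<equiv> xcoord K"
abbreviation y where "y \<equiv> ycoord K"
abbreviation A1 where "A1 \<equiv> h (a1 E)"
abbreviation A2 where "A2 \<equiv> h (a2 E)"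
abbreviation A3 where "A3 \<equiv> h (a3 E)"
abbreviation A4 where "A4 \<equiv> h (a4 E)"
abbreviation A6 where "A6 \<equiv> h (a6 E)"

lemma eval2_eq_0_iff: "eval2 h p x y = 0 \<longleftrightarrow> weierstrass_poly E dvd p"
  using ff by (auto simp: is_function_field_def)

lemma curve_eq: "y^2 + A1 * x * y + A3 * y = x^3 + A2 * x^2 + A4 * x + A6"
  using eval2_eq_0_iff[of "weierstrass_poly E"]
  by (simp add: weierstrass_poly_def algebra_simps power2_eq_square power3_eq_cube)

lemma y_sq: "y * y = x^3 + A2 * x^2 + A4 * x + A6 - A1 * x * y - A3 * y"
  using curve_eq by (simp add: power2_eq_square algebra_simps)

abbreviation cubic :: "'c poly" where "cubic \<equiv> [: a6 E, a4 E, a2 E, 1 :]"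
abbreviation lin :: "'c poly" where "lin \<equiv> [: a3 E, a1 E :]"

section \<open>The normal form p(x) + q(x) y, its conjugate and its norm\<close>

definition pol :: "'c poly \<Rightarrow> 'c poly \<Rightarrow> 'k" where
  "pol p q = ev1 x p + ev1 x q * y"

definition ybar :: 'k where "ybar = - y - A1 * x - A3"

definition polbar :: "'c poly \<Rightarrow> 'c poly \<Rightarrow> 'k" where
  "polbar p q = ev1 x p + ev1 x q * ybar"

text \<open>The Weierstrass polynomial has degree 2 in the outer variable, so no nonzero multiple of
  it has degree at most 1.\<close>

lemma pol_eq_0_iff: "pol p q = 0 \<longleftrightarrow> p = 0 \<and> q = 0"
proof
  assume "pol p q = 0"
  then have "eval2 h [:p, q:] x y = 0" by (simp add: pol_def mult.commute)
  then obtain r where r: "[:p, q:] = weierstrass_poly E * r"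
    unfolding eval2_eq_0_iff by (elim dvdE)
  have "r = 0"
  proof (rule ccontr)
    assume "r \<noteq> 0"
    moreover have W: "degree (weierstrass_poly E) = 2" "weierstrass_poly E \<noteq> 0"
      by (simp_all add: weierstrass_poly_def)
    ultimately have "degree [:p, q:] = 2 + degree r" unfolding r by (simp add: degree_mult_eq)
    moreover have "degree [:p, q:] \<le> 1" by simp
    ultimately show False by simp
  qed
  then have "[:p, q:] = 0" using r by simp
  then show "p = 0 \<and> q = 0" by simp
qed (simp add: pol_def)

lemma ev1_x_eq_0_iff [simp]: "ev1 x p = 0 \<longleftrightarrow> p = 0"
  using pol_eq_0_iff[of p 0] by (simp add: pol_def)

lemma polbar_pol: "polbar p q = pol (p - q * lin) (- q)"
  by (simp add: polbar_def pol_def ybar_def algebra_simps)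

lemma pol_polbar: "pol p q = polbar (p - q * lin) (- q)"
  by (simp add: polbar_def pol_def ybar_def algebra_simps)

lemma polbar_eq_0_iff: "polbar p q = 0 \<longleftrightarrow> p = 0 \<and> q = 0"
  unfolding polbar_pol pol_eq_0_iff by auto

lemma pol_add: "pol p q + pol p' q' = pol (p + p') (q + q')"
  by (simp add: pol_def algebra_simps)

lemma pol_diff: "pol p q - pol p' q' = pol (p - p') (q - q')"
  by (simp add: pol_def algebra_simps)

lemma pol_scale: "ev1 x r * pol p q = pol (r * p) (r * q)"
  by (simp add: pol_def algebra_simps)

lemma polbar_scale: "ev1 x r * polbar p q = polbar (r * p) (r * q)"
  by (simp add: polbar_def algebra_simps)

lemma pol_inj: "pol p q = pol p' q' \<longleftrightarrow> p = p' \<and> q = q'"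
  using pol_eq_0_iff[of "p - p'" "q - q'"] by (simp flip: pol_diff)

lemma pol_mult:
  "pol p q * pol p' q' = pol (p * p' + q * q' * cubic) (p * q' + p' * q - q * q' * lin)"
proof -
  have "pol p q * pol p' q' = ev1 x p * ev1 x p' + (ev1 x p * ev1 x q' + ev1 x p' * ev1 x q) * y
      + ev1 x q * ev1 x q' * (y * y)"
    by (simp add: pol_def algebra_simps)
  then show ?thesis unfolding y_sq
    by (simp add: pol_def algebra_simps power2_eq_square power3_eq_cube)
qed

lemma ybar_sq: "ybar * ybar = x^3 + A2 * x^2 + A4 * x + A6 - A1 * x * ybar - A3 * ybar"
proof -
  have "ybar * ybar = y * y + 2 * (A1 * x + A3) * y + (A1 * x + A3)^2"
    by (simp add: ybar_def power2_eq_square algebra_simps)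
  then show ?thesis unfolding y_sq
    by (simp add: ybar_def power2_eq_square algebra_simps)
qed

lemma polbar_mult:
  "polbar p q * polbar p' q' = polbar (p * p' + q * q' * cubic) (p * q' + p' * q - q * q' * lin)"
proof -
  have "polbar p q * polbar p' q' = ev1 x p * ev1 x p'
      + (ev1 x p * ev1 x q' + ev1 x p' * ev1 x q) * ybar + ev1 x q * ev1 x q' * (ybar * ybar)"
    by (simp add: polbar_def algebra_simps)
  then show ?thesis unfolding ybar_sq
    by (simp add: polbar_def algebra_simps power2_eq_square power3_eq_cube)
qed

text \<open>The norm down to the rational functions in \<open>x\<close>, as
  \<open>pol_times_polbar\<close> confirms. It reduces questions about zeros on the curve to roots
  of polynomials in one variable.\<close>

definition nrm :: "'c poly \<Rightarrow> 'c poly \<Rightarrow> 'c poly" where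
  "nrm p q = p * p - p * q * lin - q * q * cubic"

lemma pol_times_polbar: "pol p q * polbar p q = ev1 x (nrm p q)"
  unfolding polbar_pol pol_mult unfolding pol_def nrm_def by (simp add: algebra_simps)

lemma nrm_eq_0_iff: "nrm p q = 0 \<longleftrightarrow> p = 0 \<and> q = 0"
  using pol_times_polbar[of p q] pol_eq_0_iff[of p q] polbar_eq_0_iff[of p q]
  by (metis ev1_0 ev1_x_eq_0_iff mult_eq_0_iff)

lemma y_pol: "y = pol 0 1"
  by (simp add: pol_def)

lemma x_nz [simp]: "x \<noteq> 0" and y_nz [simp]: "y \<noteq> 0"
  using pol_eq_0_iff[of "[:0,1:]" 0] pol_eq_0_iff[of 0 1] unfolding pol_def by auto

lemma ev1_x_of_poly: "ev1 x p = pol p 0"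
  by (simp add: pol_def)

lemma eval2_pol: "\<exists>p' q'. eval2 h p x y = pol p' q'"
proof (induction p)
  case 0
  show ?case by (rule exI[of _ 0], rule exI[of _ 0]) (simp add: pol_def)
next
  case (pCons a p)
  then obtain p' q' where "eval2 h p x y = pol p' q'" by blast
  then show ?case by (simp add: ev1_x_of_poly y_pol pol_mult pol_add del: pCons_0_0) blast
qed

text \<open>Multiplying numerator and denominator by the conjugate of the denominator leaves a norm,
  hence a polynomial in \<open>x\<close>, below.\<close>

lemma repr: obtains p q r where "r \<noteq> 0" "f = pol p q / ev1 x r"
proof -
  have "\<exists>p q. eval2 h q x y \<noteq> 0 \<and> f = eval2 h p x y / eval2 h q x y"
    using ff unfolding is_function_field_def by blast
  then obtain P Q where PQ: "eval2 h Q x y \<noteq> 0" "f = eval2 h P x y / eval2 h Q x y" by blast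
  obtain p q where pq: "eval2 h P x y = pol p q" using eval2_pol by blast
  obtain p' q' where pq': "eval2 h Q x y = pol p' q'" using eval2_pol by blast
  have nz: "\<not> (p' = 0 \<and> q' = 0)" using PQ(1) pq' pol_eq_0_iff by simp
  then have b: "polbar p' q' \<noteq> 0" by (simp add: polbar_eq_0_iff)
  have "f = pol p q * polbar p' q' / (pol p' q' * polbar p' q')"
    using PQ b unfolding pq pq' by simp
  then have "f = pol p q * pol (p' - q' * lin) (- q') / ev1 x (nrm p' q')"
    by (simp only: pol_times_polbar) (simp only: polbar_pol)
  then show ?thesis using that nz nrm_eq_0_iff unfolding pol_mult by blast
qed


subsection \<open>The involution induced by negation\<close>

text \<open>The nontrivial automorphism over the rational functions in \<open>x\<close>. The
  function field is only given through generators and relations, so it is defined on fractions;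
  \<open>sg_frac\<close> is the independence of the fraction chosen.\<close>

definition sg :: "'k \<Rightarrow> 'k" where
  "sg f = (THE g. \<exists>p q r. r \<noteq> 0 \<and> f = pol p q / ev1 x r \<and> g = polbar p q / ev1 x r)"

lemma sg_frac: assumes "r \<noteq> 0" shows "sg (pol p q / ev1 x r) = polbar p q / ev1 x r"
  unfolding sg_def
proof (rule the_equality)
  fix g
  assume "\<exists>p' q' r'. r' \<noteq> 0 \<and> pol p q / ev1 x r = pol p' q' / ev1 x r' \<and> g = polbar p' q' / ev1 x r'"
  then obtain p' q' r' where *: "r' \<noteq> 0" "pol p q / ev1 x r = pol p' q' / ev1 x r'"
    "g = polbar p' q' / ev1 x r'" by blast
  have "ev1 x r' * pol p q = ev1 x r * pol p' q'"
    using *(1,2) assms by (simp add: frac_eq_eq mult.commute)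
  then have "r' * p = r * p'" "r' * q = r * q'" unfolding pol_scale pol_inj by auto
  then have "ev1 x r' * polbar p q = ev1 x r * polbar p' q'" unfolding polbar_scale by simp
  then show "g = polbar p q / ev1 x r" using * assms by (simp add: frac_eq_eq mult.commute)
qed (use assms in blast)

lemma sg_pol [simp]: "sg (pol p q) = polbar p q"
  using sg_frac[of 1 p q] by simp

lemma sg_h [simp]: "sg (h c) = h c"
  using sg_pol[of "[:c:]" 0] by (simp add: pol_def polbar_def)

lemma sg_x [simp]: "sg x = x"
  using sg_pol[of "[:0,1:]" 0] by (simp add: pol_def polbar_def)

lemma sg_y [simp]: "sg y = ybar"
  using sg_pol[of 0 1] by (simp add: pol_def polbar_def)

lemma sg_add: "sg (f + g) = sg f + sg g"
proof -
  obtain p q r where 1: "r \<noteq> 0" "f = pol p q / ev1 x r" by (rule repr)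
  obtain p' q' r' where 2: "r' \<noteq> 0" "g = pol p' q' / ev1 x r'" by (rule repr)
  have "f + g = pol (r' * p + r * p') (r' * q + r * q') / ev1 x (r * r')"
    unfolding pol_add[symmetric] pol_scale[symmetric] using 1 2 by (simp add: add_frac_eq mult.commute)
  then have "sg (f + g) = polbar (r' * p + r * p') (r' * q + r * q') / ev1 x (r * r')"
    using 1(1) 2(1) by (simp only: sg_frac mult_eq_0_iff simp_thms)
  also have "\<dots> = (ev1 x r' * polbar p q + ev1 x r * polbar p' q') / ev1 x (r * r')"
    by (simp add: polbar_def algebra_simps)
  also have "\<dots> = sg f + sg g" using 1 2 by (simp add: sg_frac add_frac_eq algebra_simps)
  finally show ?thesis .
qed

lemma sg_mult: "sg (f * g) = sg f * sg g"
proof -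
  obtain p q r where 1: "r \<noteq> 0" "f = pol p q / ev1 x r" by (rule repr)
  obtain p' q' r' where 2: "r' \<noteq> 0" "g = pol p' q' / ev1 x r'" by (rule repr)
  have "f * g = pol (p * p' + q * q' * cubic) (p * q' + p' * q - q * q' * lin) / ev1 x (r * r')"
    unfolding pol_mult[symmetric] using 1 2 by simp
  then have "sg (f * g) = polbar p q * polbar p' q' / ev1 x (r * r')"
    unfolding polbar_mult using 1 2 by (simp only: sg_frac mult_eq_0_iff simp_thms)
  also have "\<dots> = sg f * sg g" using 1 2 by (simp add: sg_frac)
  finally show ?thesis .
qed

lemma sg_sg [simp]: "sg (sg f) = f"
proof -
  obtain p q r where 1: "r \<noteq> 0" "f = pol p q / ev1 x r" by (rule repr)
  then have 2: "sg f = pol (p - q * lin) (- q) / ev1 x r"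
    by (simp only: 1(2) sg_frac polbar_pol not_False_eq_True)
  show ?thesis unfolding 2 using 1 by (simp only: sg_frac pol_polbar[of p q] not_False_eq_True)
qed

lemma bij_sg: "bij sg"
  by (rule involuntory_imp_bij) simp

end


subsection \<open>Automorphisms over the constants\<close>

locale const_aut = field_embedding h for h :: "'c::field \<Rightarrow> 'k::field" +
  fixes \<phi> :: "'k \<Rightarrow> 'k"
  assumes bij_aut: "bij \<phi>"
    and aut_add [simp]: "\<phi> (f + g) = \<phi> f + \<phi> g"
    and aut_mult [simp]: "\<phi> (f * g) = \<phi> f * \<phi> g"
    and aut_const [simp]: "\<phi> (h c) = h c"
begin

lemma aut_0 [simp]: "\<phi> 0 = 0" and aut_1 [simp]: "\<phi> 1 = 1"
  using aut_const[of 0] aut_const[of 1] by simp_all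

lemma aut_hom: "field_embedding \<phi>"
  by unfold_locales auto

lemma aut_eq_0_iff [simp]: "\<phi> f = 0 \<longleftrightarrow> f = 0"
  by (rule field_embedding.h_eq_0_iff[OF aut_hom])

lemma aut_minus [simp]: "\<phi> (- f) = - \<phi> f"
  by (rule field_embedding.h_minus[OF aut_hom])

lemma aut_diff [simp]: "\<phi> (f - g) = \<phi> f - \<phi> g"
  by (rule field_embedding.h_diff[OF aut_hom])

lemma aut_inverse [simp]: "\<phi> (inverse f) = inverse (\<phi> f)"
  by (rule field_embedding.h_inverse[OF aut_hom])

lemma aut_divide [simp]: "\<phi> (f / g) = \<phi> f / \<phi> g"
  by (rule field_embedding.h_divide[OF aut_hom])

lemma aut_power [simp]: "\<phi> (f ^ n) = \<phi> f ^ n"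
  by (rule field_embedding.h_power[OF aut_hom])

lemma aut_numeral [simp]: "\<phi> (numeral n) = numeral n"
  by (rule field_embedding.h_numeral[OF aut_hom])

lemma aut_power_int [simp]: "\<phi> (f powi n) = \<phi> f powi n"
  by (cases n rule: int_cases2) (auto simp: power_int_minus)

lemma aut_ev1: "\<phi> (ev1 u p) = ev1 (\<phi> u) p"
  by (induction p) auto

lemma aut_eval2: "\<phi> (eval2 h p u v) = eval2 h p (\<phi> u) (\<phi> v)"
  by (induction p) (auto simp: aut_ev1)

lemma aut_sum: "\<phi> (sum f A) = (\<Sum>i\<in>A. \<phi> (f i))"
  by (induction A rule: infinite_finite_induct) auto

end

context ec_field begin

sublocale sg: const_aut "const K" sg
  by unfold_locales (auto simp: bij_sg sg_add sg_mult)

end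

section \<open>The place of a point\<close>

context chart_loc begin

text \<open>The Horner scheme splits a polynomial into its value at the point and multiples of
  \<open>u - h u0\<close> and \<open>v - h v0\<close>. If \<open>t\<close> divides both of these
  with regular quotients, it divides every function that vanishes at the point.\<close>

lemma val_0_dvd:
  assumes "u - h u0 = t * A" "val A a" "v - h v0 = t * B" "val B b" "val f 0"
  shows "\<exists>g d. f = t * g \<and> val g d"
proof -
  have 1: "\<exists>g d. ev1 u p - h (poly p u0) = t * g \<and> val g d" for p
  proof (induction p)
    case 0
    show ?case by (intro exI[of _ 0] conjI) (simp_all add: val_0)
  next
    case (pCons c p)
    then obtain g d where g: "ev1 u p - h (poly p u0) = t * g" "val g d" by blast
    have "ev1 u (pCons c p) - h (poly (pCons c p) u0)
        = u * (ev1 u p - h (poly p u0)) + (u - h u0) * h (poly p u0)"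
      by (simp add: algebra_simps)
    also have "\<dots> = t * (u * g + A * h (poly p u0))"
      unfolding g assms(1) by (simp add: algebra_simps)
    finally show ?case
      using val_add[OF val_mult[OF val_u g(2)] val_mult[OF assms(2) val_const]] by blast
  qed
  have 2: "\<exists>g d. eval2 h p u v - h (eval2 id p u0 v0) = t * g \<and> val g d" for p
  proof (induction p)
    case 0
    show ?case unfolding eval2_0 idc.eval2_0 using val_0 by (intro exI[of _ 0]) auto
  next
    case (pCons q p)
    then obtain g d where g: "eval2 h p u v - h (eval2 id p u0 v0) = t * g" "val g d" by blast
    obtain g' d' where g': "ev1 u q - h (poly q u0) = t * g'" "val g' d'" using 1 by blast
    have "eval2 h (pCons q p) u v - h (eval2 id (pCons q p) u0 v0)
        = (ev1 u q - h (poly q u0)) + v * (eval2 h p u v - h (eval2 id p u0 v0))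
          + (v - h v0) * h (eval2 id p u0 v0)"
      by (simp add: algebra_simps)
    also have "\<dots> = t * (g' + v * g + B * h (eval2 id p u0 v0))"
      unfolding g g' assms(3) by (simp add: algebra_simps)
    finally show ?case
      using val_add[OF val_add[OF g'(2) val_mult[OF val_v g(2)]] val_mult[OF assms(4) val_const]]
      by blast
  qed
  obtain p q where f: "eval2 id q u0 v0 \<noteq> 0" "f = eval2 h p u v / eval2 h q u v"
      "0 = eval2 id p u0 v0 / eval2 id q u0 v0" using assms(5) unfolding val_def by blast
  then have "eval2 id p u0 v0 = 0" by simp
  then obtain g d where g: "eval2 h p u v = t * g" "val g d" using 2[of p] by auto
  then have "f = t * (g / eval2 h q u v)" using f by simp
  then show ?thesis using val_divide[OF g(2) val_poly f(1)] by blast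
qed

text \<open>While \<open>n > 0\<close>, the product vanishes at the point, so one factor does and
  gives up a factor \<open>t\<close>; at \<open>n = 0\<close> both are units. Applied to a function
  and its conjugate, it passes from the norm to the function.\<close>

lemma decomp_factor:
  assumes dvd: "\<And>f. val f 0 \<Longrightarrow> \<exists>g d. f = t * g \<and> val g d" and t: "t \<noteq> 0" "val t 0"
    and "val f c" "val g d" "f * g = t ^ n * e" "val e b" "b \<noteq> 0"
  shows "\<exists>m e c. f = t ^ m * e \<and> val e c \<and> c \<noteq> 0"
  using assms(4-)
proof (induction n arbitrary: f g c d)
  case 0
  then have "val e (c * d)" using val_mult by fastforce
  then have "c * d = b" using 0(4) val_unique by blast
  then have "c \<noteq> 0" using 0(5) by auto
  then show ?case using 0 by (intro exI[of _ "0::nat"]) auto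
next
  case (Suc n)
  have "val (f * g) (0 ^ Suc n * b)" unfolding Suc.prems(3) using t Suc.prems by (intro val_mult val_power)
  then have "c * d = 0" using val_unique val_mult[OF Suc.prems(1,2)] by fastforce
  then show ?case unfolding mult_eq_0_iff
  proof
    assume "c = 0"
    then obtain f' c' where f': "f = t * f'" "val f' c'" using dvd Suc.prems by blast
    have "f' * g = t ^ n * e" using Suc.prems(3) f' t by simp
    then obtain m e c where "f' = t ^ m * e" "val e c" "c \<noteq> 0"
      using Suc.IH[OF f'(2) Suc.prems(2) _ Suc.prems(4,5)] by blast
    then show ?thesis using f' by (intro exI[of _ "Suc m"]) auto
  next
    assume "d = 0"
    then obtain g' d' where g': "g = t * g'" "val g' d'" using dvd Suc.prems by blast
    have "f * g' = t ^ n * e" using Suc.prems(3) g' t by (simp add: mult.left_commute)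
    then show ?thesis using Suc.IH[OF Suc.prems(1) g'(2) _ Suc.prems(4,5)] by blast
  qed
qed

end

context ec_field begin

abbreviation cu where "cu P \<equiv> fst (chart K P)"
abbreviation cv where "cv P \<equiv> snd (chart K P)"
abbreviation cu0 where "cu0 P \<equiv> fst (chart_coords P)"
abbreviation cv0 where "cv0 P \<equiv> snd (chart_coords P)"

subsection \<open>Affine points\<close>

lemma chart_affine:
  assumes "on_curve E (Affine x0 y0)" shows "chart_loc (const K) x y x0 y0"
proof
  fix p assume "eval2 h p x y = 0"
  then obtain r where "p = weierstrass_poly E * r" unfolding eval2_eq_0_iff by (elim dvdE)
  moreover have "eval2 id (weierstrass_poly E) x0 y0 = 0"
    using assms by (simp add: weierstrass_poly_def algebra_simps power2_eq_square power3_eq_cube)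
  ultimately show "eval2 id p x0 y0 = 0" by simp
qed

text \<open>Where the tangent is vertical, \<open>x\<close> is ramified and \<open>y\<close> has to
  be used instead.\<close>

definition unif :: "'c point \<Rightarrow> 'k" where
  "unif P = (case P of Origin \<Rightarrow> x / y | Affine x0 y0 \<Rightarrow>
     if 2 * y0 + a1 E * x0 + a3 E \<noteq> 0 then x - h x0 else y - h y0)"

lemma x_minus_nz: "x - h c \<noteq> 0" and y_minus_nz: "y - h c \<noteq> 0"
  using pol_eq_0_iff[of "[:-c, 1:]" 0] pol_eq_0_iff[of "[:-c:]" 1] by (simp_all add: pol_def)

text \<open>The difference of the curve equations at the generic point and at
  \<open>(x0, y0)\<close>. The two cofactors take the partial derivatives, up to sign, as values at
  the point, so by nonsingularity one of them is a unit.\<close>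

lemma coord_identity:
  assumes "on_curve E (Affine x0 y0)"
  shows "(y - h y0) * (y + h y0 + A1 * x + A3)
    = (x - h x0) * (x^2 + x * h x0 + h x0^2 + A2 * (x + h x0) + A4 - A1 * h y0)"
proof -
  have "h (y0^2 + a1 E * x0 * y0 + a3 E * y0) = h (x0^3 + a2 E * x0^2 + a4 E * x0 + a6 E)"
    using assms by simp
  then have *: "h y0^2 = h x0^3 + A2 * h x0^2 + A4 * h x0 + A6 - A1 * h x0 * h y0 - A3 * h y0"
    by (simp add: algebra_simps)
  have **: "y^2 = x^3 + A2 * x^2 + A4 * x + A6 - A1 * x * y - A3 * y"
    using curve_eq by (simp add: algebra_simps)
  have "(y - h y0) * (y + h y0 + A1 * x + A3) = (y^2 + A1 * x * y + A3 * y) - h y0^2 - A1 * x * h y0 - A3 * h y0"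
    by (simp add: algebra_simps power2_eq_square)
  also have "\<dots> = (x - h x0) * (x^2 + x * h x0 + h x0^2 + A2 * (x + h x0) + A4 - A1 * h y0)"
    unfolding * ** by (simp add: algebra_simps power2_eq_square power3_eq_cube)
  finally show ?thesis .
qed

text \<open>The exponent in the last claim is the ramification index of \<open>x\<close> at the point.\<close>

lemma affine_unif:
  assumes "on_curve E (Affine x0 y0)"
  defines "t \<equiv> unif (Affine x0 y0)" and "V \<equiv> chart_loc.val (const K) x y x0 y0"
  shows "t \<noteq> 0" "V t 0"
    "\<exists>A a. x - h x0 = t * A \<and> V A a" "\<exists>B b. y - h y0 = t * B \<and> V B b"
    "\<exists>e c. x - h x0 = t ^ (if 2 * y0 + a1 E * x0 + a3 E = 0 then 2 else 1) * e \<and> V e c \<and> c \<noteq> 0"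
proof -
  interpret chart_loc "const K" x y x0 y0 by (rule chart_affine[OF assms(1)])
  show "t \<noteq> 0" using x_minus_nz y_minus_nz by (simp add: t_def unif_def)
  show t0: "V t 0"
    using val_diff[OF val_u val_const[of x0]] val_diff[OF val_v val_const[of y0]]
    by (simp add: t_def V_def unif_def)
  define A where "A = y + h y0 + A1 * x + A3"
  define B where "B = x^2 + x * h x0 + h x0^2 + A2 * (x + h x0) + A4 - A1 * h y0"
  define c where "c = 2 * y0 + a1 E * x0 + a3 E"
  define d where "d = 3 * x0^2 + 2 * a2 E * x0 + a4 E - a1 E * y0"
  have AB: "(y - h y0) * A = (x - h x0) * B" unfolding A_def B_def by (rule coord_identity[OF assms(1)])
  have A: "val A c"
    using val_add[OF val_add[OF val_add[OF val_v val_const[of y0]] val_mult[OF val_const[of "a1 E"] val_u]]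
      val_const[of "a3 E"]]
    unfolding A_def c_def by (simp add: algebra_simps)
  have "val B (x0^2 + x0 * x0 + x0^2 + a2 E * (x0 + x0) + a4 E - a1 E * y0)" unfolding B_def
    by (intro val_add val_diff val_mult val_const val_u val_power)
  then have B: "val B d" unfolding d_def by (simp add: power2_eq_square algebra_simps)
  have cd: "c \<noteq> 0 \<or> d \<noteq> 0"
    using ec assms(1) unfolding elliptic_curve_def c_def d_def right_minus_eq by metis
  have "(\<exists>A a. x - h x0 = t * A \<and> val A a) \<and> (\<exists>B b. y - h y0 = t * B \<and> val B b) \<and>
    (\<exists>e b. x - h x0 = t ^ (if c = 0 then 2 else 1) * e \<and> val e b \<and> b \<noteq> 0)"
  proof (cases "c = 0")
    case False
    then have t: "t = x - h x0" by (simp add: t_def unif_def c_def)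
    have "y - h y0 = t * (B / A)" using AB val_nz[OF A False] unfolding t by (simp add: field_simps)
    moreover have "val (B / A) (d / c)" by (intro val_divide A B False)
    moreover have "x - h x0 = t * 1" by (simp add: t)
    moreover have "x - h x0 = t ^ (if c = 0 then 2 else 1) * 1" using False by (simp add: t)
    ultimately show ?thesis using val_1 one_neq_zero by blast
  next
    case True
    then have d: "d \<noteq> 0" using cd by simp
    have t: "t = y - h y0" using True by (simp add: t_def unif_def c_def)
    have B0: "B \<noteq> 0" using val_nz[OF B d] .
    have 1: "x - h x0 = t * (A / B)" using AB B0 unfolding t by (simp add: field_simps)
    have 2: "val (A / B) 0" using val_divide[OF A B d] True by simp
    \<comment> \<open>Because \<open>c = 0\<close>, the cofactor \<open>A\<close> is itself a
      multiple of \<open>t\<close>. This gives \<open>x - h x0\<close> its second factor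
      \<open>t\<close>.\<close>
    have "A = t + A1 * (x - h x0) + h c" unfolding A_def t c_def by (simp add: algebra_simps)
    then have "A = t * (1 + A1 * (A / B))" using True 1 by (simp add: algebra_simps)
    then have 3: "x - h x0 = t ^ 2 * ((1 + A1 * (A / B)) / B)"
      using 1 by (simp add: power2_eq_square)
    have 4: "val ((1 + A1 * (A / B)) / B) ((1 + a1 E * 0) / d)"
      by (intro val_divide val_add val_mult val_const val_1 2 B d)
    have "y - h y0 = t * 1" by (simp add: t)
    moreover have "(1 + a1 E * 0) / d \<noteq> 0" using d by simp
    ultimately show ?thesis using 1 2 3 4 val_1 unfolding if_P[OF True] by blast
  qed
  then show "\<exists>A a. x - h x0 = t * A \<and> V A a" "\<exists>B b. y - h y0 = t * B \<and> V B b"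
    "\<exists>e c. x - h x0 = t ^ (if 2 * y0 + a1 E * x0 + a3 E = 0 then 2 else 1) * e \<and> V e c \<and> c \<noteq> 0"
    unfolding V_def c_def by blast+
qed

text \<open>For polynomials in \<open>x\<close> the exponent is the multiplicity of the root
  \<open>x0\<close> times the order \<open>j\<close> of \<open>x - h x0\<close>. A function
  \<open>pol p q\<close> is a factor of its norm, so \<open>decomp_factor\<close> applies to it; a
  general function is a quotient of these two kinds.\<close>

lemma place_affine:
  assumes "on_curve E (Affine x0 y0)" shows "place_loc (const K) x y x0 y0 (unif (Affine x0 y0))"
proof -
  interpret chart_loc "const K" x y x0 y0 by (rule chart_affine[OF assms(1)])
  define t where "t = unif (Affine x0 y0)"
  note U = affine_unif[OF assms, folded t_def]
  have dvd: "\<exists>g d. f = t * g \<and> val g d" if "val f 0" for f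
    using U(3,4) val_0_dvd that by blast
  obtain j e0 c0 where dx: "x - h x0 = t ^ j * e0" "val e0 c0" "c0 \<noteq> 0" using U(5) by blast
  have nat: "\<exists>n e c. ev1 x p = t ^ n * e \<and> val e c \<and> c \<noteq> 0" if p: "p \<noteq> 0" for p
  proof -
    obtain q where q: "p = [:- x0, 1:] ^ order x0 p * q" "\<not> [:- x0, 1:] dvd q"
      using order_decomp[OF p] by blast
    let ?k = "order x0 p"
    have "ev1 x p = (x - h x0) ^ ?k * ev1 x q" by (subst q(1)) simp
    also have "\<dots> = t ^ (j * ?k) * (e0 ^ ?k * ev1 x q)"
      by (simp add: dx power_mult_distrib power_mult)
    finally have "ev1 x p = t ^ (j * ?k) * (e0 ^ ?k * ev1 x q)" .
    moreover have "val (e0 ^ ?k * ev1 x q) (c0 ^ ?k * poly q x0)"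
      by (intro val_mult val_power dx val_ev1 val_u)
    moreover have "c0 ^ ?k * poly q x0 \<noteq> 0" using dx q(2) by (simp add: dvd_iff_poly_eq_0)
    ultimately show ?thesis by blast
  qed
  have valp: "\<exists>c. val (pol p q) c" for p q
    unfolding pol_def by (meson val_add val_mult val_ev1 val_u val_v)
  have valb: "\<exists>c. val (polbar p q) c" for p q
    unfolding polbar_pol by (rule valp)
  have natp: "\<exists>n e c. pol p q = t ^ n * e \<and> val e c \<and> c \<noteq> 0" if nz: "\<not> (p = 0 \<and> q = 0)" for p q
  proof -
    obtain n e b where *: "ev1 x (nrm p q) = t ^ n * e" "val e b" "b \<noteq> 0"
      using nat[of "nrm p q"] nz nrm_eq_0_iff by blast
    obtain c d where "val (pol p q) c" "val (polbar p q) d" using valp valb by blast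
    then show ?thesis
      using decomp_factor[OF dvd U(1,2) _ _ _ *(2,3), of "pol p q" c "polbar p q" d n] * pol_times_polbar
      by auto
  qed
  show ?thesis
    unfolding t_def[symmetric]
  proof
    show "t \<noteq> 0" "val t 0" by (rule U)+
    fix f :: 'k assume f: "f \<noteq> 0"
    obtain p q r where r: "r \<noteq> 0" "f = pol p q / ev1 x r" by (rule repr)
    then obtain n e c where 1: "pol p q = t ^ n * e" "val e c" "c \<noteq> 0"
      using natp[of p q] f pol_eq_0_iff by auto
    obtain n' e' c' where 2: "ev1 x r = t ^ n' * e'" "val e' c'" "c' \<noteq> 0"
      using nat[OF r(1)] by blast
    have "f = t powi (int n - int n') * (e / e')"
      unfolding r(2) 1 2 using U(1) by (simp add: power_int_diff)
    then show "\<exists>n e c. f = t powi n * e \<and> val e c \<and> c \<noteq> 0"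
      using val_divide[OF 1(2) 2(2,3)] 1(3) 2(3) by (metis divide_eq_0_iff)
  qed
qed

end

context ec_field begin

subsection \<open>The origin\<close>

text \<open>The functions with a pole of order less than \<open>N\<close> at the origin and no other poles.\<close>

definition pole_lt :: "nat \<Rightarrow> 'k set" where
  "pole_lt N = {pol p q | p q. (p \<noteq> 0 \<longrightarrow> 2 * degree p < N) \<and> (q \<noteq> 0 \<longrightarrow> 2 * degree q + 3 < N)}"

lemma pole_ltI:
  "(p \<noteq> 0 \<Longrightarrow> 2 * degree p < N) \<Longrightarrow> (q \<noteq> 0 \<Longrightarrow> 2 * degree q + 3 < N) \<Longrightarrow> pol p q \<in> pole_lt N"
  unfolding pole_lt_def by blast

lemma pole_lt_mono: "f \<in> pole_lt M \<Longrightarrow> M \<le> N \<Longrightarrow> f \<in> pole_lt N"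
  unfolding pole_lt_def by (smt (verit) mem_Collect_eq order_less_le_trans)

lemma degree_add_less': "(p \<noteq> 0 \<Longrightarrow> 2 * degree p < N) \<Longrightarrow> (q \<noteq> 0 \<Longrightarrow> 2 * degree q < N) \<Longrightarrow>
  p + q \<noteq> 0 \<Longrightarrow> 2 * degree (p + q) < (N :: nat)"
  using degree_add_le_max[of p q] by (cases "p = 0"; cases "q = 0") auto

lemma pole_lt_add:
  assumes "f \<in> pole_lt N" "g \<in> pole_lt N" shows "f + g \<in> pole_lt N"
proof -
  obtain p q where 1: "f = pol p q" "p \<noteq> 0 \<longrightarrow> 2 * degree p < N" "q \<noteq> 0 \<longrightarrow> 2 * degree q + 3 < N"
    using assms(1) by (auto simp: pole_lt_def)
  obtain p' q' where 2: "g = pol p' q'" "p' \<noteq> 0 \<longrightarrow> 2 * degree p' < N" "q' \<noteq> 0 \<longrightarrow> 2 * degree q' + 3 < N"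
    using assms(2) by (auto simp: pole_lt_def)
  have "2 * degree (p + p') < N" if "p + p' \<noteq> 0"
    using 1(2) 2(2) that degree_add_less'[of p N p'] by blast
  moreover have "2 * degree (q + q') < N - 3" if "q + q' \<noteq> 0"
    using 1(3) 2(3) that by (intro degree_add_less') auto
  ultimately show ?thesis unfolding 1 2 pol_add by (intro pole_ltI) fastforce+
qed

lemma pole_lt_scale: "f \<in> pole_lt N \<Longrightarrow> h c * f \<in> pole_lt N"
proof -
  assume "f \<in> pole_lt N"
  then obtain p q where 1: "f = pol p q" "p \<noteq> 0 \<longrightarrow> 2 * degree p < N" "q \<noteq> 0 \<longrightarrow> 2 * degree q + 3 < N"
    by (auto simp: pole_lt_def)
  have "h c * f = pol (smult c p) (smult c q)" by (simp add: 1 pol_def algebra_simps)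
  then show ?thesis using 1 by (auto intro!: pole_ltI)
qed

lemma pole_lt_x: assumes "f \<in> pole_lt N" shows "x * f \<in> pole_lt (N + 2)"
proof -
  obtain p q where 1: "f = pol p q" "p \<noteq> 0 \<longrightarrow> 2 * degree p < N" "q \<noteq> 0 \<longrightarrow> 2 * degree q + 3 < N"
    using assms by (auto simp: pole_lt_def)
  have "x * f = pol (pCons 0 p) (pCons 0 q)" by (simp add: 1 pol_def algebra_simps)
  then show ?thesis using 1 by (auto intro!: pole_ltI)
qed

lemma pole_lt_y: assumes "f \<in> pole_lt N" shows "y * f \<in> pole_lt (N + 3)"
proof -
  obtain p q where 1: "f = pol p q" "p \<noteq> 0 \<longrightarrow> 2 * degree p < N" "q \<noteq> 0 \<longrightarrow> 2 * degree q + 3 < N"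
    using assms by (auto simp: pole_lt_def)
  have "y * f = pol (q * cubic) (p - q * lin)" unfolding y_pol 1 pol_mult by simp
  moreover have "pol (q * cubic) 0 \<in> pole_lt (N + 3)"
    using 1 degree_mult_le[of q cubic] by (intro pole_ltI) auto
  moreover have "pol 0 p \<in> pole_lt (N + 3)" using 1 by (intro pole_ltI) auto
  moreover have "pol 0 (- (q * lin)) \<in> pole_lt (N + 3)"
  proof (intro pole_ltI)
    assume nz: "- (q * lin) \<noteq> 0"
    have "degree (- (q * lin)) \<le> degree q + 1"
      unfolding degree_minus by (rule order_trans[OF degree_mult_le]) simp
    moreover have "q \<noteq> 0" using nz by auto
    ultimately show "2 * degree (- (q * lin)) + 3 < N + 3" using 1(3) by linarith
  qed simp
  moreover have "pol (q * cubic) (p - q * lin) = pol (q * cubic) 0 + (pol 0 p + pol 0 (- (q * lin)))"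
    by (simp only: pol_add add_0_right add_0_left diff_conv_add_uminus)
  ultimately show ?thesis by (simp only: pole_lt_add)
qed

lemma y_pow_pole: "y ^ n \<in> pole_lt (3 * n + 1)"
proof (induction n)
  case 0
  show ?case using pole_ltI[of 1 1 0] by (simp add: pol_def)
next
  case (Suc n)
  show ?case using pole_lt_y[OF Suc] by (simp add: algebra_simps)
qed

lemma pole_lt_x_pow: "f \<in> pole_lt N \<Longrightarrow> x ^ n * f \<in> pole_lt (N + 2 * n)"
proof (induction n)
  case (Suc n)
  then show ?case using pole_lt_x[of "x ^ n * f" "N + 2 * n"] by (simp add: mult.assoc)
qed simp

text \<open>\<open>x^3 - y^2\<close> has a pole of order below 6, so \<open>y ^ (2 * m)\<close> and
  \<open>x ^ (3 * m)\<close> have the same leading term, and the degree of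
  \<open>x ^ (3 * m)\<close> is visible in the normal form.\<close>

lemma y_even_pow_pole: "y ^ (2 * m) \<notin> pole_lt (6 * m)"
proof
  assume y: "y ^ (2 * m) \<in> pole_lt (6 * m)"
  have "x ^ (3 * m) - y ^ (2 * m) \<in> pole_lt (6 * m)"
  proof (induction m)
    case 0
    show ?case using pole_ltI[of 0 0 0] by (simp add: pol_def)
  next
    case (Suc m)
    have "x ^ (3 * Suc m) - y ^ (2 * Suc m)
      = x ^ (3 * m) * (x^3 - y^2) + y * (y * (x ^ (3 * m) - y ^ (2 * m)))"
      by (simp add: algebra_simps power_add power2_eq_square)
    moreover have "x^3 - y^2 = pol (- [:a6 E, a4 E, a2 E:]) lin"
      using curve_eq by (simp add: pol_def algebra_simps power2_eq_square)
    moreover have "pol (- [:a6 E, a4 E, a2 E:]) lin \<in> pole_lt 6"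
      by (intro pole_ltI) (simp_all del: minus_pCons)
    moreover have "6 + 2 * (3 * m) = 6 * Suc m" "6 * m + 3 + 3 = 6 * Suc m" by simp_all
    ultimately show ?case
      using pole_lt_add pole_lt_x_pow[of _ 6 "3 * m"] pole_lt_y[OF pole_lt_y[OF Suc]] by metis
  qed
  from pole_lt_add[OF this y] have "pol (monom 1 (3 * m)) 0 \<in> pole_lt (6 * m)"
    by (simp add: pol_def monom_altdef)
  then show False by (auto simp: pole_lt_def pol_inj degree_monom_eq)
qed

abbreviation (input) zo where "zo \<equiv> x / y"
abbreviation (input) wo where "wo \<equiv> 1 / y"

text \<open>With weight 2 for \<open>x\<close> and 3 for \<open>y\<close>, the coordinates
  \<open>x / y\<close> and \<open>1 / y\<close> have negative weight. So after clearing denominators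
  by \<open>y ^ n\<close> only the constant term reaches weight \<open>3 * n\<close>. The bound
  \<open>N\<close> keeps \<open>n\<close> large enough to clear them.\<close>

lemma origin_leading:
  "\<exists>N. \<forall>n\<ge>N. eval2 h p zo wo * y ^ n - h (eval2 id p 0 0) * y ^ n \<in> pole_lt (3 * n)"
proof -
  have bnd: "f * y ^ n \<in> pole_lt (3 * n + 1)" if "f * y ^ n - h c * y ^ n \<in> pole_lt (3 * n)" for f c n
    using pole_lt_add[OF pole_lt_mono[OF that] pole_lt_scale[OF y_pow_pole, of c n]] by simp
  have 1: "\<exists>N. \<forall>n\<ge>N. ev1 zo p * y ^ n - h (poly p 0) * y ^ n \<in> pole_lt (3 * n)" for p
  proof (induction p)
    case 0
    show ?case using pole_ltI[of 0 _ 0] by (simp add: pol_def)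
  next
    case (pCons c p)
    then obtain N where N: "\<forall>n\<ge>N. ev1 zo p * y ^ n - h (poly p 0) * y ^ n \<in> pole_lt (3 * n)" by blast
    have "ev1 zo (pCons c p) * y ^ n - h (poly (pCons c p) 0) * y ^ n \<in> pole_lt (3 * n)"
      if n: "n \<ge> Suc N" for n
    proof -
      obtain m where m: "n = Suc m" "m \<ge> N" using n by (cases n) auto
      have "x * (ev1 zo p * y ^ m) \<in> pole_lt (3 * m + 1 + 2)" using bnd N m by (intro pole_lt_x) blast
      moreover have "x * (ev1 zo p * y ^ m) = ev1 zo (pCons c p) * y ^ n - h (poly (pCons c p) 0) * y ^ n"
        by (simp add: m algebra_simps)
      moreover have "3 * m + 1 + 2 = 3 * n" by (simp add: m)
      ultimately show ?thesis by metis
    qed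
    then show ?case by blast
  qed
  show ?thesis
  proof (induction p)
    case 0
    show ?case unfolding eval2_0 idc.eval2_0 using pole_ltI[of 0 _ 0] by (simp add: pol_def)
  next
    case (pCons q p)
    then obtain N where N: "\<forall>n\<ge>N. eval2 h p zo wo * y ^ n - h (eval2 id p 0 0) * y ^ n \<in> pole_lt (3 * n)" by blast
    obtain M where M: "\<forall>n\<ge>M. ev1 zo q * y ^ n - h (poly q 0) * y ^ n \<in> pole_lt (3 * n)" using 1 by blast
    have "eval2 h (pCons q p) zo wo * y ^ n - h (eval2 id (pCons q p) 0 0) * y ^ n \<in> pole_lt (3 * n)"
      if n: "n \<ge> Suc (max M N)" for n
    proof -
      obtain m where m: "n = Suc m" "m \<ge> N" "n \<ge> M" using n by (cases n) auto
      have "eval2 h p zo wo * y ^ m \<in> pole_lt (3 * m + 1)" using bnd N m by blast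
      then have "eval2 h p zo wo * y ^ m \<in> pole_lt (3 * n)" using m by (auto elim: pole_lt_mono)
      moreover have "eval2 h (pCons q p) zo wo * y ^ n - h (eval2 id (pCons q p) 0 0) * y ^ n
        = (ev1 zo q * y ^ n - h (poly q 0) * y ^ n) + eval2 h p zo wo * y ^ m"
        by (simp add: m algebra_simps)
      ultimately show ?thesis using M m(3) pole_lt_add by metis
    qed
    then show ?case by blast
  qed
qed

text \<open>If the constant term were nonzero, a vanishing expression would put
  \<open>y ^ (2 * N)\<close> among the functions of pole order below \<open>6 * N\<close>.
  Valuations at the origin are not yet available here; \<open>pole_lt\<close> takes their
  place.\<close>

lemma chart_origin: "chart_loc (const K) zo wo 0 0"
proof
  fix p assume p: "eval2 h p zo wo = 0"
  show "eval2 id p 0 0 = 0"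
  proof (rule ccontr)
    assume nz: "eval2 id p 0 0 \<noteq> 0"
    obtain N where N: "\<forall>n\<ge>N. eval2 h p zo wo * y ^ n - h (eval2 id p 0 0) * y ^ n \<in> pole_lt (3 * n)"
      using origin_leading by blast
    have "- h (eval2 id p 0 0) * y ^ (2 * N) \<in> pole_lt (6 * N)"
      using N[rule_format, of "2 * N"] p by simp
    from pole_lt_scale[OF this, of "- inverse (eval2 id p 0 0)"]
    show False using nz y_even_pow_pole by (simp add: mult.assoc[symmetric])
  qed
qed

text \<open>The curve equation divided by \<open>y^3\<close>. The bracket has value 1 at the origin,
  so \<open>1 / y\<close> is the cube of \<open>x / y\<close> up to a unit.\<close>

lemma w_eq: "wo * (1 + A1 * zo + A3 * wo - A2 * zo^2 - A4 * zo * wo - A6 * wo^2) = zo^3"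
proof -
  have "wo * (1 + A1 * zo + A3 * wo - A2 * zo^2 - A4 * zo * wo - A6 * wo^2) * y^3
    = y^2 + A1 * x * y + A3 * y - A2 * x^2 - A4 * x - A6"
    by (simp add: field_simps power2_eq_square power3_eq_cube)
  also have "\<dots> = zo^3 * y^3" unfolding curve_eq by (simp add: power_divide)
  finally show ?thesis unfolding mult_right_cancel[OF power_not_zero[OF y_nz]] .
qed

text \<open>By \<open>w_eq\<close>, \<open>x\<close> and \<open>y\<close> are
  \<open>zo powi (-2)\<close> and \<open>zo powi (-3)\<close> times a unit. Then the summands p(x)
  and q(x) y have even and odd order; the orders differ, and the smaller one is that of the
  sum.\<close>

lemma place_origin: "place_loc (const K) zo wo 0 0 (unif Origin)"
proof -
  interpret chart_loc "const K" zo wo 0 0 by (rule chart_origin)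
  have u: "unif Origin = zo" by (simp add: unif_def)
  define U where "U = 1 + A1 * zo + A3 * wo - A2 * zo^2 - A4 * zo * wo - A6 * wo^2"
  have "val U (1 + a1 E * 0 + a3 E * 0 - a2 E * 0^2 - a4 E * 0 * 0 - a6 E * 0^2)"
    unfolding U_def by (intro val_add val_diff val_mult val_const val_1 val_u val_v val_power)
  then have U: "val U 1" by simp
  have U0: "U \<noteq> 0" using val_nz[OF U] by simp
  have wU: "wo * U = zo^3" using w_eq by (simp only: U_def)
  have z0: "zo \<noteq> 0" by simp
  have yU: "y = zo powi (-3) * U" using wU U0
    by (simp add: power_int_minus field_simps)
  have xU: "x = zo powi (-2) * U"
  proof -
    have "x = zo * y" by simp
    also have "\<dots> = zo powi 1 * zo powi (-3) * U" by (subst yU) (simp only: power_int_1_right mult.assoc)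
    also have "zo powi 1 * zo powi (-3) = zo powi (-2)" by (subst power_int_add[symmetric]) (use z0 in auto)
    finally show ?thesis .
  qed
  have "1 / x = zo ^ 2 * inverse U" by (subst xU) (simp add: power_int_minus field_simps)
  then have valx: "val (1 / x) 0"
    using val_mult[OF val_power[OF val_u, of 2] val_inverse[OF U]] by simp
  have 1: "\<exists>e c. ev1 x p = x ^ degree p * e \<and> val e c \<and> c \<noteq> 0" if "p \<noteq> 0" for p
    using that
  proof (induction p)
    case (pCons a p)
    show ?case
    proof (cases "p = 0")
      case True
      then show ?thesis using pCons val_const by auto
    next
      case False
      then obtain e c where e: "ev1 x p = x ^ degree p * e" "val e c" "c \<noteq> 0" using pCons by blast
      have "ev1 x (pCons a p) = x ^ degree (pCons a p) * (e + h a * (1 / x) ^ Suc (degree p))"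
        using False e by (simp add: power_divide field_simps)
      moreover have "val (e + h a * (1 / x) ^ Suc (degree p)) (c + a * 0 ^ Suc (degree p))"
        by (intro val_add e val_mult val_const val_power valx)
      ultimately show ?thesis using e by (metis add.right_neutral mult_zero_right power_0_Suc)
    qed
  qed simp
  have 2: "\<exists>e c. ev1 x p = zo powi (- 2 * int (degree p)) * e \<and> val e c \<and> c \<noteq> 0" if nz: "p \<noteq> 0" for p
  proof -
    obtain e c where e: "ev1 x p = x ^ degree p * e" "val e c" "c \<noteq> 0" using 1[OF nz] by blast
    have "x ^ degree p = (zo powi (-2)) ^ degree p * U ^ degree p"
      by (subst xU) (simp only: power_mult_distrib)
    also have "(zo powi (-2)) ^ degree p = zo powi (- 2 * int (degree p))"
      by (simp only: power_int_mult power_int_of_nat)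
    finally have "ev1 x p = zo powi (- 2 * int (degree p)) * (U ^ degree p * e)"
      by (simp only: e mult.assoc)
    moreover have "val (U ^ degree p * e) (1 ^ degree p * c)" by (intro val_mult val_power U e)
    ultimately show ?thesis using e by auto
  qed
  have 3: "\<exists>n e c. pol p q = zo powi n * e \<and> val e c \<and> c \<noteq> 0" if nz: "\<not> (p = 0 \<and> q = 0)" for p q
  proof -
    have q: "\<exists>e c. ev1 x q * y = zo powi (- 2 * int (degree q) - 3) * e \<and> val e c \<and> c \<noteq> 0" if q0: "q \<noteq> 0"
    proof -
      obtain e c where e: "ev1 x q = zo powi (- 2 * int (degree q)) * e" "val e c" "c \<noteq> 0"
        using 2[OF q0] by blast
      have "ev1 x q * y = (zo powi (- 2 * int (degree q)) * zo powi (-3)) * (e * U)"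
        by (subst yU) (simp only: e mult_ac)
      also have "zo powi (- 2 * int (degree q)) * zo powi (-3) = zo powi (- 2 * int (degree q) - 3)"
        by (subst power_int_add[symmetric]) (use z0 in auto)
      finally show ?thesis using val_mult[OF e(2) U] e(3) by (metis mult.right_neutral)
    qed
    have sum: "\<exists>n e c. zo powi a * e1 + zo powi b * e2 = zo powi n * e \<and> val e c \<and> c \<noteq> 0"
      if "a < b" "val e1 c1" "c1 \<noteq> 0" "val e2 c2" for a b e1 e2 c1 c2
    proof -
      have "zo powi b = zo powi a * zo powi (b - a)" using z0 by (simp flip: power_int_add)
      then have "zo powi a * e1 + zo powi b * e2 = zo powi a * (e1 + zo powi (b - a) * e2)"
        by (simp only: distrib_left mult.assoc)
      moreover have "zo powi (b - a) = zo ^ nat (b - a)" using that(1) by (simp add: power_int_def)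
      moreover have "val (e1 + zo ^ nat (b - a) * e2) (c1 + 0 ^ nat (b - a) * c2)"
        by (intro val_add val_mult val_power val_u that)
      moreover have "c1 + 0 ^ nat (b - a) * c2 = c1" using that(1) by simp
      ultimately show ?thesis using that(3) by metis
    qed
    show ?thesis
    proof (cases "q = 0")
      case True
      then show ?thesis using 2[of p] nz by (auto simp: pol_def)
    next
      case False
      then obtain e c where e: "ev1 x q * y = zo powi (- 2 * int (degree q) - 3) * e" "val e c" "c \<noteq> 0"
        using q by blast
      show ?thesis
      proof (cases "p = 0")
        case True
        then show ?thesis using e unfolding pol_def by auto
      next
        case False
        then obtain e' c' where e': "ev1 x p = zo powi (- 2 * int (degree p)) * e'" "val e' c'" "c' \<noteq> 0"
          using 2 by blast
        have "- 2 * int (degree p) \<noteq> - 2 * int (degree q) - 3" by presburger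
        then show ?thesis unfolding pol_def e e'
          using sum[OF _ e'(2,3) e(2)] sum[OF _ e(2,3) e'(2)]
          by (metis add.commute linorder_neqE)
      qed
    qed
  qed
  show ?thesis unfolding u
  proof
    show "zo \<noteq> 0" "val zo 0" using val_u by simp_all
    fix f :: 'k assume f: "f \<noteq> 0"
    obtain p q r where r: "r \<noteq> 0" "f = pol p q / ev1 x r" by (rule repr)
    then obtain n e c where 1: "pol p q = zo powi n * e" "val e c" "c \<noteq> 0"
      using 3[of p q] f pol_eq_0_iff by auto
    obtain n' e' c' where 2: "ev1 x r = zo powi n' * e'" "val e' c'" "c' \<noteq> 0"
      using 2[OF r(1)] by blast
    have "f = zo powi (n - n') * (e / e')"
      unfolding r(2) 1 2 using z0 by (subst power_int_diff) auto
    then show "\<exists>n e c. f = zo powi n * e \<and> val e c \<and> c \<noteq> 0"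
      using val_divide[OF 1(2) 2(2,3)] 1(3) 2(3) by (metis divide_eq_0_iff)
  qed
qed

subsection \<open>Valuations\<close>

lemma place: "on_curve E P \<Longrightarrow> place_loc (const K) (cu P) (cv P) (cu0 P) (cv0 P) (unif P)"
  by (cases P) (simp_all add: place_origin place_affine)

lemma has_value_val:
  "on_curve E P \<Longrightarrow> has_value K P f c \<longleftrightarrow> chart_loc.val (const K) (cu P) (cv P) (cu0 P) (cv0 P) f c"
  by (subst chart_loc.val_def[OF place_loc.axioms(1)[OF place]])
    (auto simp: has_value_def case_prod_beta)

lemma valuation_at_ord:
  assumes "on_curve E P"
  shows "valuation_at K P = place_loc.ord (const K) (cu P) (cv P) (cu0 P) (cv0 P) (unif P)"
proof -
  interpret place_loc "const K" "cu P" "cv P" "cu0 P" "cv0 P" "unif P" by (rule place[OF assms])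
  have L: "local_ring K P = {f. \<exists>c. val f c}"
    using has_value_val[OF assms] by (simp add: local_ring_def)
  show ?thesis unfolding valuation_at_def L
  proof (rule the_equality)
    show "normalized_valuation ord \<and> {f. f = 0 \<or> ord f \<ge> 0} = {f. \<exists>c. val f c}"
      using normalized_valuation_ord val_iff_ord by auto
  qed (use ord_unique in blast)
qed

end

context ec_field begin

abbreviation nu :: "'c point \<Rightarrow> 'k \<Rightarrow> int" where "nu \<equiv> valuation_at K"
abbreviation hv :: "'c point \<Rightarrow> 'k \<Rightarrow> 'c \<Rightarrow> bool" where "hv \<equiv> has_value K"

context
  fixes P assumes P: "on_curve E P"
begin

interpretation pl: place_loc "const K" "cu P" "cv P" "cu0 P" "cv0 P" "unif P"
  rewrites "pl.val = has_value K P" and "pl.ord = valuation_at K P"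
proof -
  show "place_loc (const K) (cu P) (cv P) (cu0 P) (cv0 P) (unif P)" by (rule place[OF P])
qed (use has_value_val[OF P] valuation_at_ord[OF P] in auto)

lemmas hv_unique = pl.val_unique
  and hv_u = pl.val_u
  and hv_v = pl.val_v
  and hv_const = pl.val_const
  and hv_0 = pl.val_0
  and hv_1 = pl.val_1
  and hv_add = pl.val_add
  and hv_mult = pl.val_mult
  and hv_minus = pl.val_minus
  and hv_diff = pl.val_diff
  and hv_divide = pl.val_divide
  and hv_power = pl.val_power
  and hv_nz = pl.val_nz
  and hv_ev1 = pl.val_ev1
  and hv_eval2 = pl.val_eval2
  and unif_nz = pl.t_nz
  and hv_unif = pl.val_t
  and nuE = pl.ordE
  and nuI = pl.ordI
  and nu_0 = pl.ord_0
  and nu_unif = pl.ord_t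
  and nu_unit = pl.ord_unit
  and nu_const = pl.ord_const
  and nu_mult = pl.ord_mult
  and nu_divide = pl.ord_divide
  and nu_inverse = pl.ord_inverse
  and nu_power = pl.ord_power
  and nu_power_int = pl.ord_power_int
  and nu_minus = pl.ord_minus
  and nu_add = pl.ord_add
  and nu_add_less = pl.ord_add_less
  and hv_nu_nonneg = pl.val_ord_nonneg
  and nu_pos_hv = pl.ord_pos_val
  and hv_iff_nu = pl.val_iff_ord
  and hv_0_iff_nu = pl.val_0_iff_ord

end

lemma local_ring_iff: "f \<in> local_ring K P \<longleftrightarrow> (\<exists>c. hv P f c)"
  by (simp add: local_ring_def)

lemma hv_x: "on_curve E (Affine x0 y0) \<Longrightarrow> hv (Affine x0 y0) x x0"
  and hv_y: "on_curve E (Affine x0 y0) \<Longrightarrow> hv (Affine x0 y0) y y0"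
  using hv_u[of "Affine x0 y0"] hv_v[of "Affine x0 y0"] by simp_all

lemma hv_pol: assumes "on_curve E (Affine x0 y0)"
  shows "hv (Affine x0 y0) (pol p q) (poly p x0 + poly q x0 * y0)"
  unfolding pol_def by (intro hv_add hv_mult hv_ev1 hv_x hv_y assms)

lemma on_curve_neg: "on_curve E P \<Longrightarrow> on_curve E (ec_neg E P)"
  by (cases P) (simp_all add: algebra_simps power2_eq_square)

lemma neg_neg [simp]: "ec_neg E (ec_neg E P) = P"
  by (cases P) simp_all

lemma on_curve_exists: "\<exists>y0. on_curve E (Affine x0 y0)"
proof -
  obtain y0 where "poly [: - poly cubic x0, a1 E * x0 + a3 E, 1 :] y0 = 0"
    using alg_closed_imp_poly_has_root[of "[: - poly cubic x0, a1 E * x0 + a3 E, 1 :]"] by auto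
  then show ?thesis
    by (intro exI[of _ y0]) (simp add: algebra_simps power2_eq_square power3_eq_cube)
qed

lemma infinite_points: "infinite (curve_points E)"
proof
  assume fin: "finite (curve_points E)"
  define f where "f x0 = Affine x0 (SOME y0. on_curve E (Affine x0 y0))" for x0
  have "range f \<subseteq> curve_points E"
    unfolding f_def curve_points_def using someI_ex[OF on_curve_exists] by blast
  then have "finite (range f)" using fin finite_subset by blast
  moreover have "inj f" by (rule injI) (simp add: f_def)
  ultimately show False using finite_imageD infinite_UNIV_char_0 by blast
qed

text \<open>At affine points \<open>pol p q\<close> is regular, so a nonzero order means a zero, and
  then the norm vanishes there as well. The norm has finitely many roots \<open>x0\<close>, each
  with finitely many \<open>y0\<close> above it.\<close>

lemma finite_zeros: assumes "f \<noteq> 0" shows "finite {P. on_curve E P \<and> nu P f \<noteq> 0}"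
proof -
  have fin: "finite {P. on_curve E P \<and> nu P (pol p q) \<noteq> 0}" if nz: "\<not> (p = 0 \<and> q = 0)" for p q
  proof -
    define X where "X = {x0. poly (nrm p q) x0 = 0}"
    have X: "finite X" using nz nrm_eq_0_iff by (simp add: X_def poly_roots_finite)
    define Y where "Y x0 = {y0. poly [: - poly cubic x0, a1 E * x0 + a3 E, 1 :] y0 = 0}" for x0
    have Y: "finite (Y x0)" for x0 by (simp add: Y_def poly_roots_finite del: poly_pCons)
    have "{P. on_curve E P \<and> nu P (pol p q) \<noteq> 0} \<subseteq> insert Origin (\<Union>x0\<in>X. Affine x0 ` Y x0)"
    proof (intro subsetI insertCI)
      fix P assume "P \<in> {P. on_curve E P \<and> nu P (pol p q) \<noteq> 0}" "P \<notin> (\<Union>x0\<in>X. Affine x0 ` Y x0)"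
      then have P: "on_curve E P" "nu P (pol p q) \<noteq> 0" by auto
      show "P = Origin"
      proof (rule ccontr)
        assume "P \<noteq> Origin"
        then obtain x0 y0 where P': "P = Affine x0 y0" by (cases P) auto
        note oc = P(1)[unfolded P']
        have "pol p q \<noteq> 0" using nz pol_eq_0_iff by blast
        then have "nu P (pol p q) \<ge> 0" using hv_nu_nonneg[OF P(1)] hv_pol[OF oc] P' by blast
        then have "hv P (pol p q) 0" using nu_pos_hv[OF P(1) \<open>pol p q \<noteq> 0\<close>] P(2) by linarith
        then have "hv P (pol p q * polbar p q) (0 * (poly (p - q * lin) x0 + poly (- q) x0 * y0))"
          unfolding polbar_pol by (rule hv_mult[OF P(1) _ hv_pol[OF oc, folded P']])
        then have "poly (nrm p q) x0 = 0"
          using hv_ev1[OF oc hv_x[OF oc], of "nrm p q"] hv_unique[OF P(1)]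
          unfolding pol_times_polbar P' by simp
        moreover have "y0 \<in> Y x0" using oc
          by (simp add: Y_def algebra_simps power2_eq_square power3_eq_cube)
        ultimately have "P \<in> (\<Union>x0\<in>X. Affine x0 ` Y x0)" unfolding P' X_def by blast
        then show False using \<open>P \<notin> (\<Union>x0\<in>X. Affine x0 ` Y x0)\<close> by contradiction
      qed
    qed
    then show ?thesis by (rule finite_subset) (use X Y in auto)
  qed
  obtain p q r where r: "r \<noteq> 0" "f = pol p q / ev1 x r" by (rule repr)
  have p: "\<not> (p = 0 \<and> q = 0)" using assms r by (auto simp: pol_def)
  have "nu P f = nu P (pol p q) - nu P (pol r 0)" if "on_curve E P" for P
    unfolding r(2) ev1_x_of_poly using nu_divide[OF that] p r(1) pol_eq_0_iff by simp
  then have "{P. on_curve E P \<and> nu P f \<noteq> 0}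
      \<subseteq> {P. on_curve E P \<and> nu P (pol p q) \<noteq> 0} \<union> {P. on_curve E P \<and> nu P (pol r 0) \<noteq> 0}" by auto
  then show ?thesis by (rule finite_subset) (use fin[OF p] fin[of r 0] r(1) in auto)
qed

lemma eq_if_values_eq:
  assumes "infinite {P. on_curve E P \<and> (\<exists>c. hv P f c \<and> hv P g c)}" shows "f = g"
proof (rule ccontr)
  assume "f \<noteq> g"
  then have nz: "f - g \<noteq> 0" by simp
  have "{P. on_curve E P \<and> (\<exists>c. hv P f c \<and> hv P g c)} \<subseteq> {P. on_curve E P \<and> nu P (f - g) \<noteq> 0}"
  proof safe
    fix P c assume P: "on_curve E P" "hv P f c" "hv P g c" "nu P (f - g) = 0"
    then have "hv P (f - g) 0" using hv_diff[OF P(1-3)] by simp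
    then show False using hv_0_iff_nu[OF P(1) nz] P(4) by simp
  qed
  then show False using assms finite_zeros[OF nz] finite_subset by blast
qed


subsection \<open>Functions with restricted poles\<close>

lemma nu_Origin_w: "nu Origin (1 / y) = 3" and nu_Origin_z: "nu Origin (x / y) = 1"
proof -
  have oc: "on_curve E Origin" by simp
  show z: "nu Origin (x / y) = 1" using nu_unif[OF oc] by (simp add: unif_def)
  let ?U = "1 + A1 * (x / y) + A3 * (1 / y) - A2 * (x / y)^2 - A4 * (x / y) * (1 / y) - A6 * (1 / y)^2"
  have "hv Origin ?U (1 + a1 E * 0 + a3 E * 0 - a2 E * 0^2 - a4 E * 0 * 0 - a6 E * 0^2)"
    using hv_u[OF oc] hv_v[OF oc]
    by (intro hv_add hv_diff hv_mult hv_const hv_1 hv_power oc) simp_all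
  then have U: "hv Origin ?U 1" by simp
  have "nu Origin (1 / y * ?U) = nu Origin (1 / y) + nu Origin ?U"
    by (rule nu_mult[OF oc]) (use hv_nz[OF oc U] in auto)
  then have "nu Origin ((x / y) ^ 3) = nu Origin (1 / y)"
    unfolding w_eq using nu_unit[OF oc U] by simp
  then show "nu Origin (1 / y) = 3" using nu_power[OF oc, of "x / y" 3] z by simp
qed

lemma nu_Origin_y: "nu Origin y = -3"
  using nu_inverse[of Origin "1 / y"] nu_Origin_w by simp

lemma nu_Origin_x: "nu Origin x = -2"
  using nu_mult[of Origin "x / y" y] nu_Origin_y nu_Origin_z by simp

lemma nu_Origin_ev1: "p \<noteq> 0 \<Longrightarrow> nu Origin (ev1 x p) = - 2 * int (degree p)"
proof (induction p)
  case (pCons a p)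
  show ?case
  proof (cases "p = 0")
    case False
    then have 1: "nu Origin (x * ev1 x p) = - 2 * int (Suc (degree p))"
      using nu_mult[of Origin x "ev1 x p"] nu_Origin_x pCons by simp
    have "nu Origin (x * ev1 x p + h a) = nu Origin (x * ev1 x p)"
    proof (cases "a = 0")
      case a: False
      show ?thesis using nu_add_less(2)[of Origin "x * ev1 x p" "h a"] a False 1 nu_const[of Origin a] by simp
    qed simp
    then show ?thesis using 1 False by (simp add: add.commute)
  qed (use nu_const[of Origin a] in simp)
qed simp

text \<open>The pole orders of p(x) and q(x) y have different parity, so the pole order of the sum
  is the larger of the two: \<open>2 * degree p\<close> or \<open>2 * degree q + 3\<close>. None of
  these numbers is 1, which is why order -1 can be allowed.\<close>

lemma pol_Origin_const:
  assumes "pol p q = 0 \<or> nu Origin (pol p q) \<ge> -1" shows "\<exists>c. pol p q = h c"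
proof (cases "pol p q = 0")
  case False
  have nq: "nu Origin (ev1 x q * y) = - 2 * int (degree q) - 3" if "q \<noteq> 0"
    using nu_mult[of Origin "ev1 x q" y] that nu_Origin_y nu_Origin_ev1 by simp
  have q: "q = 0"
  proof (rule ccontr)
    assume q: "q \<noteq> 0"
    have p: "p \<noteq> 0"
      using nq q assms False by (auto simp: pol_def)
    have "nu Origin (ev1 x p) \<noteq> nu Origin (ev1 x q * y)"
      unfolding nq[OF q] nu_Origin_ev1[OF p] by presburger
    then have "nu Origin (pol p q) \<le> nu Origin (ev1 x q * y)"
      using nu_add_less(2)[of Origin "ev1 x p" "ev1 x q * y"]
        nu_add_less(2)[of Origin "ev1 x q * y" "ev1 x p"] p q
      by (fastforce simp: pol_def add.commute)
    then show False using assms False nq[OF q] by simp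
  qed
  then have p: "p \<noteq> 0" using False by (auto simp: pol_def)
  have "- 2 * int (degree p) \<ge> -1" using assms False nu_Origin_ev1[OF p] q by (simp add: pol_def)
  then have "degree p = 0" by simp
  then obtain c where "p = [:c:]" by (elim degree_eq_zeroE)
  then show ?thesis using q by (auto simp: pol_def)
next
  case True
  then show ?thesis by (intro exI[of _ 0]) simp
qed

text \<open>The affine coordinate ring of a nonsingular curve is integrally closed, made explicit.
  At a root \<open>x0\<close> of the denominator the numerator vanishes at every point above
  \<open>x0\<close>, which forces \<open>p\<close> and \<open>q\<close> to vanish at
  \<open>x0\<close>, and a linear factor cancels.\<close>

lemma affine_regular_pol:
  assumes "\<And>x0 y0. on_curve E (Affine x0 y0) \<Longrightarrow> \<exists>c. hv (Affine x0 y0) f c"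
  shows "\<exists>p q. f = pol p q"
proof -
  have "\<exists>p q. f = pol p q" if "r \<noteq> 0" "f = pol p q / ev1 x r" for p q r
    using that
  proof (induction "degree r" arbitrary: p q r)
    case 0
    then obtain c where c: "r = [:c:]" by (metis degree_eq_zeroE)
    then have "f = pol (smult (inverse c) p) (smult (inverse c) q)"
      using 0 by (simp add: pol_def field_simps)
    then show ?case by blast
  next
    case (Suc n)
    then obtain x0 where x0: "poly r x0 = 0" using alg_closed_imp_poly_has_root[of r] by auto
    then obtain r' where r': "r = [:- x0, 1:] * r'" unfolding poly_eq_0_iff_dvd by (elim dvdE)
    obtain y0 where oc: "on_curve E (Affine x0 y0)" using on_curve_exists by blast
    define y1 where "y1 = - y0 - a1 E * x0 - a3 E"
    have oc1: "on_curve E (Affine x0 y1)" using on_curve_neg[OF oc] by (simp add: y1_def)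
    have pf: "pol p q = f * ev1 x r" using Suc.prems by simp
    have zero: "poly p x0 + poly q x0 * yy = 0" if ocy: "on_curve E (Affine x0 yy)" for yy
    proof -
      obtain c where "hv (Affine x0 yy) f c" using assms ocy by blast
      then have "hv (Affine x0 yy) (f * ev1 x r) (c * poly r x0)"
        by (intro hv_mult hv_ev1 hv_x ocy)
      then show ?thesis using hv_unique[OF ocy hv_pol[OF ocy]] x0 unfolding pf[symmetric] by fastforce
    qed
    have q0: "poly q x0 = 0"
    proof (cases "y0 = y1")
      case False
      have "poly q x0 * (y0 - y1) = (poly p x0 + poly q x0 * y0) - (poly p x0 + poly q x0 * y1)"
        by (simp add: algebra_simps)
      then have "poly q x0 * (y0 - y1) = 0" unfolding zero[OF oc] zero[OF oc1] by simp
      then show ?thesis using False by simp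
    next
      \<comment> \<open>There is only one point above \<open>x0\<close>, hence only one equation.
        The other comes from the order: \<open>h (poly q x0) * t\<close> equals a multiple of
        \<open>t ^ 2\<close>, since \<open>x - h x0\<close> is divisible by
        \<open>t ^ 2\<close>.\<close>
      case True
      then have "y0 + y0 + a1 E * x0 + a3 E = 0" unfolding y1_def by (simp add: algebra_simps)
      then have ram: "2 * y0 + a1 E * x0 + a3 E = 0" by simp
      define t where "t = unif (Affine x0 y0)"
      have t: "t = y - h y0" using ram by (simp add: t_def unif_def)
      obtain e c where e: "x - h x0 = t ^ 2 * e" "hv (Affine x0 y0) e c"
        using affine_unif(5)[OF oc] has_value_val[OF oc] ram unfolding t_def by auto
      obtain d where d: "hv (Affine x0 y0) f d" using assms oc by blast
      have "[:- x0, 1:] dvd p - [:poly p x0:]" "[:- x0, 1:] dvd q - [:poly q x0:]"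
        unfolding poly_eq_0_iff_dvd[symmetric] by simp_all
      then obtain p1 q1 where p1: "p - [:poly p x0:] = [:- x0, 1:] * p1"
        and q1: "q - [:poly q x0:] = [:- x0, 1:] * q1" by (elim dvdE)
      have p1': "ev1 x p = h (poly p x0) + (x - h x0) * ev1 x p1"
        and q1': "ev1 x q = h (poly q x0) + (x - h x0) * ev1 x q1"
        using arg_cong[OF p1, of "ev1 x"] arg_cong[OF q1, of "ev1 x"]
        by (simp_all add: algebra_simps)
      have "h (poly p x0) = - h (poly q x0) * h y0" using zero[OF oc]
        by (metis add_eq_0_iff2 h_minus h_mult mult_minus_left)
      then have "pol p q = h (poly q x0) * t + (x - h x0) * pol p1 q1"
        unfolding pol_def p1' q1' t by (simp add: algebra_simps)
      moreover have "f * ev1 x r = (x - h x0) * (f * ev1 x r')"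
        by (simp add: r' algebra_simps)
      ultimately have "h (poly q x0) * t = t ^ 2 * (e * (f * ev1 x r' - pol p1 q1))"
        using pf e(1) by (simp add: algebra_simps)
      then have "t * h (poly q x0) = t * (t * (e * (f * ev1 x r' - pol p1 q1)))"
        by (simp add: power2_eq_square algebra_simps)
      moreover have "t \<noteq> 0" using unif_nz[OF oc] by (simp add: t_def)
      ultimately have *: "h (poly q x0) = t * (e * (f * ev1 x r' - pol p1 q1))" by simp
      have "hv (Affine x0 y0) (t * (e * (f * ev1 x r' - pol p1 q1)))
        (0 * (c * (d * poly r' x0 - (poly p1 x0 + poly q1 x0 * y0))))"
        unfolding t_def by (intro hv_mult hv_diff hv_ev1 hv_x hv_pol oc hv_unif d e)
      then show ?thesis using hv_unique[OF oc hv_const[OF oc, of "poly q x0"]] unfolding *[symmetric] by fastforce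
    qed
    have p0: "poly p x0 = 0" using zero[OF oc] q0 by simp
    obtain p' q' where pq: "p = [:- x0, 1:] * p'" "q = [:- x0, 1:] * q'"
      using p0 q0 unfolding poly_eq_0_iff_dvd by (elim dvdE)
    have "f = pol p' q' / ev1 x r'"
    proof -
      have "ev1 x [:- x0, 1:] * pol p' q' / (ev1 x [:- x0, 1:] * ev1 x r') = pol p' q' / ev1 x r'"
        by (rule mult_divide_mult_cancel_left) (use x_minus_nz[of x0] in simp)
      then show ?thesis unfolding Suc.prems(2) r' pq pol_scale[symmetric] ev1_mult .
    qed
    moreover have "r' \<noteq> 0" using Suc.prems r' by auto
    moreover have "n = degree r'" using Suc.hyps(2) \<open>r' \<noteq> 0\<close> unfolding r'
      by (subst (asm) degree_mult_eq) auto
    ultimately show ?case using Suc.hyps(1) by blast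
  qed
  then show ?thesis using repr by metis
qed

text \<open>Admitting a simple pole at the origin is what gives the theorem its strength: it makes
  points inequivalent as divisors and lets the residue theorem be proved by removing all other
  poles.\<close>

theorem liouville:
  assumes "\<And>P. on_curve E P \<Longrightarrow> P \<noteq> Origin \<Longrightarrow> \<exists>c. hv P f c" and "f = 0 \<or> nu Origin f \<ge> -1"
  shows "\<exists>c. f = h c"
proof -
  obtain p q where "f = pol p q" using affine_regular_pol assms(1) by blast
  then show ?thesis using pol_Origin_const assms(2) by auto
qed

lemma regular_const:
  assumes "\<And>P. on_curve E P \<Longrightarrow> f \<in> local_ring K P" shows "\<exists>c. f = h c"
  using assms hv_iff_nu[of Origin f] unfolding local_ring_iff by (intro liouville) auto

end


subsection \<open>Automorphisms induced by maps of the curve\<close>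

locale point_aut = ec_field E K + const_aut "const K" \<phi>
  for E :: "'c::{alg_closed_field, field_char_0} weierstrass"
    and K :: "('c, 'k::field) function_field" and \<phi> :: "'k \<Rightarrow> 'k" +
  fixes T :: "'c point \<Rightarrow> 'c point"
  assumes T_curve: "on_curve E P \<Longrightarrow> on_curve E (T P)"
    and hv_T: "on_curve E P \<Longrightarrow> hv (T P) f c \<Longrightarrow> hv P (\<phi> f) c"
begin

text \<open>Pullback multiplies orders by the ramification index \<open>k\<close>. Since
  \<open>\<phi>\<close> is onto, some \<open>g\<close> is pulled back to \<open>unif P\<close>, so
  \<open>k\<close> divides 1.\<close>

lemma nu_aut: assumes P: "on_curve E P" shows "nu P (\<phi> f) = nu (T P) f"
proof -
  note TP = T_curve[OF P]
  define k where "k = nu P (\<phi> (unif (T P)))"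
  have k: "nu P (\<phi> f) = nu (T P) f * k" for f
  proof (cases "f = 0")
    case False
    obtain e c where e: "f = unif (T P) powi (nu (T P) f) * e" "hv (T P) e c" "c \<noteq> 0" "e \<noteq> 0"
      using nuE[OF TP False] by metis
    have "nu P (\<phi> f) = nu P (\<phi> (unif (T P)) powi (nu (T P) f) * \<phi> e)"
      by (subst e(1)) simp
    also have "\<dots> = nu P (\<phi> (unif (T P)) powi (nu (T P) f)) + nu P (\<phi> e)"
      using e(4) unif_nz[OF TP] by (intro nu_mult[OF P]) auto
    finally show ?thesis
      using nu_unit[OF P hv_T[OF P e(2)] e(3)] nu_power_int[OF P] unif_nz[OF TP] by (simp add: k_def)
  qed (use nu_0[OF P] nu_0[OF TP] in simp)
  have "hv P (\<phi> (unif (T P))) 0" using hv_T[OF P hv_unif[OF TP]] .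
  then have "k > 0" using hv_0_iff_nu[OF P] unif_nz[OF TP] by (simp add: k_def)
  moreover obtain g where "\<phi> g = unif P" using bij_aut by (metis bij_pointE)
  then have "nu (T P) g * k = 1" using k[of g] nu_unif[OF P] by simp
  ultimately have "k = 1" by (auto simp: zmult_eq_1_iff)
  then show ?thesis using k by simp
qed

lemma hv_aut_iff: assumes P: "on_curve E P" shows "hv P (\<phi> f) c \<longleftrightarrow> hv (T P) f c"
proof
  assume c: "hv P (\<phi> f) c"
  then have "\<exists>d. hv (T P) f d"
    using hv_iff_nu[OF P, of "\<phi> f"] hv_iff_nu[OF T_curve[OF P], of f] nu_aut[OF P] by auto
  then obtain d where "hv (T P) f d" ..
  then show "hv (T P) f c" using hv_T[OF P] hv_unique[OF P c] by blast
qed (rule hv_T[OF P])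

lemma local_ring_aut_iff: "on_curve E P \<Longrightarrow> \<phi> f \<in> local_ring K P \<longleftrightarrow> f \<in> local_ring K (T P)"
  by (simp add: local_ring_iff hv_aut_iff)

end

context ec_field begin

lemma hv_eval2_transport:
  assumes P: "on_curve E P" and Q: "on_curve E Q"
    and u: "hv P (sg (cu Q)) (cu0 Q)" and v: "hv P (sg (cv Q)) (cv0 Q)" and f: "hv Q f c"
  shows "hv P (sg f) c"
proof -
  interpret Q: place_loc "const K" "cu Q" "cv Q" "cu0 Q" "cv0 Q" "unif Q" by (rule place[OF Q])
  obtain p q where pq: "eval2 id q (cu0 Q) (cv0 Q) \<noteq> 0"
    "f = eval2 h p (cu Q) (cv Q) / eval2 h q (cu Q) (cv Q)"
    "c = eval2 id p (cu0 Q) (cv0 Q) / eval2 id q (cu0 Q) (cv0 Q)"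
    using f unfolding has_value_val[OF Q] Q.val_def by blast
  show ?thesis unfolding pq(2,3) sg.aut_divide sg.aut_eval2
    by (intro hv_divide hv_eval2 u v P pq(1))
qed

lemma hv_sg: assumes P: "on_curve E P" and f: "hv (ec_neg E P) f c" shows "hv P (sg f) c"
proof (cases P)
  case (Affine x0 y0)
  note oc = P[unfolded Affine]
  have "hv P ybar (- y0 - a1 E * x0 - a3 E)" unfolding ybar_def Affine
    by (intro hv_diff hv_minus hv_mult hv_const hv_x hv_y oc)
  moreover have "hv P x x0" using hv_x[OF oc] Affine by simp
  ultimately show ?thesis
    by (intro hv_eval2_transport[OF P on_curve_neg[OF P] _ _ f]) (simp_all add: Affine)
next
  case Origin
  have o: "on_curve E Origin" by simp
  have z: "hv Origin (x / y) 0" "hv Origin (1 / y) 0" using hv_u[OF o] hv_v[OF o] by simp_all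
  have "hv Origin (- 1 - A1 * (x / y) - A3 * (1 / y)) (- 1 - a1 E * 0 - a3 E * 0)"
    by (intro hv_diff hv_minus hv_mult hv_const hv_1 z o)
  moreover have "- 1 - A1 * (x / y) - A3 * (1 / y) = ybar / y"
    by (simp add: ybar_def field_simps)
  ultimately have b: "hv Origin (ybar / y) (- 1)" by simp
  have "hv Origin (x / y / (ybar / y)) (0 / - 1)" "hv Origin (1 / y / (ybar / y)) (0 / - 1)"
    by (intro hv_divide z b o; simp)+
  then have "hv Origin (x / ybar) 0" "hv Origin (1 / ybar) 0" by simp_all
  then show ?thesis
    by (intro hv_eval2_transport[OF P on_curve_neg[OF P] _ _ f]) (simp_all add: Origin)
qed

sublocale sg: point_aut E K sg "ec_neg E"
  by unfold_locales (auto simp: on_curve_neg hv_sg)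

end

section \<open>The group law via divisors\<close>

text \<open>Taylor expansion at \<open>x1\<close> of the cubic that results from substituting the
  line into the curve equation; the constant term vanishes because \<open>(x1, y1)\<close> lies on
  the curve.\<close>

lemma line_cubic:
  fixes x1 y1 X l :: "'a::field"
  assumes "y1^2 + c1 * x1 * y1 + c3 * y1 = x1^3 + c2 * x1^2 + c4 * x1 + c6"
  defines "L \<equiv> l * (X - x1) + y1"
  shows "X^3 + c2 * X^2 + c4 * X + c6 - L * (c1 * X + c3) - L^2 =
    (X - x1) * ((3 * x1^2 + 2 * c2 * x1 + c4 - c1 * y1 - l * (2 * y1 + c1 * x1 + c3))
      + (X - x1) * (3 * x1 + c2 - c1 * l - l^2) + (X - x1)^2)"
proof -
  define d where "d = X - x1"
  have X: "X = x1 + d" by (simp add: d_def)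
  have c6: "c6 = y1^2 + c1 * x1 * y1 + c3 * y1 - x1^3 - c2 * x1^2 - c4 * x1"
    using assms(1) by (simp add: algebra_simps)
  show ?thesis unfolding L_def d_def[symmetric] unfolding X c6
    by (simp add: algebra_simps power2_eq_square power3_eq_cube)
qed

text \<open>By Vieta's formulas for the quadratic factor in \<open>X - x1\<close>, whose roots are
  \<open>x2 - x1\<close> and \<open>x3 - x1\<close>. Hypothesis \<open>s\<close> gives their
  product, the formula for \<open>x3\<close> their sum; this form covers chords and tangents
  alike.\<close>

lemma line_cubic_factor:
  fixes x1 y1 x2 x3 X l :: "'a::field"
  assumes "y1^2 + c1 * x1 * y1 + c3 * y1 = x1^3 + c2 * x1^2 + c4 * x1 + c6"
    and s: "3 * x1^2 + 2 * c2 * x1 + c4 - c1 * y1 - l * (2 * y1 + c1 * x1 + c3) = (x1 - x2) * (x1 - x3)"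
    and x3: "x3 = l^2 + c1 * l - c2 - x1 - x2"
  defines "L \<equiv> l * (X - x1) + y1"
  shows "X^3 + c2 * X^2 + c4 * X + c6 - L * (c1 * X + c3) - L^2 = (X - x1) * (X - x2) * (X - x3)"
proof -
  have 1: "3 * x1 + c2 - c1 * l - l^2 = (x1 - x2) + (x1 - x3)" unfolding x3 by simp
  show ?thesis unfolding L_def line_cubic[OF assms(1)] s 1
    by (simp add: algebra_simps power2_eq_square)
qed

lemma chord_slope:
  fixes x1 y1 x2 y2 l :: "'a::field"
  assumes 1: "y1^2 + c1 * x1 * y1 + c3 * y1 = x1^3 + c2 * x1^2 + c4 * x1 + c6"
    and 2: "y2^2 + c1 * x2 * y2 + c3 * y2 = x2^3 + c2 * x2^2 + c4 * x2 + c6"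
    and l: "y2 = l * (x2 - x1) + y1" and "x1 \<noteq> x2"
    and x3: "x3 = l^2 + c1 * l - c2 - x1 - x2"
  shows "3 * x1^2 + 2 * c2 * x1 + c4 - c1 * y1 - l * (2 * y1 + c1 * x1 + c3) = (x1 - x2) * (x1 - x3)"
proof -
  have "x2^3 + c2 * x2^2 + c4 * x2 + c6 - y2 * (c1 * x2 + c3) - y2^2 = 0"
    using 2 by (simp add: algebra_simps)
  then have "(3 * x1^2 + 2 * c2 * x1 + c4 - c1 * y1 - l * (2 * y1 + c1 * x1 + c3))
      + (x2 - x1) * (3 * x1 + c2 - c1 * l - l^2) + (x2 - x1)^2 = 0"
    using line_cubic[OF 1, of x2 l] \<open>x1 \<noteq> x2\<close> unfolding l[symmetric] by simp
  then have "3 * x1^2 + 2 * c2 * x1 + c4 - c1 * y1 - l * (2 * y1 + c1 * x1 + c3)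
      = - ((x2 - x1) * (3 * x1 + c2 - c1 * l - l^2) + (x2 - x1)^2)"
    by (simp only: eq_neg_iff_add_eq_0 add.assoc)
  also have "\<dots> = (x1 - x2) * (x1 - x3)" unfolding x3
    by (simp add: algebra_simps power2_eq_square)
  finally show ?thesis .
qed

context ec_field begin

lemma same_x:
  assumes "on_curve E (Affine x0 y0)" "on_curve E (Affine x0 y1)"
  shows "y1 = y0 \<or> y1 = - y0 - a1 E * x0 - a3 E"
proof -
  have "(y1 - y0) * (y1 + y0 + a1 E * x0 + a3 E) = 0"
    using assms by (simp add: algebra_simps power2_eq_square)
  then have "y1 = y0 \<or> y1 + (y0 + a1 E * x0 + a3 E) = 0" by (simp add: add.assoc)
  moreover have "- y0 - a1 E * x0 - a3 E = - (y0 + a1 E * x0 + a3 E)" by simp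
  ultimately show ?thesis by (metis eq_neg_iff_add_eq_0)
qed

lemma self_neg_iff: "ec_neg E (Affine x0 y0) = Affine x0 y0 \<longleftrightarrow> 2 * y0 + a1 E * x0 + a3 E = 0"
proof -
  have "- y0 - a1 E * x0 - a3 E = y0 \<longleftrightarrow> - (- y0 - a1 E * x0 - a3 E) + y0 = 0"
    by (metis add.commute add_diff_cancel_left' diff_add_cancel eq_iff_diff_eq_0 uminus_add_conv_diff)
  also have "- (- y0 - a1 E * x0 - a3 E) + y0 = 2 * y0 + a1 E * x0 + a3 E" by simp
  finally show ?thesis by simp
qed

text \<open>For a tangent \<open>x1 = x2\<close>: the slope makes the left-hand side of the last
  equation 0, and so is the right-hand side. Having that equation in both cases spares the divisor
  computation a case distinction.\<close>

lemma add_line: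
  assumes P: "on_curve E (Affine x1 y1)" and Q: "on_curve E (Affine x2 y2)"
    and ne: "Affine x1 y1 \<noteq> ec_neg E (Affine x2 y2)"
  obtains l x3 where "y2 = l * (x2 - x1) + y1" "x3 = l^2 + a1 E * l - a2 E - x1 - x2"
    "ec_add E (Affine x1 y1) (Affine x2 y2) = ec_neg E (Affine x3 (l * (x3 - x1) + y1))"
    "3 * x1^2 + 2 * a2 E * x1 + a4 E - a1 E * y1 - l * (2 * y1 + a1 E * x1 + a3 E) = (x1 - x2) * (x1 - x3)"
proof -
  define l where "l = (if x1 = x2
    then (3 * x1^2 + 2 * a2 E * x1 + a4 E - a1 E * y1) / (2 * y1 + a1 E * x1 + a3 E)
    else (y2 - y1) / (x2 - x1))"
  define x3 where "x3 = l^2 + a1 E * l - a2 E - x1 - x2"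
  have add: "ec_add E (Affine x1 y1) (Affine x2 y2) = ec_neg E (Affine x3 (l * (x3 - x1) + y1))"
    unfolding ec_add.simps(3) if_not_P[OF ne] Let_def l_def[symmetric] x3_def[symmetric] ..
  show ?thesis
  proof (cases "x1 = x2")
    case False
    then have l: "y2 = l * (x2 - x1) + y1" by (simp add: l_def)
    show ?thesis by (rule that[OF l x3_def add])
      (rule chord_slope[OF P[simplified] Q[simplified] l False x3_def])
  next
    case True
    then have y: "y2 = y1" using same_x[OF P Q[folded True]] ne by auto
    then have "2 * y1 + a1 E * x1 + a3 E \<noteq> 0" using ne True self_neg_iff[of x1 y1] by auto
    then have "l * (2 * y1 + a1 E * x1 + a3 E) = 3 * x1^2 + 2 * a2 E * x1 + a4 E - a1 E * y1"
      unfolding l_def using True by simp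
    then show ?thesis using that[OF _ x3_def add] True y by simp
  qed
qed

lemma nu_x_minus_affine:
  assumes "on_curve E (Affine X Y)"
  shows "nu (Affine X Y) (x - h c)
    = (if X = c then if 2 * Y + a1 E * X + a3 E = 0 then 2 else 1 else 0)"
proof (cases "X = c")
  case False
  have "hv (Affine X Y) (x - h c) (X - c)" by (intro hv_diff hv_x hv_const assms)
  then show ?thesis using nu_unit[OF assms] False by simp
next
  case True
  let ?n = "if 2 * Y + a1 E * X + a3 E = 0 then 2 else 1 :: nat"
  obtain e d where "x - h X = unif (Affine X Y) ^ ?n * e" "hv (Affine X Y) e d" "d \<noteq> 0"
    using affine_unif(5)[OF assms] has_value_val[OF assms] by auto
  then have "nu (Affine X Y) (x - h X) = int ?n"
    by (intro nuI[OF assms]) (auto simp: power_int_of_nat)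
  then show ?thesis using True by simp
qed

lemma nu_Origin_x_minus: "nu Origin (x - h c) = -2"
  using nu_Origin_ev1[of "[:- c, 1:]"] by simp

lemma nu_x_minus:
  assumes P: "on_curve E (Affine x1 y1)" and R: "on_curve E R"
  shows "nu R (x - h x1) = of_bool (R = Affine x1 y1) + of_bool (R = ec_neg E (Affine x1 y1))
    - 2 * of_bool (R = Origin)"
proof (cases R)
  case Origin
  then show ?thesis by (simp add: nu_Origin_x_minus)
next
  case (Affine X Y)
  show ?thesis
  proof (cases "X = x1")
    case True
    then have "Y = y1 \<or> Y = - y1 - a1 E * x1 - a3 E" using same_x[OF P] R Affine by simp
    moreover have "2 * Y + a1 E * X + a3 E = 0 \<longleftrightarrow> y1 = - y1 - a1 E * x1 - a3 E"
    proof -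
      have "2 * (- y1 - a1 E * x1 - a3 E) + a1 E * x1 + a3 E = - (2 * y1 + a1 E * x1 + a3 E)" by simp
      then have "2 * Y + a1 E * X + a3 E = 0 \<longleftrightarrow> 2 * y1 + a1 E * x1 + a3 E = 0"
        using calculation True by (metis neg_equal_0_iff_equal)
      then show ?thesis using self_neg_iff[of x1 y1] by auto
    qed
    ultimately show ?thesis using nu_x_minus_affine[OF R[unfolded Affine], of x1] True Affine by auto
  next
    case False
    then show ?thesis using nu_x_minus_affine[OF R[unfolded Affine], of x1] Affine by simp
  qed
qed

text \<open>The norm of the line is \<open>- ((x - h x1) * (x - h x2) * (x - h x3))\<close>, which
  gives the sum of its orders at \<open>R\<close> and at the negative of \<open>R\<close>. If these
  affine points differ, the line, not being vertical, meets at most one of them and has the whole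
  order there; if they coincide, each order is half of the sum.\<close>

lemma nu_line:
  assumes P1: "on_curve E (Affine x1 y1)" and R: "on_curve E R"
    and s: "3 * x1^2 + 2 * a2 E * x1 + a4 E - a1 E * y1 - l * (2 * y1 + a1 E * x1 + a3 E) = (x1 - x2) * (x1 - x3)"
    and x3: "x3 = l^2 + a1 E * l - a2 E - x1 - x2"
  defines "L \<equiv> \<lambda>X. l * (X - x1) + y1"
  shows "nu R (y - (h l * (x - h x1) + h y1)) = of_bool (R = Affine x1 y1)
    + of_bool (R = Affine x2 (L x2)) + of_bool (R = Affine x3 (L x3)) - 3 * of_bool (R = Origin)"
proof -
  define u where "u = y - (h l * (x - h x1) + h y1)"
  have u_pol: "u = pol (- [:y1 - l * x1, l:]) 1"
    unfolding u_def pol_def by (simp add: algebra_simps)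
  have u0: "u \<noteq> 0" using pol_eq_0_iff[of _ 1] unfolding u_pol by simp
  have hs: "3 * h x1^2 + 2 * A2 * h x1 + A4 - A1 * h y1 - h l * (2 * h y1 + A1 * h x1 + A3)
      = (h x1 - h x2) * (h x1 - h x3)"
    using arg_cong[OF s, of h] by simp
  have hP: "h y1^2 + A1 * h x1 * h y1 + A3 * h y1 = h x1^3 + A2 * h x1^2 + A4 * h x1 + A6"
    using arg_cong[OF P1[simplified], of h] by simp
  have hx3: "h x3 = h l^2 + A1 * h l - A2 - h x1 - h x2" using x3 by simp
  have "u * sg u = - (x^3 + A2 * x^2 + A4 * x + A6 - (h l * (x - h x1) + h y1) * (A1 * x + A3)
      - (h l * (x - h x1) + h y1)^2)"
    unfolding u_pol sg_pol pol_times_polbar nrm_def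
    by (simp add: algebra_simps power2_eq_square power3_eq_cube)
  then have norm: "u * sg u = - ((x - h x1) * (x - h x2) * (x - h x3))"
    unfolding line_cubic_factor[OF hP hs hx3] .
  show ?thesis
  proof (cases R)
    case Origin
    have "nu Origin u = -3"
    proof (cases "[:y1 - l * x1, l:] = 0")
      case True
      then show ?thesis using nu_Origin_y unfolding u_pol by (simp add: pol_def)
    next
      case False
      have "degree [:y1 - l * x1, l:] \<le> 1" by simp
      then have "nu Origin y < nu Origin (- ev1 x [:y1 - l * x1, l:])"
        using nu_Origin_ev1[OF False] nu_Origin_y nu_minus[of Origin] by (simp del: ev1_pCons)
      then have "nu Origin (y + (- ev1 x [:y1 - l * x1, l:])) = nu Origin y"
        using False by (intro nu_add_less) (auto simp del: ev1_pCons)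
      then show ?thesis using nu_Origin_y unfolding u_pol pol_def by (simp add: algebra_simps)
    qed
    then show ?thesis using Origin by (simp add: u_def)
  next
    case (Affine X Y)
    note oc = R[unfolded Affine]
    have hu: "hv (Affine X Y') u (Y' - L X)" if "on_curve E (Affine X Y')" for Y'
      unfolding u_def L_def by (intro hv_diff hv_add hv_mult hv_const hv_x hv_y that)
    have nn: "nu R u \<ge> 0" using hv_nu_nonneg[OF R u0] hu[OF oc] Affine by blast
    define k :: int where "k = of_bool (X = x1) + of_bool (X = x2) + of_bool (X = x3)"
    define m where "m = (if 2 * Y + a1 E * X + a3 E = 0 then 2 else 1 :: int)"
    have "nu R u + nu (ec_neg E R) u = nu R (u * sg u)"
      using nu_mult[OF R u0, of "sg u"] sg.nu_aut[OF R] u0 by simp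
    also have "\<dots> = nu R ((x - h x1) * (x - h x2) * (x - h x3))"
      unfolding norm by (rule nu_minus[OF R])
    also have "\<dots> = nu R (x - h x1) + nu R (x - h x2) + nu R (x - h x3)"
      using x_minus_nz by (simp add: nu_mult[OF R])
    also have "\<dots> = m * k"
      unfolding Affine nu_x_minus_affine[OF oc] by (simp add: m_def k_def)
    finally have sum: "nu R u + nu (ec_neg E R) u = m * k" .
    have goal: "nu R u = of_bool (Y = L X) * k"
    proof (cases "Y = L X")
      case False
      then show ?thesis using nu_unit[OF oc hu[OF oc]] Affine by simp
    next
      case True
      show ?thesis
      proof (cases "2 * Y + a1 E * X + a3 E = 0")
        case sn: True
        then have "ec_neg E R = R" using self_neg_iff[of X Y] Affine by simp
        then show ?thesis using sum sn True by (simp add: m_def)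
      next
        case nsn: False
        have oc': "on_curve E (Affine X (- Y - a1 E * X - a3 E))" using on_curve_neg[OF oc] by simp
        have "- Y - a1 E * X - a3 E \<noteq> L X" using nsn self_neg_iff[of X Y] True by auto
        then have "nu (ec_neg E R) u = 0" using nu_unit[OF oc' hu[OF oc']] Affine by simp
        then show ?thesis using sum nsn True by (simp add: m_def)
      qed
    qed
    have "y1 = L x1" by (simp add: L_def)
    then have "of_bool (Y = L X) * k = of_bool (R = Affine x1 y1)
      + of_bool (R = Affine x2 (L x2)) + of_bool (R = Affine x3 (L x3))"
      unfolding k_def Affine by auto
    then show ?thesis using goal Affine by (simp add: u_def)
  qed
qed

section \<open>Divisor classes and the group axioms\<close>

definition principal :: "('c point \<Rightarrow> int) \<Rightarrow> bool" where
  "principal D \<longleftrightarrow> (\<exists>f. f \<noteq> 0 \<and> (\<forall>R. on_curve E R \<longrightarrow> nu R f = D R))"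

lemma principal_add: assumes "principal D" "principal D'" shows "principal (\<lambda>R. D R + D' R)"
proof -
  obtain f g where "f \<noteq> 0" "\<forall>R. on_curve E R \<longrightarrow> nu R f = D R" "g \<noteq> 0" "\<forall>R. on_curve E R \<longrightarrow> nu R g = D' R"
    using assms unfolding principal_def by blast
  then show ?thesis unfolding principal_def by (intro exI[of _ "f * g"]) (simp add: nu_mult)
qed

lemma principal_diff: assumes "principal D" "principal D'" shows "principal (\<lambda>R. D R - D' R)"
proof -
  obtain f g where "f \<noteq> 0" "\<forall>R. on_curve E R \<longrightarrow> nu R f = D R" "g \<noteq> 0" "\<forall>R. on_curve E R \<longrightarrow> nu R g = D' R"
    using assms unfolding principal_def by blast
  then show ?thesis unfolding principal_def by (intro exI[of _ "f / g"]) (simp add: nu_divide)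
qed

abbreviation pt :: "'c point \<Rightarrow> 'c point \<Rightarrow> int" where "pt P R \<equiv> of_bool (R = P)"

lemma principal_neg:
  assumes "on_curve E P" shows "principal (\<lambda>R. pt P R + pt (ec_neg E P) R - 2 * pt Origin R)"
proof (cases P)
  case Origin
  then show ?thesis unfolding principal_def
    using nu_const[of _ 1] by (intro exI[of _ 1]) auto
next
  case (Affine x1 y1)
  show ?thesis unfolding principal_def Affine
    using nu_x_minus[OF assms[unfolded Affine]] x_minus_nz by (intro exI[of _ "x - h x1"]) auto
qed

text \<open>The line through \<open>P\<close> and \<open>Q\<close> meets the curve in a third point
  \<open>T\<close>, and the vertical line through \<open>T\<close> in its negative, which is the
  sum. The quotient of the two functions has the required divisor; that \<open>T\<close> lies on the
  curve is the factored cubic at \<open>x3\<close>.\<close>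

lemma add_curve_principal:
  assumes P: "on_curve E P" and Q: "on_curve E Q"
  shows "on_curve E (ec_add E P Q) \<and>
    principal (\<lambda>R. pt P R + pt Q R - pt (ec_add E P Q) R - pt Origin R)"
proof -
  have p0: "principal (\<lambda>R. 0)"
    unfolding principal_def using nu_const[of _ 1] by (intro exI[of _ 1]) auto
  show ?thesis
  proof (cases "P = Origin \<or> Q = Origin")
    case True
    then show ?thesis
    proof
      assume "P = Origin" then show ?thesis using Q p0 by simp
    next
      assume "Q = Origin" then show ?thesis using P p0 by (cases P) simp_all
    qed
  next
    case False
    then obtain x1 y1 x2 y2 where PQ: "P = Affine x1 y1" "Q = Affine x2 y2"
      by (metis point.exhaust)
    show ?thesis
    proof (cases "P = ec_neg E Q")
      case True
      then have "ec_add E P Q = Origin" using PQ by simp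
      then show ?thesis using principal_neg[OF Q] True by (simp add: algebra_simps)
    next
      case ne: False
      note P' = P[unfolded PQ] and Q' = Q[unfolded PQ]
      obtain l x3 where l: "y2 = l * (x2 - x1) + y1" and x3: "x3 = l^2 + a1 E * l - a2 E - x1 - x2"
        and S: "ec_add E P Q = ec_neg E (Affine x3 (l * (x3 - x1) + y1))"
        and s: "3 * x1^2 + 2 * a2 E * x1 + a4 E - a1 E * y1 - l * (2 * y1 + a1 E * x1 + a3 E) = (x1 - x2) * (x1 - x3)"
        using add_line[OF P' Q' ne[unfolded PQ]] unfolding PQ by metis
      define T where "T = Affine x3 (l * (x3 - x1) + y1)"
      have T: "on_curve E T"
        using line_cubic_factor[OF P'[simplified] s x3, of x3]
        by (simp add: T_def algebra_simps power2_eq_square)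
      have "principal (\<lambda>R. pt P R + pt Q R + pt T R - 3 * pt Origin R)"
        unfolding principal_def
      proof (intro exI conjI allI impI)
        show "y - (h l * (x - h x1) + h y1) \<noteq> 0"
        proof -
          have "y - (h l * (x - h x1) + h y1) = pol (- [:y1 - l * x1, l:]) 1"
            unfolding pol_def by (simp add: algebra_simps)
          then show ?thesis using pol_eq_0_iff[of _ 1] by simp
        qed
        show "nu R (y - (h l * (x - h x1) + h y1)) = pt P R + pt Q R + pt T R - 3 * pt Origin R"
          if "on_curve E R" for R
          using nu_line[OF P' that s x3] unfolding PQ T_def l .
      qed
      from principal_diff[OF this principal_neg[OF T]]
      have "principal (\<lambda>R. pt P R + pt Q R - pt (ec_neg E T) R - pt Origin R)"
        by (simp add: algebra_simps)
      then show ?thesis using on_curve_neg[OF T] S unfolding T_def by simp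
    qed
  qed
qed

lemmas on_curve_add = add_curve_principal[THEN conjunct1]
  and principal_sum = add_curve_principal[THEN conjunct2]

lemma add_Origin_right [simp]: "ec_add E P Origin = P"
  by (cases P) simp_all

lemma add_neg [simp]: "ec_add E P (ec_neg E P) = Origin"
  by (cases P) simp_all

lemma add_eq_Origin_iff: "ec_add E P Q = Origin \<longleftrightarrow> P = ec_neg E Q"
  by (cases P; cases Q) (auto simp: Let_def)

lemma no_simple_pole:
  assumes "on_curve E R" "principal (\<lambda>S. pt R S - pt Origin S)" shows "R = Origin"
proof (rule ccontr)
  assume ne: "R \<noteq> Origin"
  obtain f where f: "f \<noteq> 0" "\<And>S. on_curve E S \<Longrightarrow> nu S f = pt R S - pt Origin S"
    using assms(2) unfolding principal_def by blast
  have "\<exists>c. f = h c"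
  proof (rule liouville)
    show "\<exists>c. hv P f c" if "on_curve E P" "P \<noteq> Origin" for P
      unfolding hv_iff_nu[OF that(1)] f(2)[OF that(1)] using that(2) by simp
    show "f = 0 \<or> nu Origin f \<ge> -1" using f(2)[of Origin] ne by simp
  qed
  then have "nu R f = 0" using nu_const[OF assms(1)] by blast
  then show False using f(2)[OF assms(1)] ne by simp
qed

text \<open>Adding the negative of \<open>Q\<close> turns \<open>P - Q\<close> into the divisor of a
  point minus the origin. With this, an equation between points follows from one between divisor
  classes, which is how the group axioms are proved.\<close>

lemma principal_points_eq:
  assumes P: "on_curve E P" and Q: "on_curve E Q" and D: "principal (\<lambda>R. pt P R - pt Q R)"
  shows "P = Q"
proof -
  let ?R = "ec_add E P (ec_neg E Q)"
  have Q': "on_curve E (ec_neg E Q)" by (rule on_curve_neg[OF Q])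
  have "principal (\<lambda>S. pt ?R S - pt Origin S)"
    using principal_diff[OF principal_add[OF D principal_neg[OF Q]] principal_sum[OF P Q']]
    by (simp add: algebra_simps)
  then have "?R = Origin" using no_simple_pole on_curve_add[OF P Q'] by blast
  then show ?thesis unfolding add_eq_Origin_iff by simp
qed

lemma ec_add_commute:
  assumes P: "on_curve E P" and Q: "on_curve E Q" shows "ec_add E P Q = ec_add E Q P"
proof (rule principal_points_eq)
  show "principal (\<lambda>R. pt (ec_add E P Q) R - pt (ec_add E Q P) R)"
    using principal_diff[OF principal_sum[OF Q P] principal_sum[OF P Q]] by (simp add: algebra_simps)
qed (use on_curve_add P Q in auto)

text \<open>Both sides are equivalent to \<open>P + Q + R\<close> minus twice the origin.\<close>

lemma ec_add_assoc:
  assumes P: "on_curve E P" and Q: "on_curve E Q" and R: "on_curve E R"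
  shows "ec_add E (ec_add E P Q) R = ec_add E P (ec_add E Q R)"
proof (rule principal_points_eq)
  note PQ = on_curve_add[OF P Q] and QR = on_curve_add[OF Q R]
  show "principal (\<lambda>S. pt (ec_add E (ec_add E P Q) R) S - pt (ec_add E P (ec_add E Q R)) S)"
    using principal_diff[OF principal_add[OF principal_sum[OF P QR] principal_sum[OF Q R]]
      principal_add[OF principal_sum[OF PQ R] principal_sum[OF P Q]]] by (simp add: algebra_simps)
qed (use on_curve_add P Q R in auto)

end

context ec_field begin

subsection \<open>Multiples of a point\<close>

lemma ec_neg_add:
  assumes P: "on_curve E P" and Q: "on_curve E Q"
  shows "ec_neg E (ec_add E P Q) = ec_add E (ec_neg E P) (ec_neg E Q)"
proof -
  note [simp] = on_curve_add on_curve_neg P Q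
  have "ec_add E (ec_add E P Q) (ec_add E (ec_neg E P) (ec_neg E Q))
    = ec_add E P (ec_add E Q (ec_add E (ec_neg E Q) (ec_neg E P)))"
    by (simp add: ec_add_assoc ec_add_commute[of "ec_neg E P" "ec_neg E Q"])
  also have "\<dots> = Origin" by (simp flip: ec_add_assoc)
  finally show ?thesis unfolding add_eq_Origin_iff by simp
qed

lemma add_neg_left: "on_curve E P \<Longrightarrow> ec_add E (ec_neg E P) P = Origin"
  using add_neg[of "ec_neg E P"] by simp

lemma add_sub_cancel: "on_curve E P \<Longrightarrow> on_curve E Q \<Longrightarrow> ec_add E (ec_add E P (ec_neg E Q)) Q = P"
  and sub_add_cancel: "on_curve E P \<Longrightarrow> on_curve E Q \<Longrightarrow> ec_add E (ec_add E P Q) (ec_neg E Q) = P"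
  by (simp_all add: ec_add_assoc on_curve_neg add_neg_left)

lemma multiple_0 [simp]: "ec_multiple E 0 P = Origin"
  by (simp add: ec_multiple_def)

lemma on_curve_multiple: assumes "on_curve E P" shows "on_curve E (ec_multiple E n P)"
proof -
  have "on_curve E ((ec_add E P ^^ k) Origin)" for k
    by (induction k) (simp_all add: on_curve_add assms)
  then show ?thesis by (simp add: ec_multiple_def on_curve_neg)
qed

lemma multiple_Suc: assumes P: "on_curve E P"
  shows "ec_multiple E (n + 1) P = ec_add E (ec_multiple E n P) P"
proof -
  have oc: "on_curve E ((ec_add E P ^^ k) Origin)" for k
    by (induction k) (simp_all add: on_curve_add P)
  show ?thesis
  proof (cases "n \<ge> 0")
    case True
    then show ?thesis
      by (simp add: ec_multiple_def nat_add_distrib ec_add_commute[OF P oc])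
  next
    case False
    define k where "k = nat (- n - 1)"
    have n: "n = - int k - 1" using False by (simp add: k_def)
    have M: "ec_multiple E (- int k) P = ec_neg E ((ec_add E P ^^ k) Origin)" for k
      by (cases "k = 0") (simp_all add: ec_multiple_def)
    have "n = - int (Suc k)" by (simp add: n)
    then have "ec_multiple E n P = ec_neg E ((ec_add E P ^^ Suc k) Origin)"
      using M[of "Suc k"] by (simp only:)
    also have "\<dots> = ec_add E (ec_neg E ((ec_add E P ^^ k) Origin)) (ec_neg E P)"
      using ec_neg_add[OF oc[of k] P] ec_add_commute[OF P oc[of k]] by simp
    finally have "ec_add E (ec_multiple E n P) P = ec_neg E ((ec_add E P ^^ k) Origin)"
      using add_sub_cancel[OF on_curve_neg[OF oc] P] by simp
    then show ?thesis using M[of k] by (simp add: n)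
  qed
qed

lemma multiple_pred: assumes P: "on_curve E P"
  shows "ec_multiple E (n - 1) P = ec_add E (ec_multiple E n P) (ec_neg E P)"
  using multiple_Suc[OF P, of "n - 1"] sub_add_cancel[OF on_curve_multiple[OF P] P] by simp

lemma multiple_add: assumes P: "on_curve E P"
  shows "ec_multiple E (m + n) P = ec_add E (ec_multiple E m P) (ec_multiple E n P)"
proof (induction n rule: int_induct[of _ 0])
  case (step1 n)
  have "ec_multiple E (m + (n + 1)) P = ec_add E (ec_multiple E (m + n) P) P"
    using multiple_Suc[OF P, of "m + n"] by (simp add: add.assoc)
  then show ?case using step1 by (simp add: multiple_Suc P ec_add_assoc on_curve_multiple)
next
  case (step2 n)
  have "ec_multiple E (m + (n - 1)) P = ec_add E (ec_multiple E (m + n) P) (ec_neg E P)"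
    using multiple_pred[OF P, of "m + n"] by (simp add: algebra_simps)
  then show ?case using step2 by (simp add: multiple_pred P ec_add_assoc on_curve_multiple on_curve_neg)
qed simp

lemma multiple_1: "on_curve E P \<Longrightarrow> ec_multiple E 1 P = P"
  using multiple_Suc[of P 0] by simp

lemma multiple_eq_Origin:
  assumes P: "on_curve E P" and nt: "\<not> ec_torsion E P" and n: "ec_multiple E n P = Origin"
  shows "n = 0"
proof (rule ccontr)
  assume "n \<noteq> 0"
  then consider "n > 0" | "- n > 0" by linarith
  then show False
  proof cases
    case 1
    then show False using nt n by (auto simp: ec_torsion_def)
  next
    case 2
    have "ec_multiple E (- n) P = Origin" using multiple_add[OF P, of n "- n"] n by simp
    then show False using nt 2 unfolding ec_torsion_def by blast
  qed
qed

lemma add_left_cancel: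
  assumes "on_curve E P" "on_curve E Q" "on_curve E R" "ec_add E P Q = ec_add E P R" shows "Q = R"
  using assms sub_add_cancel[of Q P] sub_add_cancel[of R P] ec_add_commute by metis

lemma orbit_inj:
  assumes P: "on_curve E P" and Q: "on_curve E Q" and nt: "\<not> ec_torsion E P"
    and eq: "ec_add E Q (ec_multiple E m P) = ec_add E Q (ec_multiple E n P)"
  shows "m = n"
proof -
  have "ec_multiple E m P = ec_multiple E n P"
    using add_left_cancel[OF Q _ _ eq] on_curve_multiple[OF P] by blast
  then have "ec_multiple E (m + - n) P = ec_multiple E (n + - n) P"
    unfolding multiple_add[OF P] by simp
  then show ?thesis using multiple_eq_Origin[OF P nt, of "m - n"] by simp
qed

section \<open>Derivations and residues\<close>

definition derivation :: "('k \<Rightarrow> 'k) \<Rightarrow> bool" where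
  "derivation D \<longleftrightarrow> (\<forall>f g. D (f + g) = D f + D g) \<and> (\<forall>f g. D (f * g) = f * D g + g * D f)
     \<and> (\<forall>c. D (h c) = 0)"

end

locale ec_der = ec_field E K
  for E :: "'c::{alg_closed_field, field_char_0} weierstrass" and K :: "('c, 'k::field) function_field" +
  fixes D :: "'k \<Rightarrow> 'k"
  assumes D: "derivation D"
begin

lemma D_add [simp]: "D (f + g) = D f + D g"
  and D_mult: "D (f * g) = f * D g + g * D f"
  and D_const [simp]: "D (h c) = 0"
  using D by (auto simp: derivation_def)

lemma D_0 [simp]: "D 0 = 0" and D_1 [simp]: "D 1 = 0"
  using D_const[of 0] D_const[of 1] by simp_all

lemma D_minus [simp]: "D (- f) = - D f"
  using D_add[of f "- f"] by (simp add: add_eq_0_iff)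

lemma D_diff [simp]: "D (f - g) = D f - D g"
  using D_add[of f "- g"] by simp

lemma D_inverse: "D (inverse f) = - D f / f^2"
proof (cases "f = 0")
  case False
  then have "f * D (inverse f) + inverse f * D f = 0" using D_mult[of f "inverse f"] by simp
  then have "f * (f * D (inverse f) + inverse f * D f) = 0" by simp
  also have "f * (f * D (inverse f) + inverse f * D f) = f^2 * D (inverse f) + D f"
    using False by (simp add: power2_eq_square distrib_left)
  finally have "f^2 * D (inverse f) = - D f" by (simp add: eq_neg_iff_add_eq_0)
  then show ?thesis by (intro eq_divide_imp) (simp_all add: False mult.commute)
qed simp

lemma D_divide: assumes "g \<noteq> 0" shows "D (f / g) = (g * D f - f * D g) / g^2"
proof -
  have "D (f / g) = f * (- D g / g^2) + inverse g * D f"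
    using D_mult[of f "inverse g"] D_inverse[of g] by (simp only: divide_inverse)
  also have "inverse g * D f = g * D f / g^2" using assms by (simp add: power2_eq_square divide_inverse)
  finally show ?thesis by (simp add: diff_divide_distrib)
qed

abbreviation psi :: 'k where "psi \<equiv> 2 * y + A1 * x + A3"
abbreviation phi :: 'k where "phi \<equiv> 3 * x^2 + 2 * A2 * x + A4 - A1 * y"

lemma D_relation: "psi * D y = phi * D x"
proof -
  have "D (y^2 + A1 * x * y + A3 * y) = D (x^3 + A2 * x^2 + A4 * x + A6)" by (simp only: curve_eq)
  then show ?thesis
    by (simp add: D_mult numeral_3_eq_3 power2_eq_square algebra_simps)
qed

lemma psi_nz: "psi \<noteq> 0"
  using pol_eq_0_iff[of lin "[:2:]"] by (simp add: pol_def algebra_simps)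

text \<open>Differentiating the curve equation determines \<open>D y\<close> from
  \<open>D x\<close>, as \<open>psi\<close> is not 0. So derivations over the constants form a space
  of dimension at most one.\<close>

lemma D_eq_0: assumes "D x = 0" shows "D f = 0"
proof -
  have Dy: "D y = 0" using D_relation assms psi_nz by simp
  have 1: "D (ev1 x p) = 0" for p by (induction p) (simp_all add: D_mult assms)
  have 2: "D (eval2 h p x y) = 0" for p by (induction p) (simp_all add: D_mult 1 Dy)
  have "\<exists>p q. eval2 h q x y \<noteq> 0 \<and> f = eval2 h p x y / eval2 h q x y"
    using ff unfolding is_function_field_def by blast
  then obtain p q where "eval2 h q x y \<noteq> 0" "f = eval2 h p x y / eval2 h q x y" by blast
  then show ?thesis using 2 by (simp add: D_divide)
qed

end

context ec_field begin

lemma derivation_unique: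
  assumes "derivation D" "derivation D'" "D' x = k * D x" shows "D' f = k * D f"
proof -
  interpret d: ec_der E K D by unfold_locales (rule assms)
  interpret d': ec_der E K D' by unfold_locales (rule assms)
  interpret dd: ec_der E K "\<lambda>f. D' f - k * D f"
    by unfold_locales (simp add: derivation_def d.D_mult d'.D_mult algebra_simps)
  show ?thesis using dd.D_eq_0[of f] assms(3) by simp
qed

end

text \<open>The derivation dual to the invariant differential \<open>dx / (2y + a\<^sub>1 x + a\<^sub>3)\<close>.\<close>

locale inv_der = ec_der E K D
  for E :: "'c::{alg_closed_field, field_char_0} weierstrass" and K :: "('c, 'k::field) function_field"
    and D :: "'k \<Rightarrow> 'k" +
  assumes D_x: "D x = psi"
begin

lemma D_y: "D y = phi"
  using D_relation D_x psi_nz by (simp add: mult.commute)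

text \<open>Rewritten as polynomials in the chart at infinity, the derivatives are visibly regular.
  The value -1 is 2 - 3, where 3 comes from \<open>3 * (x^3 / y^2)\<close>: by the curve equation
  \<open>x^3 / y^2\<close> has value 1 there.\<close>

lemma D_Origin_coords:
  "\<exists>a b. D (x / y) = a \<and> hv Origin a (- 1) \<and> D (1 / y) = b \<and> hv Origin b 0"
proof -
  have o: "on_curve E Origin" by simp
  define u where "u = x / y"
  define v where "v = 1 / y"
  have u: "hv Origin u 0" and v: "hv Origin v 0"
    using hv_u[OF o] hv_v[OF o] by (simp_all add: u_def v_def)
  have sq: "x^3 / y^2 = 1 + A1 * u + A3 * v - A2 * u^2 - A4 * u * v - A6 * v^2"
  proof -
    have "x^3 = y^2 + A1 * x * y + A3 * y - A2 * x^2 - A4 * x - A6"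
      unfolding curve_eq by simp
    then have "x^3 / y^2 = (y^2 + A1 * x * y + A3 * y - A2 * x^2 - A4 * x - A6) / y^2" by (rule arg_cong)
    then show ?thesis by (simp add: u_def v_def add_divide_distrib diff_divide_distrib power2_eq_square)
  qed
  have "D u = (y * psi - x * phi) / y^2" unfolding u_def by (simp add: D_divide D_x D_y)
  also have "\<dots> = 2 + 2 * A1 * u + A3 * v - 3 * (x^3 / y^2) - 2 * A2 * u^2 - A4 * u * v"
    by (simp add: u_def v_def add_divide_distrib diff_divide_distrib power2_eq_square power3_eq_cube algebra_simps)
  finally have Du: "D u = h 2 + h 2 * A1 * u + A3 * v - h 3 * (1 + A1 * u + A3 * v - A2 * u^2 - A4 * u * v - A6 * v^2)
      - h 2 * A2 * u^2 - A4 * u * v" unfolding sq by simp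
  have "hv Origin (D u) (2 + 2 * a1 E * 0 + a3 E * 0
      - 3 * (1 + a1 E * 0 + a3 E * 0 - a2 E * 0^2 - a4 E * 0 * 0 - a6 E * 0^2)
      - 2 * a2 E * 0^2 - a4 E * 0 * 0)"
    unfolding Du by (intro hv_add hv_diff hv_mult hv_power hv_const hv_1 u v o)
  then have 1: "hv Origin (D u) (- 1)" by simp
  have "D v = - phi / y^2" unfolding v_def by (simp add: D_divide D_y)
  also have "\<dots> = - (h 3 * u^2 + h 2 * A2 * u * v + A4 * v^2 - A1 * v)"
    by (simp add: u_def v_def add_divide_distrib diff_divide_distrib power2_eq_square algebra_simps)
  finally have Dv: "D v = - (h 3 * u^2 + h 2 * A2 * u * v + A4 * v^2 - A1 * v)" .
  have "hv Origin (D v) (- (3 * 0^2 + 2 * a2 E * 0 * 0 + a4 E * 0^2 - a1 E * 0))"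
    unfolding Dv by (intro hv_add hv_diff hv_minus hv_mult hv_power hv_const u v o)
  then show ?thesis using 1 by (simp add: u_def v_def)
qed

lemma hv_psi: assumes "on_curve E (Affine X Y)"
  shows "hv (Affine X Y) psi (2 * Y + a1 E * X + a3 E)"
proof -
  have "hv (Affine X Y) (h 2 * y + A1 * x + A3) (2 * Y + a1 E * X + a3 E)"
    by (intro hv_add hv_mult hv_const hv_x hv_y assms)
  then show ?thesis by simp
qed

lemma hv_phi: assumes "on_curve E (Affine X Y)"
  shows "hv (Affine X Y) phi (3 * X^2 + 2 * a2 E * X + a4 E - a1 E * Y)"
proof -
  have "hv (Affine X Y) (h 3 * x^2 + h 2 * A2 * x + A4 - A1 * y) (3 * X^2 + 2 * a2 E * X + a4 E - a1 E * Y)"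
    by (intro hv_add hv_diff hv_mult hv_power hv_const hv_x hv_y assms)
  then show ?thesis by simp
qed

text \<open>By the rules of differentiation it is enough that \<open>D\<close> keeps the two chart
  functions regular. This expresses that the dual differential has no zeros.\<close>

lemma D_regular: assumes P: "on_curve E P" and f: "f \<in> local_ring K P" shows "D f \<in> local_ring K P"
proof -
  interpret pl: place_loc "const K" "cu P" "cv P" "cu0 P" "cv0 P" "unif P" by (rule place[OF P])
  have u: "\<exists>c. hv P (D (cu P)) c" and v: "\<exists>c. hv P (D (cv P)) c"
    using P D_Origin_coords hv_psi hv_phi by (cases P; fastforce simp: D_x D_y)+
  have 1: "\<exists>c. hv P (D (ev1 (cu P) p)) c" for p
  proof (induction p)
    case (pCons a p)
    then show ?case using u hv_u[OF P] hv_ev1[OF P hv_u[OF P], of p]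
      by (simp add: D_mult) (meson hv_add[OF P] hv_mult[OF P])
  qed (use hv_0[OF P] in auto)
  have 2: "\<exists>c. hv P (D (eval2 h p (cu P) (cv P))) c" for p
  proof (induction p)
    case (pCons a p)
    then show ?case using v 1[of a] hv_v[OF P] hv_eval2[OF P hv_u[OF P] hv_v[OF P], of p]
      by (simp add: D_mult) (meson hv_add[OF P] hv_mult[OF P])
  qed (use hv_0[OF P] in auto)
  obtain c where "hv P f c" using f by (auto simp: local_ring_iff)
  then obtain p q where pq: "eval2 id q (cu0 P) (cv0 P) \<noteq> 0"
    "f = eval2 h p (cu P) (cv P) / eval2 h q (cu P) (cv P)"
    unfolding has_value_val[OF P] pl.val_def by blast
  have hp: "hv P (eval2 h p (cu P) (cv P)) (eval2 id p (cu0 P) (cv0 P))" for p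
    by (rule hv_eval2[OF P hv_u[OF P] hv_v[OF P]])
  obtain c1 c2 where c: "hv P (D (eval2 h p (cu P) (cv P))) c1" "hv P (D (eval2 h q (cu P) (cv P))) c2"
    using 2 by blast
  have "hv P (D f) ((eval2 id q (cu0 P) (cv0 P) * c1 - eval2 id p (cu0 P) (cv0 P) * c2) / (eval2 id q (cu0 P) (cv0 P))^2)"
    unfolding pq(2) D_divide[OF pl.denom_nz[OF pq(1)]]
    by (intro hv_divide hv_diff hv_mult hv_power hp P c) (use pq(1) in simp)
  then show ?thesis by (auto simp: local_ring_iff)
qed

text \<open>At affine points the value is, up to sign, a partial derivative of the curve equation,
  and \<open>unif\<close> is chosen such that it is a nonzero one. Hence the dual differential has
  no poles either.\<close>

lemma D_unif: assumes P: "on_curve E P" shows "\<exists>c. hv P (D (unif P)) c \<and> c \<noteq> 0"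
proof (cases P)
  case Origin
  then show ?thesis using D_Origin_coords by (force simp: unif_def)
next
  case (Affine X Y)
  note oc = P[unfolded Affine]
  show ?thesis
  proof (cases "2 * Y + a1 E * X + a3 E = 0")
    case False
    then show ?thesis using hv_psi[OF oc] by (auto simp: Affine unif_def D_x)
  next
    case True
    then have "3 * X^2 + 2 * a2 E * X + a4 E - a1 E * Y \<noteq> 0"
      using ec oc unfolding elliptic_curve_def by (metis eq_iff_diff_eq_0)
    then show ?thesis using hv_phi[OF oc] True by (auto simp: Affine unif_def D_y)
  qed
qed

section \<open>Logarithmic derivatives and residues\<close>

definition Dlog :: "'k \<Rightarrow> 'k" where "Dlog f = D f / f"

lemma Dlog_mult: "f \<noteq> 0 \<Longrightarrow> g \<noteq> 0 \<Longrightarrow> Dlog (f * g) = Dlog f + Dlog g"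
  by (simp add: Dlog_def D_mult field_simps)

lemma Dlog_1 [simp]: "Dlog 1 = 0"
  by (simp add: Dlog_def)

lemma Dlog_inverse: "f \<noteq> 0 \<Longrightarrow> Dlog (inverse f) = - Dlog f"
  unfolding Dlog_def D_inverse by (simp add: power2_eq_square)

lemma Dlog_divide: "f \<noteq> 0 \<Longrightarrow> g \<noteq> 0 \<Longrightarrow> Dlog (f / g) = Dlog f - Dlog g"
  by (simp add: divide_inverse Dlog_mult Dlog_inverse)

lemma Dlog_power: "f \<noteq> 0 \<Longrightarrow> Dlog (f ^ n) = of_nat n * Dlog f"
  by (induction n) (simp_all add: Dlog_mult algebra_simps)

lemma Dlog_power_int: "f \<noteq> 0 \<Longrightarrow> Dlog (f powi n) = of_int n * Dlog f"
  by (cases n rule: int_cases2) (simp_all add: Dlog_power Dlog_inverse power_int_minus)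

lemma nu_Dlog_unif: assumes P: "on_curve E P" shows "Dlog (unif P) \<noteq> 0" "nu P (Dlog (unif P)) = -1"
proof -
  obtain c where c: "hv P (D (unif P)) c" "c \<noteq> 0" using D_unif[OF P] by blast
  have nz: "D (unif P) \<noteq> 0" using hv_nz[OF P c] .
  then show "Dlog (unif P) \<noteq> 0" using unif_nz[OF P] by (simp add: Dlog_def)
  show "nu P (Dlog (unif P)) = -1" unfolding Dlog_def
    using nu_divide[OF P nz unif_nz[OF P]] nu_unit[OF P c] nu_unif[OF P] by simp
qed

text \<open>The function \<open>f\<close> has at most a simple pole at \<open>P\<close>, with residue \<open>r\<close> with respect to the
  differential dual to \<open>D\<close>.\<close>

definition residue :: "'c point \<Rightarrow> 'k \<Rightarrow> 'c \<Rightarrow> bool" where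
  "residue P f r \<longleftrightarrow> f - h r * Dlog (unif P) \<in> local_ring K P"

lemma local_ring_add: "on_curve E P \<Longrightarrow> f \<in> local_ring K P \<Longrightarrow> g \<in> local_ring K P \<Longrightarrow> f + g \<in> local_ring K P"
  and local_ring_diff: "on_curve E P \<Longrightarrow> f \<in> local_ring K P \<Longrightarrow> g \<in> local_ring K P \<Longrightarrow> f - g \<in> local_ring K P"
  and local_ring_mult: "on_curve E P \<Longrightarrow> f \<in> local_ring K P \<Longrightarrow> g \<in> local_ring K P \<Longrightarrow> f * g \<in> local_ring K P"
  and local_ring_const: "on_curve E P \<Longrightarrow> h c \<in> local_ring K P"
  unfolding local_ring_iff by (blast intro: hv_add hv_diff hv_mult hv_const)+

lemma local_ring_nu: "on_curve E P \<Longrightarrow> f \<in> local_ring K P \<longleftrightarrow> f = 0 \<or> nu P f \<ge> 0"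
  unfolding local_ring_iff by (rule hv_iff_nu)

lemma residue_unique:
  assumes P: "on_curve E P" and "residue P f r" "residue P f r'" shows "r = r'"
proof (rule ccontr)
  assume ne: "r \<noteq> r'"
  have 1: "h (inverse (r' - r)) * ((f - h r * Dlog (unif P)) - (f - h r' * Dlog (unif P))) \<in> local_ring K P"
    using local_ring_mult[OF P local_ring_const[OF P]
      local_ring_diff[OF P assms(2,3)[unfolded residue_def]]] .
  have "(f - h r * Dlog (unif P)) - (f - h r' * Dlog (unif P)) = h (r' - r) * Dlog (unif P)"
    by (simp add: algebra_simps)
  then have 2: "h (inverse (r' - r)) * ((f - h r * Dlog (unif P)) - (f - h r' * Dlog (unif P))) = Dlog (unif P)"
    using ne by simp
  show False using 1 unfolding 2 local_ring_nu[OF P] using nu_Dlog_unif[OF P] by simp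
qed

lemma residue_0_iff: "residue P f 0 \<longleftrightarrow> f \<in> local_ring K P"
  by (simp add: residue_def)

lemma residue_add: assumes "on_curve E P" "residue P f r" "residue P g q" shows "residue P (f + g) (r + q)"
  using local_ring_add[OF assms(1) assms(2,3)[unfolded residue_def]] by (simp add: residue_def algebra_simps)

lemma residue_scale: assumes "on_curve E P" "residue P f r" shows "residue P (h c * f) (c * r)"
  using local_ring_mult[OF assms(1) local_ring_const[OF assms(1)] assms(2)[unfolded residue_def], of c]
  by (simp add: residue_def algebra_simps)

lemma residue_minus: assumes "on_curve E P" "residue P f r" shows "residue P (- f) (- r)"
  using residue_scale[OF assms, of "-1"] by simp

lemma residue_diff: assumes "on_curve E P" "residue P f r" "residue P g q" shows "residue P (f - g) (r - q)"
  using residue_add[OF assms(1,2) residue_minus[OF assms(1,3)]] by simp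

lemma residue_const: "on_curve E P \<Longrightarrow> residue P (h c) 0"
  by (simp add: residue_0_iff local_ring_const)

lemma residue_sum:
  assumes "on_curve E P" "\<And>i. i \<in> A \<Longrightarrow> residue P (f i) (r i)"
  shows "residue P (\<Sum>i\<in>A. f i) (\<Sum>i\<in>A. r i)"
  using assms(2)
  by (induction A rule: infinite_finite_induct)
    (simp_all add: residue_add[OF assms(1)] residue_const[OF assms(1), of 0, simplified])

lemma residue_Dlog: assumes P: "on_curve E P" and "f \<noteq> 0" shows "residue P (Dlog f) (of_int (nu P f))"
proof -
  obtain e c where e: "f = unif P powi (nu P f) * e" "hv P e c" "c \<noteq> 0" "e \<noteq> 0"
    by (rule nuE[OF P assms(2)])
  have "Dlog (unif P powi n * e) = of_int n * Dlog (unif P) + Dlog e" for n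
    using e(4) unif_nz[OF P] by (simp add: Dlog_mult Dlog_power_int)
  then have "Dlog f = of_int (nu P f) * Dlog (unif P) + Dlog e" using e(1) by metis
  moreover have "D e \<in> local_ring K P" using D_regular[OF P, of e] e(2) by (auto simp: local_ring_iff)
  then have "Dlog e \<in> local_ring K P"
    unfolding Dlog_def local_ring_iff using hv_divide[OF P _ e(2,3)] by blast
  ultimately show ?thesis by (simp add: residue_def)
qed

lemma residue_exists: assumes P: "on_curve E P" and "f = 0 \<or> nu P f \<ge> -1" shows "\<exists>r. residue P f r"
proof (cases "f = 0")
  case True
  then show ?thesis using residue_const[OF P, of 0] h_0 by metis
next
  case False
  define t where "t = Dlog (unif P)"
  have t: "t \<noteq> 0" "nu P t = -1" using nu_Dlog_unif[OF P] by (simp_all add: t_def)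
  have "nu P (f / t) \<ge> 0" using nu_divide[OF P False t(1)] t(2) assms False by simp
  then obtain r where r: "hv P (f / t) r" using hv_iff_nu[OF P] by blast
  have eq: "f - h r * t = t * (f / t - h r)" using t by (simp add: field_simps)
  define g where "g = f / t - h r"
  have "hv P g 0" using hv_diff[OF P r hv_const[OF P, of r]] by (simp add: g_def)
  then have g: "g = 0 \<or> nu P g > 0" using hv_0_iff_nu[OF P, of g] by blast
  have "f - h r * t \<in> local_ring K P"
    unfolding local_ring_nu[OF P] eq g_def[symmetric]
    using nu_mult[OF P t(1), of g] t(2) g by (cases "g = 0") simp_all
  then show ?thesis unfolding residue_def t_def by blast
qed

lemma residue_nu: assumes P: "on_curve E P" and r: "residue P f r" and "f \<noteq> 0" shows "nu P f \<ge> -1"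
proof -
  define t where "t = Dlog (unif P)"
  have t: "t \<noteq> 0" "nu P t = -1" using nu_Dlog_unif[OF P] by (simp_all add: t_def)
  have rt: "h r * t = 0 \<or> nu P (h r * t) = -1"
    using nu_mult[OF P, of "h r" t] t nu_const[OF P] by (cases "r = 0") auto
  define g where "g = f - h r * t"
  have g: "g = 0 \<or> nu P g \<ge> 0" using r unfolding residue_def local_ring_nu[OF P] g_def t_def .
  have f: "f = g + h r * t" by (simp add: g_def)
  show ?thesis
  proof (cases "g = 0 \<or> h r * t = 0")
    case True
    then show ?thesis using f g rt assms(3) by auto
  next
    case False
    then show ?thesis using nu_add[OF P, of g "h r * t"] f g rt assms(3) by auto
  qed
qed

lemma regular_residues_const:
  assumes "\<And>P. on_curve E P \<Longrightarrow> residue P f 0" shows "\<exists>c. f = h c"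
  using assms by (intro regular_const) (simp add: residue_0_iff)

end

context inv_der begin

text \<open>Conjugating \<open>D\<close> by the involution gives a derivation that sends
  \<open>x\<close> to \<open>- psi\<close>, and the value at \<open>x\<close> decides. Negation
  changes the sign of the invariant differential.\<close>

lemma D_sg: "D (sg f) = - sg (D f)"
proof -
  have "derivation (\<lambda>f. sg (D (sg f)))"
    unfolding derivation_def by (simp add: D_mult)
  moreover have "sg (D (sg x)) = - 1 * D x"
    by (simp add: D_x ybar_def)
  ultimately have "sg (D (sg f)) = - 1 * D f" using derivation_unique[OF D] by blast
  then have "sg (sg (D (sg f))) = sg (- D f)" by simp
  then show ?thesis by simp
qed

lemma Dlog_sg: "Dlog (sg f) = - sg (Dlog f)"
  by (simp add: Dlog_def D_sg)

text \<open>\<open>\<phi>\<close> carries a uniformizer at \<open>T P\<close> to a uniformizer at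
  \<open>P\<close>, so residues can be compared through its logarithmic derivative; the factor
  \<open>c\<close> enters when \<open>D\<close> is moved past \<open>\<phi>\<close>.\<close>

lemma residue_aut:
  assumes "point_aut E K \<phi> T" and c: "\<And>f. D (\<phi> f) = h c * \<phi> (D f)" "c \<noteq> 0"
    and P: "on_curve E P" and r: "residue (T P) f r"
  shows "residue P (\<phi> f) (r / c)"
proof -
  interpret \<phi>: point_aut E K \<phi> T by fact
  note TP = \<phi>.T_curve[OF P]
  define t where "t = unif (T P)"
  have "f - h r * Dlog t \<in> local_ring K (T P)" using r by (simp add: residue_def t_def)
  then have "\<phi> f - h r * \<phi> (Dlog t) \<in> local_ring K P" by (simp flip: \<phi>.local_ring_aut_iff[OF P])
  moreover have "\<phi> (Dlog t) = h (inverse c) * Dlog (\<phi> t)"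
    using c(2) by (simp add: Dlog_def c(1))
  ultimately have 1: "residue P (\<phi> f - h (r / c) * Dlog (\<phi> t)) 0"
    by (simp add: residue_0_iff divide_inverse mult.assoc)
  have "nu P (\<phi> t) = 1" using \<phi>.nu_aut[OF P] nu_unif[OF TP] by (simp add: t_def)
  then have 2: "residue P (Dlog (\<phi> t)) 1"
    using residue_Dlog[OF P, of "\<phi> t"] unif_nz[OF TP] by (simp add: t_def)
  show ?thesis using residue_add[OF P 1 residue_scale[OF P 2, of "r / c"]] by simp
qed

lemma residue_sg: assumes P: "on_curve E P" and "residue (ec_neg E P) f r"
  shows "residue P (sg f) (- r)"
proof -
  have "residue P (sg f) (r / - 1)"
    by (rule residue_aut[OF sg.point_aut_axioms _ _ assms]) (simp_all add: D_sg)
  then show ?thesis by simp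
qed


subsection \<open>Functions with two simple poles\<close>

text \<open>Over the complex numbers \<open>two_poles \<alpha>\<close> is \<open>\<zeta>(z - \<alpha>) - \<zeta>(z) + \<zeta>(\<alpha>)\<close>.\<close>

fun two_poles :: "'c point \<Rightarrow> 'k" where
  "two_poles Origin = 0"
| "two_poles (Affine X Y) = (psi + h (2 * Y + a1 E * X + a3 E)) / (2 * (x - h X))"

lemma two_K: "(2 :: 'k) \<noteq> 0"
  using h_eq_0_iff[of 2] by (simp del: h_eq_0_iff)

lemma D_x_minus: "D (x - h c) = psi"
  by (simp add: D_x)

text \<open>Up to the factor 1/2, the function is \<open>Dlog (x - h X)\<close>, with residues 1, 1,
  -2 at \<open>\<alpha>\<close>, its negative and the origin, plus \<open>H\<close>, with residues 1
  and -1 at the first two. The poles at the negative of \<open>\<alpha>\<close> cancel. If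
  \<open>\<alpha>\<close> is its own negative, \<open>H\<close> is 0 and the first term has residue
  2 there.\<close>

lemma residue_two_poles:
  assumes P: "on_curve E P" and \<alpha>: "on_curve E \<alpha>"
  shows "residue P (two_poles \<alpha>) (of_bool (P = \<alpha>) - of_bool (P = Origin))"
proof (cases \<alpha>)
  case Origin
  then show ?thesis using residue_const[OF P, of 0] by simp
next
  case (Affine X Y)
  note oc = \<alpha>[unfolded Affine]
  define c where "c = 2 * Y + a1 E * X + a3 E"
  have neg_iff: "ec_neg E \<alpha> = \<alpha> \<longleftrightarrow> c = 0" using self_neg_iff by (simp add: Affine c_def)
  define H where "H = h c / (x - h X)"
  have split: "two_poles \<alpha> = h (1 / 2) * (Dlog (x - h X) + H)"
  proof -
    have "(a + b) / (2 * d) = h (1 / 2) * (a / d + b / d)" for a b d :: 'k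
      by (simp add: add_divide_distrib distrib_left)
    then show ?thesis unfolding Affine two_poles.simps c_def[symmetric] Dlog_def D_x_minus H_def .
  qed
  have 1: "residue P (Dlog (x - h X)) (of_int (pt \<alpha> P + pt (ec_neg E \<alpha>) P - 2 * pt Origin P))"
    using residue_Dlog[OF P x_minus_nz[of X]] nu_x_minus[OF oc P] Affine by simp
  have 2: "residue P H (of_bool (P = \<alpha>) - of_bool (P = ec_neg E \<alpha>))"
  proof (cases "c = 0")
    case True
    then show ?thesis using neg_iff residue_const[OF P, of 0] by (simp add: H_def)
  next
    case c: False
    show ?thesis
    proof (cases "P = \<alpha> \<or> P = ec_neg E \<alpha>")
      case False
      have "nu P (x - h X) \<le> 0" using nu_x_minus[OF oc P] False Affine by simp
      then have "nu P H \<ge> 0"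
        unfolding H_def using nu_divide[OF P _ x_minus_nz, of "h c"] c nu_const[OF P] by simp
      then show ?thesis using False by (simp add: residue_0_iff local_ring_nu[OF P])
    next
      case True
      \<comment> \<open>\<open>psi\<close> takes the value \<open>e * c\<close> at \<open>P\<close>;
        subtracting \<open>h e * Dlog (unif P)\<close> therefore cancels the pole of
        \<open>H\<close>.\<close>
      define e :: 'c where "e = (if P = \<alpha> then 1 else - 1)"
      have e: "e * e = 1" by (simp add: e_def)
      obtain Y' where P': "P = Affine X Y'" and Y': "2 * Y' + a1 E * X + a3 E = e * c"
        using True
      proof
        assume "P = \<alpha>"
        then show ?thesis using that[of Y] by (simp add: Affine c_def e_def)
      next
        assume "P = ec_neg E \<alpha>"
        then show ?thesis using that[of "- Y - a1 E * X - a3 E"] c neg_iff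
          by (simp add: Affine c_def e_def algebra_simps)
      qed
      have t: "unif P = x - h X" using c Y' by (auto simp: P' unif_def e_def)
      have "hv P (h c - h e * psi) (c - e * (e * c))"
        using hv_psi[OF P[unfolded P']] Y' P' by (intro hv_diff hv_mult hv_const P) simp
      then have num: "hv P (h c - h e * psi) 0" using e by (simp flip: mult.assoc)
      have "H - h e * Dlog (unif P) = (h c - h e * psi) / unif P"
        unfolding t H_def Dlog_def D_x_minus by (simp add: diff_divide_distrib)
      moreover have "(h c - h e * psi) / unif P \<in> local_ring K P"
      proof (cases "h c - h e * psi = 0")
        case False
        then show ?thesis unfolding local_ring_nu[OF P]
          using nu_divide[OF P False unif_nz[OF P]] nu_unif[OF P] hv_0_iff_nu[OF P False] num by simp
      qed (use local_ring_const[OF P, of 0] in simp)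
      ultimately have "residue P H e" by (simp add: residue_def)
      moreover have "\<alpha> \<noteq> ec_neg E \<alpha>" using c neg_iff by metis
      ultimately show ?thesis using True by (auto simp: e_def)
    qed
  qed
  have "residue P (two_poles \<alpha>) (1 / 2 * (of_int (pt \<alpha> P + pt (ec_neg E \<alpha>) P - 2 * pt Origin P)
      + (of_bool (P = \<alpha>) - of_bool (P = ec_neg E \<alpha>))))"
    unfolding split by (rule residue_scale[OF P residue_add[OF P 1 2]])
  moreover have "1 / 2 * (of_int (pt \<alpha> P + pt (ec_neg E \<alpha>) P - 2 * pt Origin P)
      + (of_bool (P = \<alpha>) - of_bool (P = ec_neg E \<alpha>)) :: 'c) = of_bool (P = \<alpha>) - of_bool (P = Origin)"
    by (auto split: split_of_bool)
  ultimately show ?thesis by metis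
qed

text \<open>\<open>psi\<close> is odd under negation, while the constant and the denominator are
  even, so only \<open>psi\<close> survives.\<close>

lemma sg_two_poles: "two_poles (Affine X Y) - sg (two_poles (Affine X Y)) = Dlog (x - h X)"
proof -
  define c where "c = h (2 * Y + a1 E * X + a3 E)"
  have "sg psi = - psi" "sg c = c" by (simp_all add: ybar_def c_def)
  then have "two_poles (Affine X Y) - sg (two_poles (Affine X Y))
      = (psi + c) / (2 * (x - h X)) - (- psi + c) / (2 * (x - h X))"
    unfolding two_poles.simps c_def[symmetric] by (simp only: sg.aut_divide sg.aut_add sg.aut_mult
      sg.aut_diff sg.aut_numeral sg_x sg_h)
  also have "\<dots> = (2 * psi) / (2 * (x - h X))" unfolding diff_divide_distrib[symmetric] by simp
  also have "\<dots> = psi / (x - h X)" by (rule mult_divide_mult_cancel_left) (rule two_K)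
  finally show ?thesis unfolding Dlog_def D_x_minus .
qed

text \<open>Subtracting multiples of \<open>two_poles\<close> removes all poles outside the origin
  and collects the residues there. The remainder has at most a simple pole at the origin, so
  \<open>liouville\<close> makes it constant and the collected sum is 0.\<close>

theorem residue_theorem:
  assumes r: "\<And>P. on_curve E P \<Longrightarrow> residue P f (r P)"
  shows "finite {P \<in> curve_points E. r P \<noteq> 0}" "sum r {P \<in> curve_points E. r P \<noteq> 0} = 0"
proof -
  show fin: "finite {P \<in> curve_points E. r P \<noteq> 0}"
  proof (cases "f = 0")
    case True
    have "r P = 0" if "on_curve E P" for P
      using residue_unique[OF that r[OF that]] residue_const[OF that, of 0] True by simp
    then have "{P \<in> curve_points E. r P \<noteq> 0} = {}" by (auto simp: curve_points_def)
    then show ?thesis by (simp only: finite.emptyI)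
  next
    case False
    have "r P = 0" if "on_curve E P" "nu P f = 0" for P
      using residue_unique[OF that(1) r[OF that(1)]] that False
      by (simp add: residue_0_iff local_ring_nu)
    then have "{P \<in> curve_points E. r P \<noteq> 0} \<subseteq> {P. on_curve E P \<and> nu P f \<noteq> 0}"
      by (auto simp: curve_points_def)
    then show ?thesis using finite_zeros[OF False] finite_subset by blast
  qed
  define S where "S = {P \<in> curve_points E. r P \<noteq> 0} - {Origin}"
  have S: "finite S" "\<And>\<alpha>. \<alpha> \<in> S \<Longrightarrow> on_curve E \<alpha>" using fin by (auto simp: S_def curve_points_def)
  define F where "F = f - (\<Sum>\<alpha>\<in>S. h (r \<alpha>) * two_poles \<alpha>)"
  have F: "residue P F (r P - (\<Sum>\<alpha>\<in>S. r \<alpha> * (of_bool (P = \<alpha>) - of_bool (P = Origin))))"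
    if P: "on_curve E P" for P
    unfolding F_def
    by (intro residue_diff residue_sum residue_scale residue_two_poles P r S)
  have aff: "residue P F 0" if P: "on_curve E P" "P \<noteq> Origin" for P
  proof -
    have "(\<Sum>\<alpha>\<in>S. r \<alpha> * (of_bool (P = \<alpha>) - of_bool (P = Origin))) = (\<Sum>\<alpha>\<in>S. if P = \<alpha> then r \<alpha> else 0)"
      using P by (intro sum.cong) auto
    also have "\<dots> = r P" using S(1) P by (simp add: S_def curve_points_def)
    finally show ?thesis using F[OF P(1)] by simp
  qed
  have o: "residue Origin F (r Origin + sum r S)"
  proof -
    have "(\<Sum>\<alpha>\<in>S. r \<alpha> * (of_bool (Origin = \<alpha>) - of_bool (Origin = Origin))) = (\<Sum>\<alpha>\<in>S. - r \<alpha>)"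
      by (intro sum.cong) (auto simp: S_def)
    then show ?thesis using F[of Origin] by (simp add: sum_negf)
  qed
  have "\<exists>c. F = h c"
  proof (rule liouville)
    show "\<exists>c. hv P F c" if "on_curve E P" "P \<noteq> Origin" for P
      using aff[OF that] by (simp add: residue_0_iff local_ring_iff)
    show "F = 0 \<or> nu Origin F \<ge> -1" using residue_nu[OF _ o] by auto
  qed
  then have "residue Origin F 0" using residue_const[of Origin] by auto
  then have 0: "r Origin + sum r S = 0" using residue_unique[OF _ o] by auto
  have "sum r {P \<in> curve_points E. r P \<noteq> 0} = sum r (insert Origin S)"
    using S(1) by (intro sum.mono_neutral_left) (auto simp: S_def curve_points_def)
  also have "\<dots> = r Origin + sum r S" using S(1) by (subst sum.insert) (auto simp: S_def)
  finally show "sum r {P \<in> curve_points E. r P \<noteq> 0} = 0" using 0 by simp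
qed

end


section \<open>Translations\<close>

locale translation = inv_der E K D
  for E :: "'c::{alg_closed_field, field_char_0} weierstrass" and K :: "('c, 'k::field) function_field"
    and D :: "'k \<Rightarrow> 'k" +
  fixes s :: "'c point" and \<tau> :: "'k \<Rightarrow> 'k"
  assumes s: "on_curve E s" and s_nt: "\<not> ec_torsion E s"
    and trans: "translation_automorphism E K s \<tau>"
begin

abbreviation T :: "'c point \<Rightarrow> 'c point" where "T P \<equiv> ec_add E P s"

sublocale \<tau>: point_aut E K \<tau> T
  using trans s on_curve_add
  by unfold_locales (auto simp: translation_automorphism_def curve_points_def)

lemma T_inv: "on_curve E P \<Longrightarrow> T (ec_add E P (ec_neg E s)) = P"
  by (rule add_sub_cancel[OF _ s])

lemma T_inj: "on_curve E P \<Longrightarrow> on_curve E Q \<Longrightarrow> T P = T Q \<Longrightarrow> P = Q"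
  using sub_add_cancel s by metis

lemma s_affine: "s \<noteq> Origin"
  using s_nt multiple_1[OF s] unfolding ec_torsion_def by (metis zero_less_one)

text \<open>Conjugating \<open>D\<close> by \<open>\<tau>\<close> gives a derivation, hence
  \<open>k\<close> times \<open>D\<close>. Evaluated on a uniformizer at \<open>Q\<close>, the
  numerator of \<open>k\<close> is regular and the denominator a unit, so \<open>k\<close> has no
  poles and is constant.\<close>

lemma tau_D_aux: "\<exists>c. c \<noteq> 0 \<and> (\<forall>f. D (\<tau> f) = h c * \<tau> (D f))"
proof -
  define D' where "D' f = inv \<tau> (D (\<tau> f))" for f
  have \<tau>D': "\<tau> (D' f) = D (\<tau> f)" for f
    unfolding D'_def by (simp add: bij_is_surj[OF \<tau>.bij_aut] surj_f_inv_f)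
  have inj: "f = g" if "\<tau> f = \<tau> g" for f g
    using that bij_is_inj[OF \<tau>.bij_aut] by (simp add: inj_eq)
  have der: "derivation D'"
    unfolding derivation_def by (intro conjI allI; rule inj) (simp_all add: \<tau>D' D_mult)
  define k where "k = D' x / D x"
  have Dx: "D x \<noteq> 0" using psi_nz D_x by simp
  have kD: "D' f = k * D f" for f
    by (rule derivation_unique[OF D der]) (use Dx in \<open>simp add: k_def\<close>)
  have "\<exists>c. k = h c"
  proof (rule regular_const)
    fix Q assume Q: "on_curve E Q"
    define P where "P = ec_add E Q (ec_neg E s)"
    have P: "on_curve E P" and TP: "T P = Q"
      using on_curve_add on_curve_neg Q s T_inv by (auto simp: P_def)
    obtain c where c: "hv Q (D (unif Q)) c" "c \<noteq> 0" using D_unif[OF Q] by blast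
    have "unif Q \<in> local_ring K Q" using hv_unif[OF Q] by (auto simp: local_ring_iff)
    then have "\<tau> (unif Q) \<in> local_ring K P" using \<tau>.local_ring_aut_iff[OF P] TP by simp
    then have "\<tau> (D' (unif Q)) \<in> local_ring K P" unfolding \<tau>D' by (rule D_regular[OF P])
    then have "D' (unif Q) \<in> local_ring K Q" using \<tau>.local_ring_aut_iff[OF P] TP by simp
    moreover have "k = D' (unif Q) / D (unif Q)" using hv_nz[OF Q c] kD by simp
    ultimately show "k \<in> local_ring K Q" using hv_divide[OF Q _ c] by (auto simp: local_ring_iff)
  qed
  then obtain c where c: "k = h c" ..
  have "D (\<tau> f) = h c * \<tau> (D f)" for f
    using arg_cong[OF kD[of f], of \<tau>] by (simp add: \<tau>D' c)
  moreover have "c \<noteq> 0"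
  proof
    assume "c = 0"
    then have "D (\<tau> f) = 0" for f using \<open>\<And>f. D (\<tau> f) = h c * \<tau> (D f)\<close>[of f] by simp
    moreover obtain g where "\<tau> g = x" using \<tau>.bij_aut by (metis bij_pointE)
    ultimately show False using Dx by metis
  qed
  ultimately show ?thesis by blast
qed

text \<open>Over the complex numbers both sides are \<open>\<zeta>(z) - \<zeta>(z + s) + \<zeta>(s)\<close>. The values agree because the chord through
  \<open>- s\<close> and \<open>P \<oplus> s\<close> is the reflection of the chord through \<open>s\<close> and \<open>P\<close>.\<close>

lemma tau_two_poles: "\<tau> (two_poles s) = sg (two_poles s)"
proof (rule eq_if_values_eq)
  obtain X Y where S: "s = Affine X Y" using s_affine by (cases s) auto
  note oS = s[unfolded S]
  \<comment> \<open>Outside this set, \<open>P\<close> and \<open>P \<oplus> s\<close> are affine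
    with abscissas different from that of \<open>s\<close>, so both sides can be evaluated. The last
    entry is the point that translation carries to the negative of \<open>s\<close>.\<close>
  let ?bad = "{Origin, s, ec_neg E s, ec_add E (ec_neg E s) (ec_neg E s)}"
  have "\<exists>c. hv P (\<tau> (two_poles s)) c \<and> hv P (sg (two_poles s)) c"
    if P: "on_curve E P" "P \<notin> ?bad" for P
  proof -
    obtain x1 y1 where P': "P = Affine x1 y1" using P(2) by (cases P) auto
    note oP = P(1)[unfolded P']
    have ne: "P \<noteq> ec_neg E s" using P by auto
    obtain l x3 where l: "Y = l * (X - x1) + y1" and x3: "x3 = l^2 + a1 E * l - a2 E - x1 - X"
      and Q: "T P = ec_neg E (Affine x3 (l * (x3 - x1) + y1))"
      using add_line[OF oP oS] ne unfolding P' S by metis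
    have oQ: "on_curve E (T P)" using on_curve_add[OF P(1) s] .
    have x1X: "x1 \<noteq> X"
      using same_x[OF oS, of y1] oP P(2) unfolding P' S by auto
    define y3 where "y3 = - (l * (x3 - x1) + y1) - a1 E * x3 - a3 E"
    have Q': "T P = Affine x3 y3" using Q by (simp add: y3_def)
    have x3X: "x3 \<noteq> X"
    proof
      assume "x3 = X"
      then have "T P = s \<or> T P = ec_neg E s" using same_x[OF oS, of y3] oQ Q' S by auto
      then show False
      proof
        assume "T P = s"
        then have "T P = T Origin" by simp
        then show False using T_inj[OF P(1)] P(2) by auto
      next
        assume "T P = ec_neg E s"
        then have "T P = T (ec_add E (ec_neg E s) (ec_neg E s))"
          using T_inv[OF on_curve_neg[OF s]] by simp
        then show False using T_inj[OF P(1)] on_curve_add on_curve_neg[OF s] P(2) by blast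
      qed
    qed
    define c where "c = 2 * Y + a1 E * X + a3 E"
    have val: "hv (Affine u v) (two_poles s) ((2 * v + a1 E * u + a3 E + c) / (2 * (u - X)))"
      if "on_curve E (Affine u v)" "u \<noteq> X" for u v
    proof -
      have "hv (Affine u v) ((psi + h c) / (h 2 * (x - h X))) ((2 * v + a1 E * u + a3 E + c) / (2 * (u - X)))"
        using that by (intro hv_divide hv_add hv_mult hv_diff hv_psi hv_const hv_x) auto
      then show ?thesis by (simp add: S c_def)
    qed
    have 1: "hv P (\<tau> (two_poles s)) ((2 * y3 + a1 E * x3 + a3 E + c) / (2 * (x3 - X)))"
      using val[of x3 y3] oQ x3X Q' \<tau>.hv_T[OF P(1)] by simp
    have "on_curve E (ec_neg E P)" by (rule on_curve_neg[OF P(1)])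
    then have 2: "hv P (sg (two_poles s)) ((2 * (- y1 - a1 E * x1 - a3 E) + a1 E * x1 + a3 E + c) / (2 * (x1 - X)))"
      using val[of x1 "- y1 - a1 E * x1 - a3 E"] x1X sg.hv_T[OF P(1)] unfolding P' by simp
    \<comment> \<open>The common value of both sides, \<open>- l - a1 E / 2\<close>, depends only on
      the slope of the chord through \<open>P\<close> and \<open>s\<close>.\<close>
    have "(2 * y3 + a1 E * x3 + a3 E + c) / (2 * (x3 - X)) = - l - a1 E / 2"
    proof -
      have "2 * y3 + a1 E * x3 + a3 E + c = (2 * (x3 - X)) * (- l - a1 E / 2)"
        unfolding y3_def c_def l by (simp add: algebra_simps)
      then show ?thesis using x3X by simp
    qed
    moreover have "(2 * (- y1 - a1 E * x1 - a3 E) + a1 E * x1 + a3 E + c) / (2 * (x1 - X)) = - l - a1 E / 2"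
    proof -
      have "2 * (- y1 - a1 E * x1 - a3 E) + a1 E * x1 + a3 E + c = (2 * (x1 - X)) * (- l - a1 E / 2)"
        unfolding c_def l by (simp add: algebra_simps)
      then show ?thesis using x1X by simp
    qed
    ultimately show ?thesis using 1 2 by metis
  qed
  then have "curve_points E - ?bad
    \<subseteq> {P. on_curve E P \<and> (\<exists>c. hv P (\<tau> (two_poles s)) c \<and> hv P (sg (two_poles s)) c)}"
    by (auto simp: curve_points_def)
  moreover have "infinite (curve_points E - ?bad)" using infinite_points by (intro Diff_infinite_finite) auto
  ultimately show "infinite {P. on_curve E P \<and> (\<exists>c. hv P (\<tau> (two_poles s)) c \<and> hv P (sg (two_poles s)) c)}"
    using infinite_super by blast
qed

text \<open>The scalar is 1 because \<open>\<tau>\<close> and \<open>sg\<close> agree on a function with a residue 1 at \<open>s\<close> and -1 at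
  the origin.\<close>

lemma D_tau: "D (\<tau> f) = \<tau> (D f)"
proof -
  obtain c where c: "c \<noteq> 0" "\<And>f. D (\<tau> f) = h c * \<tau> (D f)" using tau_D_aux by blast
  have o: "on_curve E Origin" by simp
  have "residue (T Origin) (two_poles s) (of_bool (s = s) - of_bool (s = Origin))"
    using residue_two_poles[OF s s] by simp
  then have "residue Origin (\<tau> (two_poles s)) (1 / c)"
    using residue_aut[OF \<tau>.point_aut_axioms c(2,1) o, of "two_poles s" 1] s_affine by simp
  moreover have "residue (ec_neg E Origin) (two_poles s) (- 1)"
    using residue_two_poles[OF o s] s_affine by simp
  then have "residue Origin (sg (two_poles s)) 1" using residue_sg[OF o] by fastforce
  ultimately have "1 / c = 1" using residue_unique[OF o] unfolding tau_two_poles by blast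
  then show ?thesis using c by simp
qed

lemma Dlog_tau: "Dlog (\<tau> f) = \<tau> (Dlog f)"
  by (simp add: Dlog_def D_tau)

lemma residue_tau: "on_curve E P \<Longrightarrow> residue (T P) f r \<Longrightarrow> residue P (\<tau> f) r"
  using residue_aut[OF \<tau>.point_aut_axioms, of 1 P f r] D_tau by simp

text \<open>On points, adding \<open>s\<close>, negating and adding \<open>s\<close> again is
  negation. The two functions thus take equal values except possibly at the negatives of the
  finitely many zeros and poles of \<open>f\<close>.\<close>

lemma tau_sg_tau: "\<tau> (sg (\<tau> f)) = sg f"
proof (cases "f = 0")
  case False
  have "{P. on_curve E P \<and> \<not> (\<exists>c. hv P (\<tau> (sg (\<tau> f))) c \<and> hv P (sg f) c)}
    \<subseteq> ec_neg E ` {P. on_curve E P \<and> nu P f \<noteq> 0}"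
  proof safe
    fix P assume P: "on_curve E P" and no: "\<not> (\<exists>c. hv P (\<tau> (sg (\<tau> f))) c \<and> hv P (sg f) c)"
    define Q where "Q = ec_neg E P"
    have Q: "on_curve E Q" using on_curve_neg[OF P] by (simp add: Q_def)
    have "T (ec_neg E (T P)) = Q"
      using ec_neg_add[OF P s] T_inv[OF Q] by (simp add: Q_def)
    then have "hv P (\<tau> (sg (\<tau> f))) c" if "hv Q f c" for c
      using that \<tau>.hv_T sg.hv_T P on_curve_add[OF P s] on_curve_neg by metis
    then have "\<not> (\<exists>c. hv Q f c)" using no sg.hv_T[OF P] unfolding Q_def by blast
    then have "nu Q f \<noteq> 0" using hv_iff_nu[OF Q, of f] by auto
    then show "P \<in> ec_neg E ` {P. on_curve E P \<and> nu P f \<noteq> 0}"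
      using Q by (intro image_eqI[of _ _ Q]) (auto simp: Q_def)
  qed
  then have fin: "finite {P. on_curve E P \<and> \<not> (\<exists>c. hv P (\<tau> (sg (\<tau> f))) c \<and> hv P (sg f) c)}"
    using finite_zeros[OF False] finite_subset by blast
  have eq: "curve_points E = {P. on_curve E P \<and> (\<exists>c. hv P (\<tau> (sg (\<tau> f))) c \<and> hv P (sg f) c)}
    \<union> {P. on_curve E P \<and> \<not> (\<exists>c. hv P (\<tau> (sg (\<tau> f))) c \<and> hv P (sg f) c)}"
    by (auto simp: curve_points_def)
  show ?thesis
  proof (rule eq_if_values_eq, rule notI)
    assume "finite {P. on_curve E P \<and> (\<exists>c. hv P (\<tau> (sg (\<tau> f))) c \<and> hv P (sg f) c)}"
    from finite_UnI[OF this fin] show False using infinite_points unfolding eq by contradiction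
  qed
qed simp

end

section \<open>Sums along orbits\<close>

lemma finsupp_sum_eq:
  assumes "finite B" "{x \<in> A. f x \<noteq> 0} \<subseteq> B" "B \<subseteq> A" shows "finsupp_sum f A = sum f B"
  unfolding finsupp_sum_def using assms by (intro sum.mono_neutral_left) auto

lemma finsupp_sum_reindex: assumes "inj g" shows "finsupp_sum f (range g) = finsupp_sum (\<lambda>n. f (g n)) UNIV"
proof -
  have "{x \<in> range g. f x \<noteq> 0} = g ` {n \<in> UNIV. f (g n) \<noteq> 0}" by auto
  then show ?thesis unfolding finsupp_sum_def
    by (simp add: sum.reindex[OF inj_on_subset[OF assms]])
qed

lemma finsupp_sum_of_int:
  "finsupp_sum (\<lambda>x. of_int (f x)) A = (of_int (finsupp_sum f A) :: 'a::ring_char_0)"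
  by (simp add: finsupp_sum_def)

lemma finsupp_sum_uminus: "finsupp_sum (\<lambda>x. - f x) A = - finsupp_sum f A"
  for f :: "'a \<Rightarrow> 'b::ab_group_add"
  by (simp add: finsupp_sum_def sum_negf)

lemma finsupp_sum_cong: "(\<And>x. x \<in> A \<Longrightarrow> f x = g x) \<Longrightarrow> finsupp_sum f A = finsupp_sum g A"
  unfolding finsupp_sum_def by (rule sum.cong) auto

text \<open>Summation by parts. \<open>B\<close> contains the support of \<open>b\<close> and that
  of its shift, so that \<open>shift\<close> can move the index; in the second claim the weights
  \<open>n - 1\<close> and \<open>n\<close> differ by the -1 that remains.\<close>

lemma finsupp_sum_telescope:
  fixes b :: "int \<Rightarrow> 'a::comm_ring_1"
  assumes "finite {n. b n \<noteq> 0}"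
  shows "finsupp_sum (\<lambda>n. b (n + 1) - b n) UNIV = 0"
    and "finsupp_sum (\<lambda>n. of_int n * (b (n + 1) - b n)) UNIV = - finsupp_sum b UNIV"
proof -
  define S where "S = {n. b n \<noteq> 0}"
  define S' where "S' = (\<lambda>n. n - 1) ` S"
  define B where "B = S \<union> S'"
  have fin: "finite S" "finite S'" "finite B" using assms by (simp_all add: S_def S'_def B_def)
  have in_S': "n \<in> S' \<longleftrightarrow> b (n + 1) \<noteq> 0" for n
    by (auto simp: S'_def S_def image_iff algebra_simps intro: exI[of _ "n + 1"])
  have shift: "(\<Sum>n\<in>B. c n * b (n + 1)) = (\<Sum>n\<in>S. c (n - 1) * b n)" for c :: "int \<Rightarrow> 'a"
  proof -
    have "(\<Sum>n\<in>B. c n * b (n + 1)) = (\<Sum>n\<in>S'. c n * b (n + 1))"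
      using fin in_S' by (intro sum.mono_neutral_right) (auto simp: B_def)
    also have "\<dots> = (\<Sum>n\<in>S. c (n - 1) * b n)"
      unfolding S'_def by (subst sum.reindex) (auto intro: inj_onI)
    finally show ?thesis .
  qed
  have stay: "(\<Sum>n\<in>B. c n * b n) = (\<Sum>n\<in>S. c n * b n)" for c :: "int \<Rightarrow> 'a"
    using fin by (intro sum.mono_neutral_right) (auto simp: B_def S_def)
  have out: "b n = 0 \<and> b (n + 1) = 0" if "n \<notin> B" for n
    using that in_S'[of n] unfolding B_def S_def by simp
  have "finsupp_sum (\<lambda>n. b (n + 1) - b n) UNIV = (\<Sum>n\<in>B. b (n + 1) - b n)"
  proof (rule finsupp_sum_eq[OF fin(3)], rule subsetI, rule ccontr)
    fix n assume "n \<notin> B"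
    moreover assume "n \<in> {n \<in> UNIV. b (n + 1) - b n \<noteq> 0}"
    ultimately show False using out[of n] by simp
  qed simp
  also have "\<dots> = 0" using shift[of "\<lambda>_. 1"] stay[of "\<lambda>_. 1"] by (simp add: sum_subtractf)
  finally show "finsupp_sum (\<lambda>n. b (n + 1) - b n) UNIV = 0" .
  have "finsupp_sum (\<lambda>n. of_int n * (b (n + 1) - b n)) UNIV = (\<Sum>n\<in>B. of_int n * (b (n + 1) - b n))"
  proof (rule finsupp_sum_eq[OF fin(3)], rule subsetI, rule ccontr)
    fix n assume "n \<notin> B"
    moreover assume "n \<in> {n \<in> UNIV. of_int n * (b (n + 1) - b n) \<noteq> 0}"
    ultimately show False using out[of n] by simp
  qed simp
  also have "\<dots> = (\<Sum>n\<in>S. of_int (n - 1) * b n) - (\<Sum>n\<in>S. of_int n * b n)"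
    using shift[of of_int] stay[of of_int] by (simp add: right_diff_distrib sum_subtractf)
  also have "\<dots> = - sum b S"
    by (simp add: left_diff_distrib sum_subtractf)
  also have "sum b S = finsupp_sum b UNIV" by (simp add: finsupp_sum_def S_def)
  finally show "finsupp_sum (\<lambda>n. of_int n * (b (n + 1) - b n)) UNIV = - finsupp_sum b UNIV" .
qed

text \<open>A right inverse of the forward difference on finitely supported functions. The sum stops
  before \<open>n\<close>, so that the difference at \<open>n\<close> is \<open>f n\<close>; it runs
  over the support because there is no least integer to start from.\<close>

definition cumulative :: "(int \<Rightarrow> int) \<Rightarrow> int \<Rightarrow> int" where
  "cumulative f n = sum f {k. k < n \<and> f k \<noteq> 0}"

lemma cumulative_step:
  assumes "finite {n. f n \<noteq> 0}" shows "cumulative f (n + 1) - cumulative f n = f n"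
proof (cases "f n = 0")
  case True
  then have "{k. k < n + 1 \<and> f k \<noteq> 0} = {k. k < n \<and> f k \<noteq> 0}"
    using order_le_less by (metis zless_add1_eq)
  then show ?thesis using True by (simp add: cumulative_def)
next
  case False
  then have "{k. k < n + 1 \<and> f k \<noteq> 0} = insert n {k. k < n \<and> f k \<noteq> 0}" by auto
  moreover have "finite {k. k < n \<and> f k \<noteq> 0}" using assms by (rule finite_subset[rotated]) auto
  ultimately show ?thesis by (simp add: cumulative_def)
qed

lemma cumulative_nz: "cumulative f n \<noteq> 0 \<Longrightarrow> \<exists>k. k < n \<and> f k \<noteq> 0"
  unfolding cumulative_def by (erule sum.not_neutral_contains_not_neutral) auto

lemma cumulative_finite:
  assumes fin: "finite {n. f n \<noteq> 0}" and zero: "finsupp_sum f UNIV = 0"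
  shows "finite {n. cumulative f n \<noteq> 0}"
proof (rule finite_subset)
  let ?S = "{n. f n \<noteq> 0}"
  show "{n. cumulative f n \<noteq> 0} \<subseteq> {Min ?S..Max ?S}"
  proof
    fix n assume "n \<in> {n. cumulative f n \<noteq> 0}"
    then have n: "cumulative f n \<noteq> 0" by simp
    obtain k where "k < n" "f k \<noteq> 0" using cumulative_nz[OF n] by blast
    then have "Min ?S \<le> n" using Min_le[OF fin, of k] by simp
    moreover have "\<exists>k. \<not> k < n \<and> f k \<noteq> 0"
    proof (rule ccontr)
      assume "\<not> (\<exists>k. \<not> k < n \<and> f k \<noteq> 0)"
      then have "{k. k < n \<and> f k \<noteq> 0} = {k \<in> UNIV. f k \<noteq> 0}" by auto
      then show False using n zero by (simp add: cumulative_def finsupp_sum_def)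
    qed
    then obtain k where "\<not> k < n" "f k \<noteq> 0" by blast
    then have "n \<le> Max ?S" using Max_ge[OF fin, of k] by simp
    ultimately show "n \<in> {Min ?S..Max ?S}" by simp
  qed
qed simp

text \<open>The telescoping identity with \<open>cumulative f\<close> in the role of
  \<open>b\<close>. It links the second condition of the theorem, a first moment, with a total
  mass.\<close>

lemma finsupp_sum_cumulative:
  assumes "finite {n. f n \<noteq> 0}" "finsupp_sum f UNIV = 0"
  shows "finsupp_sum (cumulative f) UNIV = - finsupp_sum (\<lambda>n. n * f n) UNIV"
  using finsupp_sum_telescope(2)[OF cumulative_finite[OF assms]] by (simp add: cumulative_step assms(1))

section \<open>Orbits of the translation and sums over them\<close>

context translation begin

abbreviation M :: "int \<Rightarrow> 'c point" where "M n \<equiv> ec_multiple E n s"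
abbreviation orbits :: "'c point set set" where "orbits \<equiv> curve_points E // orbit_rel E s"

lemma on_curve_M: "on_curve E (M n)"
  by (rule on_curve_multiple[OF s])

lemma add_M_M: "on_curve E P \<Longrightarrow> ec_add E (ec_add E P (M m)) (M n) = ec_add E P (M (m + n))"
  by (simp add: ec_add_assoc on_curve_M multiple_add[OF s])

lemma T_add_M: "on_curve E P \<Longrightarrow> T (ec_add E P (M n)) = ec_add E P (M (n + 1))"
  by (simp add: ec_add_assoc on_curve_M multiple_Suc[OF s] s)

lemma orbit_rel_iff: "(P, Q) \<in> orbit_rel E s \<longleftrightarrow> on_curve E P \<and> (\<exists>n. Q = ec_add E P (M n))"
  unfolding orbit_rel_def using on_curve_add on_curve_M by (auto simp: curve_points_def)

lemma equiv_orbit_rel: "equiv (curve_points E) (orbit_rel E s)"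
proof (rule equivI)
  show "orbit_rel E s \<subseteq> curve_points E \<times> curve_points E" by (auto simp: orbit_rel_def)
  show "refl_on (curve_points E) (orbit_rel E s)"
    unfolding refl_on_def orbit_rel_iff by (auto simp: curve_points_def intro: exI[of _ 0])
  show "sym (orbit_rel E s)"
  proof (rule symI)
    fix P Q assume "(P, Q) \<in> orbit_rel E s"
    then obtain n where P: "on_curve E P" and Q: "Q = ec_add E P (M n)" unfolding orbit_rel_iff by blast
    have "P = ec_add E Q (M (- n))" using add_M_M[OF P, of n "- n"] by (simp add: Q)
    moreover have "on_curve E Q" unfolding Q by (rule on_curve_add[OF P on_curve_M])
    ultimately show "(Q, P) \<in> orbit_rel E s" unfolding orbit_rel_iff by blast
  qed
  show "trans (orbit_rel E s)"
  proof (rule transI)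
    fix P Q R assume "(P, Q) \<in> orbit_rel E s" "(Q, R) \<in> orbit_rel E s"
    then show "(P, R) \<in> orbit_rel E s" unfolding orbit_rel_iff using add_M_M by blast
  qed
qed

lemma orbit_on_curve: "\<omega> \<in> orbits \<Longrightarrow> P \<in> \<omega> \<Longrightarrow> on_curve E P"
  using in_quotient_imp_subset[OF equiv_orbit_rel] by (auto simp: curve_points_def)

lemma orbit_eq_class: assumes "\<omega> \<in> orbits" "P \<in> \<omega>" shows "\<omega> = orbit_rel E s `` {P}"
proof -
  obtain Q where Q: "\<omega> = orbit_rel E s `` {Q}" using assms(1) by (rule quotientE)
  then have "(Q, P) \<in> orbit_rel E s" using assms(2) by simp
  then show ?thesis unfolding Q by (rule equiv_class_eq[OF equiv_orbit_rel])
qed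

lemma orbit_range: assumes "\<omega> \<in> orbits" "P \<in> \<omega>" shows "\<omega> = range (\<lambda>n. ec_add E P (M n))"
  using orbit_eq_class[OF assms] orbit_on_curve[OF assms] by (auto simp: orbit_rel_iff)

lemma inj_orbit: "on_curve E P \<Longrightarrow> inj (\<lambda>n. ec_add E P (M n))"
  by (rule injI) (rule orbit_inj[OF s _ s_nt])

lemma finsupp_sum_orbit: assumes "\<omega> \<in> orbits" "P \<in> \<omega>"
  shows "finsupp_sum f \<omega> = finsupp_sum (\<lambda>n. f (ec_add E P (M n))) UNIV"
  by (subst orbit_range[OF assms]) (rule finsupp_sum_reindex[OF inj_orbit[OF orbit_on_curve[OF assms]]])

lemma finite_orbit_support:
  assumes P: "on_curve E P" and "finite {Q \<in> curve_points E. f Q \<noteq> 0}"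
  shows "finite {n. f (ec_add E P (M n)) \<noteq> 0}"
proof -
  have "{n. f (ec_add E P (M n)) \<noteq> 0} \<subseteq> (\<lambda>n. ec_add E P (M n)) -` {Q \<in> curve_points E. f Q \<noteq> 0}"
    using on_curve_add[OF P on_curve_M] by (auto simp: curve_points_def)
  then show ?thesis using finite_vimageI[OF assms(2) inj_orbit[OF P]] finite_subset by blast
qed

lemma finsupp_sum_orbits:
  assumes fin: "finite {P \<in> curve_points E. f P \<noteq> 0}"
  shows "finsupp_sum (\<lambda>\<omega>. finsupp_sum f \<omega>) orbits = sum f {P \<in> curve_points E. f P \<noteq> 0}"
proof -
  define S where "S = {P \<in> curve_points E. f P \<noteq> 0}"
  define cls where "cls P = orbit_rel E s `` {P}" for P
  have cls: "cls P \<in> orbits" if "P \<in> S" for P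
    using that by (simp add: cls_def S_def quotientI)
  have inner: "finsupp_sum f \<omega> = sum f {P. P \<in> S \<and> cls P = \<omega>}" if \<omega>: "\<omega> \<in> orbits" for \<omega>
  proof -
    have "{P \<in> \<omega>. f P \<noteq> 0} = {P. P \<in> S \<and> cls P = \<omega>}"
    proof (intro set_eqI iffI)
      fix P assume P: "P \<in> {P \<in> \<omega>. f P \<noteq> 0}"
      then show "P \<in> {P. P \<in> S \<and> cls P = \<omega>}"
        using orbit_on_curve[OF \<omega>] orbit_eq_class[OF \<omega>] by (auto simp: S_def cls_def curve_points_def)
    next
      fix P assume P: "P \<in> {P. P \<in> S \<and> cls P = \<omega>}"
      then have "P \<in> cls P" unfolding cls_def S_def
        using equiv_class_self[OF equiv_orbit_rel] by blast
      then show "P \<in> {P \<in> \<omega>. f P \<noteq> 0}" using P by (auto simp: S_def)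
    qed
    then show ?thesis by (simp add: finsupp_sum_def)
  qed
  have "finsupp_sum (\<lambda>\<omega>. finsupp_sum f \<omega>) orbits = sum (\<lambda>\<omega>. finsupp_sum f \<omega>) (cls ` S)"
  proof (rule finsupp_sum_eq)
    show "{\<omega> \<in> orbits. finsupp_sum f \<omega> \<noteq> 0} \<subseteq> cls ` S"
    proof
      fix \<omega> assume "\<omega> \<in> {\<omega> \<in> orbits. finsupp_sum f \<omega> \<noteq> 0}"
      then have "\<omega> \<in> orbits" "finsupp_sum f \<omega> \<noteq> 0" by blast+
      then have "sum f {P. P \<in> S \<and> cls P = \<omega>} \<noteq> 0" using inner by metis
      then have "{P. P \<in> S \<and> cls P = \<omega>} \<noteq> {}" by (metis sum.empty)
      then show "\<omega> \<in> cls ` S" by blast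
    qed
  qed (use fin cls in \<open>auto simp: S_def\<close>)
  also have "\<dots> = (\<Sum>\<omega>\<in>cls ` S. sum f {P. P \<in> S \<and> cls P = \<omega>})"
    using cls by (intro sum.cong refl inner) blast
  also have "\<dots> = sum f S" using fin by (intro sum.image_gen[symmetric]) (simp add: S_def)
  finally show ?thesis by (simp add: S_def)
qed


text \<open>The two conditions of the theorem say that \<open>v\<close> is the coboundary of a function of total
  mass zero.\<close>

lemma coboundary_conditions:
  fixes v :: "'c point \<Rightarrow> int" and r :: "'c point \<Rightarrow> 'c"
  assumes rep: "\<And>\<omega>. \<omega> \<in> orbits \<Longrightarrow> rep \<omega> \<in> \<omega>"
    and fin: "finite {P \<in> curve_points E. r P \<noteq> 0}" and sum: "sum r {P \<in> curve_points E. r P \<noteq> 0} = 0"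
    and v: "\<And>P. on_curve E P \<Longrightarrow> of_int (v P) = r (T P) - r P"
  shows "\<omega> \<in> orbits \<Longrightarrow> finsupp_sum v \<omega> = 0"
    and "finsupp_sum (\<lambda>\<omega>. finsupp_sum (\<lambda>n. n * v (ec_add E (rep \<omega>) (M n))) UNIV) orbits = 0"
proof -
  define b where "b \<omega> n = r (ec_add E (rep \<omega>) (M n))" for \<omega> n
  have oc: "on_curve E (rep \<omega>)" if "\<omega> \<in> orbits" for \<omega>
    using orbit_on_curve[OF that rep[OF that]] .
  have fb: "finite {n. b \<omega> n \<noteq> 0}" if "\<omega> \<in> orbits" for \<omega>
    unfolding b_def by (rule finite_orbit_support[OF oc[OF that] fin])
  have vb: "of_int (v (ec_add E (rep \<omega>) (M n))) = b \<omega> (n + 1) - b \<omega> n" if "\<omega> \<in> orbits" for \<omega> n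
    using v[OF on_curve_add[OF oc[OF that] on_curve_M]] T_add_M[OF oc[OF that]] by (simp add: b_def)
  show "finsupp_sum v \<omega> = 0" if \<omega>: "\<omega> \<in> orbits" for \<omega>
  proof -
    \<comment> \<open>The values of \<open>r\<close> lie in the field of constants while the claim
      is about integers; characteristic 0 allows the return.\<close>
    have "(of_int (finsupp_sum v \<omega>) :: 'c) = 0"
      unfolding finsupp_sum_orbit[OF \<omega> rep[OF \<omega>]] finsupp_sum_of_int[symmetric] vb[OF \<omega>]
      by (rule finsupp_sum_telescope(1)[OF fb[OF \<omega>]])
    then show ?thesis by simp
  qed
  have "of_int (finsupp_sum (\<lambda>n. n * v (ec_add E (rep \<omega>) (M n))) UNIV) = - finsupp_sum r \<omega>"
    if \<omega>: "\<omega> \<in> orbits" for \<omega>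
    unfolding finsupp_sum_orbit[OF \<omega> rep[OF \<omega>]] finsupp_sum_of_int[symmetric] of_int_mult vb[OF \<omega>]
    using finsupp_sum_telescope(2)[OF fb[OF \<omega>]] by (simp add: b_def)
  then have "(of_int (finsupp_sum (\<lambda>\<omega>. finsupp_sum (\<lambda>n. n * v (ec_add E (rep \<omega>) (M n))) UNIV) orbits) :: 'c)
      = finsupp_sum (\<lambda>\<omega>. - finsupp_sum r \<omega>) orbits"
    unfolding finsupp_sum_of_int[symmetric] by (rule finsupp_sum_cong)
  also have "\<dots> = 0" using finsupp_sum_orbits[OF fin] sum by (simp add: finsupp_sum_uminus)
  finally show "finsupp_sum (\<lambda>\<omega>. finsupp_sum (\<lambda>n. n * v (ec_add E (rep \<omega>) (M n))) UNIV) orbits = 0"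
    by simp
qed

text \<open>Along each orbit, indexed from its representative, \<open>b\<close> is the sum of
  \<open>v\<close> over all earlier points. By \<open>c1\<close> it has finite support on an orbit,
  and by \<open>c2\<close> its masses on the orbits add up to 0.\<close>

lemma coboundary_exists:
  fixes v :: "'c point \<Rightarrow> int"
  assumes rep: "\<And>\<omega>. \<omega> \<in> orbits \<Longrightarrow> rep \<omega> \<in> \<omega>"
    and fin: "finite {P \<in> curve_points E. v P \<noteq> 0}"
    and c1: "\<And>\<omega>. \<omega> \<in> orbits \<Longrightarrow> finsupp_sum v \<omega> = 0"
    and c2: "finsupp_sum (\<lambda>\<omega>. finsupp_sum (\<lambda>n. n * v (ec_add E (rep \<omega>) (M n))) UNIV) orbits = 0"
  obtains b :: "'c point \<Rightarrow> int" where "finite {P \<in> curve_points E. b P \<noteq> 0}"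
    "sum b {P \<in> curve_points E. b P \<noteq> 0} = 0" "\<And>P. on_curve E P \<Longrightarrow> v P = b (T P) - b P"
proof -
  define vw where "vw \<omega> n = v (ec_add E (rep \<omega>) (M n))" for \<omega> n
  define cls where "cls P = orbit_rel E s `` {P}" for P
  define idx where "idx P = (THE n. P = ec_add E (rep (cls P)) (M n))" for P
  define b where "b P = cumulative (vw (cls P)) (idx P)" for P
  have oc: "on_curve E (rep \<omega>)" if "\<omega> \<in> orbits" for \<omega>
    using orbit_on_curve[OF that rep[OF that]] .
  have fvw: "finite {n. vw \<omega> n \<noteq> 0}" if "\<omega> \<in> orbits" for \<omega>
    unfolding vw_def by (rule finite_orbit_support[OF oc[OF that] fin])
  have svw: "finsupp_sum (vw \<omega>) UNIV = 0" if "\<omega> \<in> orbits" for \<omega>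
    using c1[OF that] unfolding finsupp_sum_orbit[OF that rep[OF that]] vw_def .
  have cls: "cls P \<in> orbits" "P \<in> cls P" if "on_curve E P" for P
    using that equiv_class_self[OF equiv_orbit_rel] by (auto simp: cls_def curve_points_def intro: quotientI)
  have b: "b (ec_add E (rep \<omega>) (M n)) = cumulative (vw \<omega>) n" if \<omega>: "\<omega> \<in> orbits" for \<omega> n
  proof -
    have "ec_add E (rep \<omega>) (M n) \<in> \<omega>" using orbit_range[OF \<omega> rep[OF \<omega>]] by blast
    then have c: "cls (ec_add E (rep \<omega>) (M n)) = \<omega>" using orbit_eq_class[OF \<omega>] by (simp add: cls_def)
    have "idx (ec_add E (rep \<omega>) (M n)) = n"
      unfolding idx_def c using inj_orbit[OF oc[OF \<omega>]] by (intro the_equality) (auto dest: injD)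
    then show ?thesis by (simp add: b_def c)
  qed
  have repr_pt: "\<exists>n. P = ec_add E (rep (cls P)) (M n)" if "on_curve E P" for P
    using orbit_range[OF cls(1)[OF that] rep[OF cls(1)[OF that]]] cls(2)[OF that] by blast
  have bfin: "finite {P \<in> curve_points E. b P \<noteq> 0}"
  proof (rule finite_subset)
    let ?Q = "cls ` {P \<in> curve_points E. v P \<noteq> 0}"
    show "{P \<in> curve_points E. b P \<noteq> 0}
      \<subseteq> (\<Union>\<omega>\<in>?Q. (\<lambda>n. ec_add E (rep \<omega>) (M n)) ` {n. cumulative (vw \<omega>) n \<noteq> 0})"
    proof
      fix P assume "P \<in> {P \<in> curve_points E. b P \<noteq> 0}"
      then have P: "on_curve E P" "b P \<noteq> 0" by (auto simp: curve_points_def)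
      obtain n where n: "P = ec_add E (rep (cls P)) (M n)" using repr_pt[OF P(1)] by blast
      have bn: "cumulative (vw (cls P)) n \<noteq> 0" using b[OF cls(1)[OF P(1)], of n] n P(2) by simp
      \<comment> \<open>A nonzero partial sum needs a nonzero term, so only the finitely many orbits
        that meet the support of \<open>v\<close> matter.\<close>
      then obtain k where k: "vw (cls P) k \<noteq> 0" using cumulative_nz by blast
      define R where "R = ec_add E (rep (cls P)) (M k)"
      have "R \<in> cls P" using orbit_range[OF cls(1)[OF P(1)] rep[OF cls(1)[OF P(1)]]] by (auto simp: R_def)
      then have "cls R = cls P" "on_curve E R"
        using orbit_eq_class[OF cls(1)[OF P(1)]] orbit_on_curve[OF cls(1)[OF P(1)]] by (auto simp: cls_def)
      then have "cls P \<in> ?Q" using k by (intro image_eqI[of _ _ R]) (auto simp: R_def vw_def curve_points_def)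
      then show "P \<in> (\<Union>\<omega>\<in>?Q. (\<lambda>n. ec_add E (rep \<omega>) (M n)) ` {n. cumulative (vw \<omega>) n \<noteq> 0})"
        using bn n by blast
    qed
    show "finite (\<Union>\<omega>\<in>?Q. (\<lambda>n. ec_add E (rep \<omega>) (M n)) ` {n. cumulative (vw \<omega>) n \<noteq> 0})"
      using fin cls(1) cumulative_finite[OF fvw svw] by (auto simp: curve_points_def)
  qed
  have "sum b {P \<in> curve_points E. b P \<noteq> 0} = finsupp_sum (\<lambda>\<omega>. finsupp_sum b \<omega>) orbits"
    by (rule finsupp_sum_orbits[OF bfin, symmetric])
  also have "\<dots> = finsupp_sum (\<lambda>\<omega>. - finsupp_sum (\<lambda>n. n * vw \<omega> n) UNIV) orbits"
    by (rule finsupp_sum_cong)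
      (simp add: finsupp_sum_orbit[OF _ rep] b finsupp_sum_cumulative fvw svw)
  also have "\<dots> = 0" using c2 by (simp add: finsupp_sum_uminus vw_def)
  finally have bsum: "sum b {P \<in> curve_points E. b P \<noteq> 0} = 0" .
  have "v P = b (T P) - b P" if P: "on_curve E P" for P
  proof -
    obtain n where n: "P = ec_add E (rep (cls P)) (M n)" using repr_pt[OF P] by blast
    note c = cls(1)[OF P]
    have "T P = ec_add E (rep (cls P)) (M (n + 1))" using T_add_M[OF oc[OF c], of n] n by metis
    then have "b (T P) - b P = cumulative (vw (cls P)) (n + 1) - cumulative (vw (cls P)) n"
      using b[OF c] n by metis
    also have "\<dots> = vw (cls P) n" by (rule cumulative_step[OF fvw[OF c]])
    also have "\<dots> = v P" using n by (metis vw_def)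
    finally show ?thesis by simp
  qed
  then show ?thesis using that bfin bsum by blast
qed

end

section \<open>Summability of logarithmic derivatives\<close>

context translation begin

text \<open>A pole of order at least 2 of \<open>g\<close> that comes first in its orbit survives in \<open>\<tau> g - g\<close>.\<close>

lemma simple_poles:
  assumes eq: "Dlog a = \<tau> g - g" and "a \<noteq> 0" and P: "on_curve E P"
  shows "\<exists>r. residue P g r"
proof (rule ccontr)
  assume "\<not> (\<exists>r. residue P g r)"
  then have "\<not> (g = 0 \<or> nu P g \<ge> -1)" using residue_exists[OF P, of g] by blast
  then have bad: "g \<noteq> 0" "nu P g < -1" by simp_all
  define B where "B = {n. nu (ec_add E P (M n)) g < -1}"
  have "finite {n. nu (ec_add E P (M n)) g \<noteq> 0}"
    using finite_zeros[OF bad(1)]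
    by (intro finite_orbit_support[OF P, of "\<lambda>Q. nu Q g"]) (simp add: curve_points_def)
  then have B: "finite B" by (rule finite_subset[rotated]) (auto simp: B_def)
  have "0 \<in> B" using bad by (simp add: B_def)
  define n where "n = Min B"
  have n: "n \<in> B" "n - 1 \<notin> B" using Min_in[OF B] Min_le[OF B, of "n - 1"] \<open>0 \<in> B\<close> by (auto simp: n_def)
  \<comment> \<open>\<open>Q\<close> is the point just before the first pole of order at least 2 in
    the orbit. There \<open>g\<close> and \<open>Dlog a\<close> have at most simple poles, hence
    also \<open>\<tau> g\<close>, whose order at \<open>Q\<close> is that of \<open>g\<close> at
    \<open>T Q\<close>.\<close>
  define Q where "Q = ec_add E P (M (n - 1))"
  have Q: "on_curve E Q" unfolding Q_def by (rule on_curve_add[OF P on_curve_M])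
  have TQ: "T Q = ec_add E P (M n)" using T_add_M[OF P, of "n - 1"] by (simp add: Q_def)
  obtain r where "residue Q g r"
    using residue_exists[OF Q, of g] n(2) by (auto simp: B_def Q_def)
  then have "residue Q (Dlog a + g) (of_int (nu Q a) + r)"
    by (intro residue_add residue_Dlog Q \<open>a \<noteq> 0\<close>)
  then have "residue Q (\<tau> g) (of_int (nu Q a) + r)" by (simp add: eq)
  then have "nu Q (\<tau> g) \<ge> -1" using residue_nu[OF Q] bad(1) by simp
  then show False using n(1) \<tau>.nu_aut[OF Q] TQ by (simp add: B_def)
qed

lemma summable_residues:
  assumes eq: "Dlog a = \<tau> g - g" and "a \<noteq> 0"
  obtains r :: "'c point \<Rightarrow> 'c" where "finite {P \<in> curve_points E. r P \<noteq> 0}" "sum r {P \<in> curve_points E. r P \<noteq> 0} = 0"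
    "\<And>P. on_curve E P \<Longrightarrow> of_int (nu P a) = r (T P) - r P"
proof -
  define r where "r P = (SOME q. residue P g q)" for P
  have r: "residue P g (r P)" if "on_curve E P" for P
    unfolding r_def using simple_poles[OF assms that] by (rule someI_ex)
  have "of_int (nu P a) = r (T P) - r P" if P: "on_curve E P" for P
  proof (rule residue_unique[OF P])
    show "residue P (\<tau> g - g) (of_int (nu P a))" using residue_Dlog[OF P \<open>a \<noteq> 0\<close>] by (simp add: eq)
    show "residue P (\<tau> g - g) (r (T P) - r P)"
      by (intro residue_diff residue_tau r P \<tau>.T_curve)
  qed
  moreover have "finite {P \<in> curve_points E. r P \<noteq> 0}" "sum r {P \<in> curve_points E. r P \<noteq> 0} = 0"
    using residue_theorem[of g r] r by simp_all
  ultimately show ?thesis using that by blast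
qed

text \<open>Chosen because its logarithmic derivative is the difference of
  \<open>two_poles \<alpha>\<close> and its reflection. The constant at the origin matches
  \<open>two_poles Origin = 0\<close>.\<close>

fun vert :: "'c point \<Rightarrow> 'k" where
  "vert Origin = 1"
| "vert (Affine X Y) = x - h X"

lemma vert_nz: "vert \<alpha> \<noteq> 0"
  using x_minus_nz by (cases \<alpha>) auto

lemma nu_vert: "on_curve E \<alpha> \<Longrightarrow> on_curve E R \<Longrightarrow>
  nu R (vert \<alpha>) = pt \<alpha> R + pt (ec_neg E \<alpha>) R - 2 * pt Origin R"
  using nu_x_minus nu_const[of R 1] by (cases \<alpha>) auto

lemma Dlog_vert: "Dlog (vert \<alpha>) = two_poles \<alpha> - sg (two_poles \<alpha>)"
  using sg_two_poles by (cases \<alpha>) auto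

lemma nu_prod:
  assumes "on_curve E R" "\<And>i. i \<in> A \<Longrightarrow> f i \<noteq> 0"
  shows "nu R (\<Prod>i\<in>A. f i) = (\<Sum>i\<in>A. nu R (f i))"
  using assms(2)
proof (induction A rule: infinite_finite_induct)
  case (insert i A)
  then show ?case by (simp add: nu_mult[OF assms(1)])
qed (use nu_const[OF assms(1), of 1] in simp_all)

lemma Dlog_prod:
  assumes "\<And>i. i \<in> A \<Longrightarrow> f i \<noteq> 0" shows "Dlog (\<Prod>i\<in>A. f i) = (\<Sum>i\<in>A. Dlog (f i))"
  using assms by (induction A rule: infinite_finite_induct) (simp_all add: Dlog_mult)

lemma sum_of_int_pick:
  assumes "finite S" "P \<notin> S \<Longrightarrow> b P = 0"
  shows "(\<Sum>\<alpha>\<in>S. of_int (b \<alpha>) * of_bool (P = \<alpha>)) = (of_int (b P) :: 'r::comm_ring_1)"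
proof -
  have "(\<Sum>\<alpha>\<in>S. of_int (b \<alpha>) * of_bool (P = \<alpha>)) = (\<Sum>\<alpha>\<in>S. if P = \<alpha> then of_int (b \<alpha>) else (0 :: 'r))"
    by (intro sum.cong) auto
  also have "\<dots> = of_int (b P)" using assms by simp
  finally show ?thesis .
qed

lemma const_if_nu_0: assumes "\<And>P. on_curve E P \<Longrightarrow> nu P e = 0" shows "\<exists>c. e = h c"
  using assms by (intro regular_const) (simp add: local_ring_nu)

text \<open>The function \<open>g\<close> with simple poles and residues \<open>b\<close> satisfies \<open>\<tau> g - g = Dlog a + c\<close>. To see that
  \<open>c = 0\<close>, compare with the reflected equation: \<open>g - sg g\<close> is the logarithmic derivative of a function
  \<open>B\<close> with divisor \<open>b + sg b\<close>, and \<open>\<tau> (sg a) * \<tau> B / (B * a)\<close> has trivial divisor.\<close>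

lemma summable_if_coboundary:
  assumes "a \<noteq> 0" and fin: "finite {P \<in> curve_points E. b P \<noteq> 0}"
    and sum0: "sum b {P \<in> curve_points E. b P \<noteq> 0} = 0"
    and b: "\<And>P. on_curve E P \<Longrightarrow> nu P a = b (T P) - b P"
  shows "\<exists>g. Dlog a = \<tau> g - g"
proof -
  define S where "S = {P \<in> curve_points E. b P \<noteq> 0}"
  have S: "finite S" "\<And>\<alpha>. \<alpha> \<in> S \<Longrightarrow> on_curve E \<alpha>" using fin by (auto simp: S_def curve_points_def)
  define g where "g = (\<Sum>\<alpha>\<in>S. h (of_int (b \<alpha>)) * two_poles \<alpha>)"
  have g: "residue P g (of_int (b P))" if P: "on_curve E P" for P
  proof -
    have "residue P g (\<Sum>\<alpha>\<in>S. of_int (b \<alpha>) * (of_bool (P = \<alpha>) - of_bool (P = Origin)))"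
      unfolding g_def by (intro residue_sum residue_scale residue_two_poles P S)
    also have "(\<Sum>\<alpha>\<in>S. of_int (b \<alpha>) * (of_bool (P = \<alpha>) - of_bool (P = Origin)))
      = (\<Sum>\<alpha>\<in>S. of_int (b \<alpha>) * of_bool (P = \<alpha>)) - of_int (sum b S) * (of_bool (P = Origin) :: 'c)"
      by (simp add: right_diff_distrib sum_subtractf sum_distrib_right)
    \<comment> \<open>By \<open>sum0\<close> the correction at the origin vanishes, so
      \<open>g\<close> has residue \<open>b P\<close> there too.\<close>
    also have "\<dots> = of_int (b P)"
      using sum_of_int_pick[OF S(1), of P b] sum0 P by (simp add: S_def curve_points_def)
    finally show ?thesis .
  qed
  have "residue P (\<tau> g - g - Dlog a) 0" if P: "on_curve E P" for P
  proof -
    have "residue P (\<tau> g - g - Dlog a) (of_int (b (T P)) - of_int (b P) - of_int (nu P a))"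
      by (intro residue_diff residue_tau residue_Dlog g P \<tau>.T_curve \<open>a \<noteq> 0\<close>)
    then show ?thesis using b[OF P] by simp
  qed
  then obtain c where "\<tau> g - g - Dlog a = h c" using regular_residues_const by blast
  then have Da: "Dlog a = \<tau> g - g - h c" by (simp add: algebra_simps)
  \<comment> \<open>The exponents have to be integers; that is why \<open>b\<close> takes values in
    \<open>int\<close> and not just in the constants.\<close>
  define B where "B = (\<Prod>\<alpha>\<in>S. vert \<alpha> powi b \<alpha>)"
  have B0: "B \<noteq> 0" using S(1) vert_nz by (simp add: B_def)
  have DB: "Dlog B = g - sg g"
  proof -
    have "Dlog B = (\<Sum>\<alpha>\<in>S. of_int (b \<alpha>) * (two_poles \<alpha> - sg (two_poles \<alpha>)))"
      unfolding B_def by (simp add: Dlog_prod vert_nz Dlog_power_int Dlog_vert)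
    then show ?thesis by (simp add: g_def sg.aut_sum right_diff_distrib sum_subtractf flip: h_of_int)
  qed
  have nuB: "nu P B = b P + b (ec_neg E P)" if P: "on_curve E P" for P
  proof -
    have "nu P B = (\<Sum>\<alpha>\<in>S. nu P (vert \<alpha> powi b \<alpha>))"
      unfolding B_def by (rule nu_prod[OF P]) (simp add: vert_nz)
    also have "\<dots> = (\<Sum>\<alpha>\<in>S. b \<alpha> * (pt \<alpha> P + pt (ec_neg E \<alpha>) P - 2 * pt Origin P))"
      by (intro sum.cong refl) (simp add: nu_power_int[OF P vert_nz] nu_vert S P)
    also have "\<dots> = (\<Sum>\<alpha>\<in>S. b \<alpha> * of_bool (P = \<alpha>)) + (\<Sum>\<alpha>\<in>S. b \<alpha> * of_bool (ec_neg E P = \<alpha>))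
        - sum b S * (2 * pt Origin P)"
    proof -
      have neg: "(P = ec_neg E \<alpha>) = (ec_neg E P = \<alpha>)" for \<alpha> by auto
      show ?thesis unfolding neg
        by (simp add: distrib_left right_diff_distrib sum.distrib sum_subtractf sum_distrib_right)
    qed
    also have "\<dots> = b P + b (ec_neg E P)"
      using sum_of_int_pick[OF S(1), of P b, where 'r = int]
        sum_of_int_pick[OF S(1), of "ec_neg E P" b, where 'r = int] on_curve_neg[OF P] P sum0
      by (simp add: S_def curve_points_def)
    finally show ?thesis .
  qed
  define e where "e = \<tau> (sg a) * \<tau> B / (B * a)"
  have "nu P e = 0" if P: "on_curve E P" for P
  proof -
    note TP = \<tau>.T_curve[OF P]
    have "T (ec_neg E (T P)) = ec_neg E P"
      using ec_neg_add[OF P s] T_inv[OF on_curve_neg[OF P]] by simp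
    then have 1: "nu P (\<tau> (sg a)) = b (ec_neg E P) - b (ec_neg E (T P))"
      using \<tau>.nu_aut[OF P] sg.nu_aut[OF TP] b[OF on_curve_neg[OF TP]] by simp
    have 2: "nu P (\<tau> B) = b (T P) + b (ec_neg E (T P))"
      using \<tau>.nu_aut[OF P] nuB[OF TP] by simp
    have "nu P e = nu P (\<tau> (sg a)) + nu P (\<tau> B) - (nu P B + nu P a)"
      unfolding e_def using B0 \<open>a \<noteq> 0\<close> by (simp add: nu_divide[OF P] nu_mult[OF P])
    then show ?thesis using 1 2 nuB[OF P] b[OF P] by simp
  qed
  then obtain k where "e = h k" using const_if_nu_0 by blast
  then have "Dlog e = 0" by (simp add: Dlog_def)
  moreover have "Dlog e = Dlog (\<tau> (sg a)) + Dlog (\<tau> B) - (Dlog B + Dlog a)"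
    unfolding e_def using B0 \<open>a \<noteq> 0\<close> by (simp add: Dlog_divide Dlog_mult)
  \<comment> \<open>The reflected equation: moving \<open>Dlog\<close> past \<open>sg\<close> costs
    a sign, which also changes that of \<open>c\<close>, and \<open>\<tau> (sg (\<tau> g))\<close>
    collapses to \<open>sg g\<close>.\<close>
  moreover have "Dlog (\<tau> (sg a)) = - sg g + \<tau> (sg g) + h c"
    unfolding Dlog_tau Dlog_sg Da by (simp add: tau_sg_tau)
  moreover have "Dlog (\<tau> B) = \<tau> g - \<tau> (sg g)" unfolding Dlog_tau DB by simp
  \<comment> \<open>All terms in \<open>g\<close>, \<open>sg g\<close> and their translates cancel;
    the original and the reflected equation contribute one \<open>h c\<close> each.\<close>
  ultimately have "h c + h c = 0" unfolding DB Da by (simp add: algebra_simps)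
  then have "h (2 * c) = 0" by (simp only: mult_2 h_add)
  then have "c = 0" by (simp del: h_mult)
  then show ?thesis using Da by auto
qed

theorem Dlog_summable_iff:
  assumes rep: "\<And>\<omega>. \<omega> \<in> orbits \<Longrightarrow> rep \<omega> \<in> \<omega>" and "a \<noteq> 0"
  shows "(\<exists>g. Dlog a = \<tau> g - g) \<longleftrightarrow>
    (\<forall>\<omega>\<in>orbits. finsupp_sum (\<lambda>\<alpha>. nu \<alpha> a) \<omega> = 0) \<and>
    finsupp_sum (\<lambda>\<omega>. finsupp_sum (\<lambda>n. n * nu (ec_add E (rep \<omega>) (M n)) a) UNIV) orbits = 0"
proof
  assume "\<exists>g. Dlog a = \<tau> g - g"
  then obtain g where "Dlog a = \<tau> g - g" ..
  then obtain r :: "'c point \<Rightarrow> 'c" where "finite {P \<in> curve_points E. r P \<noteq> 0}" "sum r {P \<in> curve_points E. r P \<noteq> 0} = 0"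
    "\<And>P. on_curve E P \<Longrightarrow> of_int (nu P a) = r (T P) - r P"
    by (rule summable_residues[OF _ \<open>a \<noteq> 0\<close>]) blast
  from coboundary_conditions[where v = "\<lambda>P. nu P a", OF rep this]
  show "(\<forall>\<omega>\<in>orbits. finsupp_sum (\<lambda>\<alpha>. nu \<alpha> a) \<omega> = 0) \<and>
    finsupp_sum (\<lambda>\<omega>. finsupp_sum (\<lambda>n. n * nu (ec_add E (rep \<omega>) (M n)) a) UNIV) orbits = 0"
    by blast
next
  assume R: "(\<forall>\<omega>\<in>orbits. finsupp_sum (\<lambda>\<alpha>. nu \<alpha> a) \<omega> = 0) \<and>
    finsupp_sum (\<lambda>\<omega>. finsupp_sum (\<lambda>n. n * nu (ec_add E (rep \<omega>) (M n)) a) UNIV) orbits = 0"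
  have fin: "finite {P \<in> curve_points E. nu P a \<noteq> 0}"
    using finite_zeros[OF \<open>a \<noteq> 0\<close>] by (simp add: curve_points_def)
  obtain b :: "'c point \<Rightarrow> int" where "finite {P \<in> curve_points E. b P \<noteq> 0}"
    "sum b {P \<in> curve_points E. b P \<noteq> 0} = 0" "\<And>P. on_curve E P \<Longrightarrow> nu P a = b (T P) - b P"
    by (rule coboundary_exists[where v = "\<lambda>P. nu P a" and rep = rep, OF rep fin])
      (use R in blast)+
  then show "\<exists>g. Dlog a = \<tau> g - g" by (rule summable_if_coboundary[OF \<open>a \<noteq> 0\<close>])
qed

end


section \<open>Kaehler differentials\<close>

lemma lookup_differential_scale [simp]:
  "Poly_Mapping.lookup (differential_scale c u) k = c * Poly_Mapping.lookup u k"
  by (simp add: differential_scale_def Poly_Mapping.map.rep_eq when_def)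

lemma differential_scale_simps:
  "differential_scale c (u + v) = differential_scale c u + differential_scale c v"
  "differential_scale c (u - v) = differential_scale c u - differential_scale c v"
  "differential_scale c (differential_scale d u) = differential_scale (c * d) u"
  "differential_scale (c + d) u = differential_scale c u + differential_scale d u"
  "differential_scale (c - d) u = differential_scale c u - differential_scale d u"
  "differential_scale 0 u = 0" "differential_scale c 0 = 0" "differential_scale 1 u = u"
  "differential_scale c (Poly_Mapping.single f d) = Poly_Mapping.single f (c * d)"
  by (rule poly_mapping_eqI; simp add: lookup_add lookup_minus lookup_single when_def algebra_simps)+

lemma differential_scale_sum:
  "differential_scale (\<Sum>i\<in>A. f i) u = (\<Sum>i\<in>A. differential_scale (f i) u)"
  by (induction A rule: infinite_finite_induct) (simp_all add: differential_scale_simps)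

context ec_field begin

lemma kaehler_scale: "u \<in> kaehler_relations K \<Longrightarrow> differential_scale c u \<in> kaehler_relations K"
proof (induction rule: kaehler_relations.induct)
  case (plus u v)
  then show ?case by (simp add: differential_scale_simps kaehler_relations.plus)
next
  case (d_add f g d)
  then show ?case using kaehler_relations.d_add[of f g "c * d" K] by (simp add: differential_scale_simps)
next
  case (d_mult f g d)
  then show ?case using kaehler_relations.d_mult[of f g "c * d" K]
    by (simp add: differential_scale_simps mult.assoc)
qed (simp_all add: differential_scale_simps kaehler_relations.zero kaehler_relations.d_const)

lemma kaehler_minus: "u \<in> kaehler_relations K \<Longrightarrow> - u \<in> kaehler_relations K"
proof -
  assume "u \<in> kaehler_relations K"
  moreover have "differential_scale (- 1) u = - u" by (rule poly_mapping_eqI) simp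
  ultimately show ?thesis by (metis kaehler_scale)
qed

lemma kaehler_diff: "u \<in> kaehler_relations K \<Longrightarrow> v \<in> kaehler_relations K \<Longrightarrow> u - v \<in> kaehler_relations K"
  using kaehler_relations.plus[of u K "- v"] kaehler_minus[of v] by simp

lemma kaehler_sum: "(\<And>i. i \<in> A \<Longrightarrow> u i \<in> kaehler_relations K) \<Longrightarrow> (\<Sum>i\<in>A. u i) \<in> kaehler_relations K"
  by (induction A rule: infinite_finite_induct) (simp_all add: kaehler_relations.zero kaehler_relations.plus)

context
  fixes w \<delta>
  assumes w_nz: "\<not> differential_eq K w 0"
    and \<delta>: "\<And>f. differential_eq K (exact_differential f) (differential_scale (\<delta> f) w)"
begin

text \<open>Relations are closed under scaling, so a nonzero \<open>c\<close> could be inverted.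
  Equations between multiples of \<open>w\<close> can thus be read as equations between
  functions.\<close>

lemma scale_w_eq_0: assumes "differential_scale c w \<in> kaehler_relations K" shows "c = 0"
proof (rule ccontr)
  assume "c \<noteq> 0"
  then have "w \<in> kaehler_relations K"
    using kaehler_scale[OF assms, of "inverse c"] by (simp add: differential_scale_simps)
  then show False using w_nz by (simp add: differential_eq_def)
qed

lemma single_scale: "Poly_Mapping.single f c - differential_scale (c * \<delta> f) w \<in> kaehler_relations K"
  using kaehler_scale[OF \<delta>[of f, unfolded differential_eq_def exact_differential_def], of c]
  by (simp add: differential_scale_simps)

text \<open>Each law for \<open>\<delta>\<close> is the corresponding relation between
  differentials, with every symbol replaced by its multiple of \<open>w\<close> and the coefficients
  compared.\<close>

lemma derivation_of_differential: "derivation \<delta>"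
  unfolding derivation_def
proof (intro conjI allI)
  fix f g :: 'k and c
  have "differential_scale (\<delta> (f + g) - \<delta> f - \<delta> g) w
    = (Poly_Mapping.single (f + g) 1 - Poly_Mapping.single f 1 - Poly_Mapping.single g 1)
      - (Poly_Mapping.single (f + g) 1 - differential_scale (1 * \<delta> (f + g)) w)
      + (Poly_Mapping.single f 1 - differential_scale (1 * \<delta> f) w)
      + (Poly_Mapping.single g 1 - differential_scale (1 * \<delta> g) w)"
    by (simp add: differential_scale_simps)
  also have "\<dots> \<in> kaehler_relations K"
    by (intro kaehler_relations.plus kaehler_diff kaehler_relations.d_add single_scale)
  finally show "\<delta> (f + g) = \<delta> f + \<delta> g" using scale_w_eq_0 by (fastforce simp: algebra_simps)
  have "differential_scale (\<delta> (f * g) - f * \<delta> g - g * \<delta> f) w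
    = (Poly_Mapping.single (f * g) 1 - Poly_Mapping.single g (1 * f) - Poly_Mapping.single f (1 * g))
      - (Poly_Mapping.single (f * g) 1 - differential_scale (1 * \<delta> (f * g)) w)
      + (Poly_Mapping.single g f - differential_scale (f * \<delta> g) w)
      + (Poly_Mapping.single f g - differential_scale (g * \<delta> f) w)"
    by (simp add: differential_scale_simps)
  also have "\<dots> \<in> kaehler_relations K"
    by (intro kaehler_relations.plus kaehler_diff kaehler_relations.d_mult single_scale)
  finally show "\<delta> (f * g) = f * \<delta> g + g * \<delta> f" using scale_w_eq_0 by (fastforce simp: algebra_simps)
  have "differential_scale (\<delta> (h c)) w
    = Poly_Mapping.single (h c) 1 - (Poly_Mapping.single (h c) 1 - differential_scale (1 * \<delta> (h c)) w)"
    by simp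
  also have "\<dots> \<in> kaehler_relations K"
    by (intro kaehler_diff kaehler_relations.d_const single_scale)
  finally show "\<delta> (h c) = 0" by (rule scale_w_eq_0)
qed

text \<open>Replacing each symbol in a local expression of \<open>w\<close> by its multiple of
  \<open>w\<close> and comparing coefficients turns regularity into an equation in the function
  field.\<close>

lemma regular_differential_sum:
  assumes "regular_differential_at K P w"
  obtains n :: nat and f g where "\<And>i. i < n \<Longrightarrow> f i \<in> local_ring K P" "\<And>i. i < n \<Longrightarrow> g i \<in> local_ring K P"
    "(\<Sum>i<n. f i * \<delta> (g i)) = 1"
proof -
  obtain n :: nat and g f where gf: "\<And>i. i < n \<Longrightarrow> g i \<in> local_ring K P \<and> f i \<in> local_ring K P"
    and w: "w - (\<Sum>i<n. Poly_Mapping.single (g i) (f i)) \<in> kaehler_relations K"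
    using assms unfolding regular_differential_at_def differential_eq_def by blast
  have "differential_scale (1 - (\<Sum>i<n. f i * \<delta> (g i))) w
    = (w - (\<Sum>i<n. Poly_Mapping.single (g i) (f i)))
      + (\<Sum>i<n. Poly_Mapping.single (g i) (f i) - differential_scale (f i * \<delta> (g i)) w)"
    by (simp add: differential_scale_simps differential_scale_sum sum_subtractf)
  also have "\<dots> \<in> kaehler_relations K"
    by (intro kaehler_relations.plus w kaehler_sum single_scale)
  finally have "(\<Sum>i<n. f i * \<delta> (g i)) = 1" using scale_w_eq_0 by fastforce
  then show ?thesis using that gf by blast
qed

text \<open>Rescaling \<open>\<delta>\<close> so that \<open>x\<close> is sent to
  \<open>2 * y + A1 * x + A3\<close> gives the invariant derivation \<open>D\<close>. At each point
  the factor \<open>\<theta>\<close> is a sum of products \<open>f i * D (g i)\<close> of regular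
  functions, since \<open>D\<close> preserves local rings; so it is constant.\<close>

lemma global_differential_invariant:
  assumes glob: "w \<in> global_differentials E K"
  obtains c D where "c \<noteq> 0" "inv_der E K D" "\<And>f. D f = h c * \<delta> f"
proof -
  interpret d: ec_der E K \<delta> by unfold_locales (rule derivation_of_differential)
  have reg: "regular_differential_at K P w" if "on_curve E P" for P
    using glob that by (simp add: global_differentials_def curve_points_def)
  \<comment> \<open>If \<open>\<delta> x\<close> were 0, \<open>\<delta>\<close> would be 0, against
    the local expression of \<open>w\<close>.\<close>
  have dx: "\<delta> x \<noteq> 0"
  proof
    assume "\<delta> x = 0"
    then have "\<delta> f = 0" for f by (rule d.D_eq_0)
    moreover obtain n :: nat and f g where "(\<Sum>i<n. f i * \<delta> (g i)) = 1"
      by (rule regular_differential_sum[OF reg[of Origin]]) auto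
    ultimately show False by simp
  qed
  define \<theta> where "\<theta> = (2 * y + A1 * x + A3) / \<delta> x"
  define D where "D f = \<theta> * \<delta> f" for f
  have "derivation D"
    unfolding derivation_def D_def by (simp add: d.D_mult algebra_simps)
  then interpret D: inv_der E K D
    by unfold_locales (use dx in \<open>simp_all add: D_def \<theta>_def\<close>)
  have "\<exists>c. \<theta> = h c"
  proof (rule regular_const)
    fix P assume P: "on_curve E P"
    obtain n :: nat and f g where f: "\<And>i. i < n \<Longrightarrow> f i \<in> local_ring K P"
      and g: "\<And>i. i < n \<Longrightarrow> g i \<in> local_ring K P" and 1: "(\<Sum>i<n. f i * \<delta> (g i)) = 1"
      using regular_differential_sum[OF reg[OF P]] by blast
    have "\<theta> * (\<Sum>i<n. f i * \<delta> (g i)) = (\<Sum>i<n. f i * D (g i))"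
      by (simp add: D_def sum_distrib_left mult.left_commute)
    then have "\<theta> = (\<Sum>i<n. f i * D (g i))" using 1 by simp
    moreover have "D.residue P (\<Sum>i<n. f i * D (g i)) (\<Sum>i<n. 0)"
      by (intro D.residue_sum P) (simp add: D.residue_0_iff D.local_ring_mult D.D_regular P f g)
    ultimately show "\<theta> \<in> local_ring K P" by (simp add: D.residue_0_iff)
  qed
  then obtain c where c: "\<theta> = h c" ..
  have "c \<noteq> 0" using D.psi_nz dx c by (auto simp: \<theta>_def)
  moreover have "inv_der E K D" by unfold_locales
  ultimately show ?thesis using that c D_def by blast
qed

end

end

theorem theorem5p13:
  fixes E :: "'c::{alg_closed_field, field_char_0} weierstrass"
    and K :: "('c, 'k::field) function_field"
    and s :: "'c point"
    and \<tau> \<delta> :: "'k \<Rightarrow> 'k"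
    and w :: "'k \<Rightarrow>\<^sub>0 'k"
    and rep :: "'c point set \<Rightarrow> 'c point"
    and a :: 'k
  assumes "elliptic_curve E"
    and "is_function_field E K"
    and "s \<in> curve_points E" and "\<not> ec_torsion E s"
    and "translation_automorphism E K s \<tau>"
    and "w \<in> global_differentials E K" and "\<not> differential_eq K w 0"
    and "\<And>f. differential_eq K (exact_differential f) (differential_scale (\<delta> f) w)"
    and "\<And>\<omega>. \<omega> \<in> curve_points E // orbit_rel E s \<Longrightarrow> rep \<omega> \<in> \<omega>"
    and "a \<noteq> 0"
  shows "difference_summable \<tau> (\<delta> a / a) \<longleftrightarrow>
     (\<forall>\<omega> \<in> curve_points E // orbit_rel E s. finsupp_sum (\<lambda>\<alpha>. valuation_at K \<alpha> a) \<omega> = 0) \<and>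
     finsupp_sum
       (\<lambda>\<omega>. finsupp_sum
          (\<lambda>n. n * valuation_at K (ec_add E (rep \<omega>) (ec_multiple E n s)) a) (UNIV :: int set))
       (curve_points E // orbit_rel E s) = 0"
proof -
  interpret ec_field E K by unfold_locales (use assms in auto)
  obtain c D where c: "c \<noteq> 0" and D: "inv_der E K D" and Dd: "\<And>f. D f = h c * \<delta> f"
    using global_differential_invariant[OF assms(7,8,6)] by blast
  interpret translation E K D s \<tau>
    using assms(3-5) by (intro translation.intro translation_axioms.intro D) (auto simp: curve_points_def)
  have Da: "Dlog a = h c * (\<delta> a / a)" by (simp add: Dlog_def Dd)
  \<comment> \<open>Multiplying \<open>g\<close> by a constant, which \<open>\<tau>\<close> fixes,
    passes between \<open>D\<close> and \<open>\<delta>\<close>.\<close>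
  have "difference_summable \<tau> (\<delta> a / a) \<longleftrightarrow> (\<exists>g. Dlog a = \<tau> g - g)"
  proof
    assume "difference_summable \<tau> (\<delta> a / a)"
    then obtain g where "\<delta> a / a = \<tau> g - g" unfolding difference_summable_def ..
    then have "Dlog a = \<tau> (h c * g) - h c * g" by (simp add: Da right_diff_distrib)
    then show "\<exists>g. Dlog a = \<tau> g - g" ..
  next
    assume "\<exists>g. Dlog a = \<tau> g - g"
    then obtain g where "Dlog a = \<tau> g - g" ..
    then have "h (inverse c) * (h c * (\<delta> a / a)) = h (inverse c) * (\<tau> g - g)" by (simp only: Da)
    moreover have "h (inverse c) * (h c * (\<delta> a / a)) = \<delta> a / a" using c by simp
    ultimately have "\<delta> a / a = \<tau> (h (inverse c) * g) - h (inverse c) * g"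
      by (simp add: right_diff_distrib)
    then show "difference_summable \<tau> (\<delta> a / a)" unfolding difference_summable_def ..
  qed
  then show ?thesis using Dlog_summable_iff[OF assms(9,10)] by simp
qed

end
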